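(* For every rank array $\mathbf r$ of a Zelevinsky permutation (block sizes $r_0,\ldots,r_n$) and every grassmannian lacing diagram $\underline\mu=(\mu_1,\ldots,\mu_n)$, the integer $(-1)^{l(\underline\mu)-d(\mathbf r)}c_{\underline\mu}(\mathbf r)$ is nonnegative, where $$c_{\underline\mu}(\mathbf r)=\sum_{\mathbf w\in L(\mathbf r)}(-1)^{l(\mathbf w)-d(\mathbf r)}\alpha^{\underline\mu}_{\mathbf w}.$$
   Context: Grothendieck polynomials: for alphabets $\mathbf z,\dot{\mathbf z}$, the Demazure operator is $\pi_i f=\frac{z_{i+1}f(\ldots,z_i,z_{i+1},\ldots)-z_if(\ldots,z_{i+1},z_i,\ldots)}{z_{i+1}-z_i}$; for $v\in S_k$, $\mathcal G_{w_0^k}=\prod_{i+j\le k}(1-z_i/\dot z_j)$ and $\mathcal G_{vs_i}=\pi_i\mathcal G_v$ when $l(vs_i)<l(v)$. A $k\times\ell$ partial permutation is a $0/1$ matrix with at most one $1$ per row and column; $\tilde w\in S_\infty$ is its unique minimal-length completion to a permutation matrix having $w$ as upper-left corner; $\mathcal G_w=\mathcal G_{\tilde w}$. The stable double Grothendieck polynomial is $\hat{\mathcal G}_w=\lim_{m\to\infty}\mathcal G_{m+w}(z_1,\ldots,z_k/\dot z_1,\ldots,\dot z_\ell)$ (remaining variables set to $1$), where $m+w$ has $1$'s at $(p,p)$, $p\le m$, and at $(m+p,m+q)$ for each $1$ of $w$ at $(p,q)$. A permutation is grassmannian if it has at most one descent. It is known that each $\hat{\mathcal G}_w$ has a unique expansion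 $\hat{\mathcal G}_w=\sum_{\mu}\alpha^\mu_w\hat{\mathcal G}_\mu$ over grassmannian permutations $\mu$, with integers $\alpha_w^\mu$. Zelevinsky permutations: fix $r_0,\ldots,r_n$, $d=\sum r_j$; block row $j$ (from top) of a $d\times d$ matrix has height $r_j$, block column $i$ (from the right) has width $r_i$, $B_{ji}$ the corresponding block. A Zelevinsky permutation is a $d\times d$ permutation matrix $v$ with $B_{ji}=0$ for $i\ge j+2$ and $1$'s proceeding northwest to southeast within every block row and block column; its rank array $\mathbf r$ has entries $r_{ij}$ ($i\ge j$) = number of $1$'s in blocks $B_{qp}$ with $q\ge j$, $p\le i$, and determines $v=v(\mathbf r)$. $v(\mathrm{Hom})$ is the unique one with entrywise maximal rank array; $d(\mathbf r)=l(v(\mathbf r))-l(v(\mathrm{Hom}))$. Pipe dreams: a pipe dream is a finite set of boxes (crosses) in a grid; its word lists $s_{i+j-1}$ for each cross at row $i$, column $j$, reading rows right to left, top to bottom; its Demazure product $\delta(P)$ is the product of the word with $s_i^2=s_i$ and braid relations. $\mathcal P(w)=\{P:\delta(P)=\tilde w\}$; $\check P$ is $P$ rotated $180^\circ$. Lacing diagrams: a lacing diagram is $\mathbf w=(w_1,\ldots,w_n)$ with $w_j$ an $r_{j-1}\times r_j$ partial permutation; $l(\mathbf w)=\sum_j l(\tilde w_j)$. For $r_{j-1}\times r_j$ pipe dreams $P_j$, $P(P_1,\ldots,P_n)$ is the $d\times d$ pipe dream consisting of all boxes of blocks $B_{ji}$ with $i\ge j+2$ plus $P_j$ placed in block $B_{j-1,j}$.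 Write $\delta(\mathbf w)=\mathbf r$ if for some (equivalently every) $P_j$ with $\check P_j\in\mathcal P(w_j)$ the Demazure product of $P(P_1,\ldots,P_n)$ equals $v(\mathbf r)$; $L(\mathbf r)=\{\mathbf w:\delta(\mathbf w)=\mathbf r\}$. A lacing diagram $\underline\mu=(\mu_1,\ldots,\mu_n)$ is grassmannian if each $\tilde\mu_j$ is grassmannian; $l(\underline\mu)=\sum_j l(\tilde\mu_j)$, and $\alpha^{\underline\mu}_{\mathbf w}=\prod_{i=1}^n\alpha^{\tilde\mu_i}_{w_i}$.
   Formalization: Rank array entries r_ij are taken for i ≤ j (for i ≥ j, as printed, block sizes force them and v(r) is undetermined); the expansion defining α runs over the distinct nonzero stable polynomials of grassmannian permutations in the k|l variables, since μ and 1+μ give the same one. *)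

theory Defs
  imports
    Complex_Main
    "HOL-Library.Poly_Mapping"
    "HOL-Library.FuncSet"
    "HOL-Combinatorics.Permutations"
begin

section \<open>Permutations and partial permutations\<close>

text \<open>
  Rows, columns and permuted letters are numbered from 1. The group \<open>S\<^sub>\<infinity>\<close> is the set of
  finitely supported permutations of the positive integers. The matrix of \<open>v\<close> has its 1's at
  the positions \<open>(p, v p)\<close>, and products of permutations are compositions of functions.
\<close>

definition S_infty :: "(nat \<Rightarrow> nat) set" where
  "S_infty = {v. \<exists>k. v permutes {1..k}}"

definition perm_length :: "(nat \<Rightarrow> nat) \<Rightarrow> nat" where
  "perm_length v = card {(p, q). p < q \<and> v p > v q}"

definition simple_refl :: "nat \<Rightarrow> nat \<Rightarrow> nat" where
  "simple_refl i = transpose i (Suc i)"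

definition longest_perm :: "nat \<Rightarrow> nat \<Rightarrow> nat" where
  "longest_perm k p = (if p \<in> {1..k} then k + 1 - p else p)"

definition grassmannian :: "(nat \<Rightarrow> nat) \<Rightarrow> bool" where
  "grassmannian v \<longleftrightarrow> v \<in> S_infty \<and> card {p. v p > v (Suc p)} \<le> 1"

text \<open>A 0/1 matrix is represented by the set of positions of its 1's.\<close>

definition partial_perm :: "nat \<Rightarrow> nat \<Rightarrow> (nat \<times> nat) set \<Rightarrow> bool" where
  "partial_perm k l w \<longleftrightarrow>
     w \<subseteq> {1..k} \<times> {1..l} \<and> single_valued w \<and> single_valued (w\<inverse>)"

definition corner :: "nat \<Rightarrow> nat \<Rightarrow> (nat \<Rightarrow> nat) \<Rightarrow> (nat \<times> nat) set" where
  "corner k l v = {(p, q). p \<in> {1..k} \<and> q \<in> {1..l} \<and> v p = q}"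

definition completion :: "nat \<Rightarrow> nat \<Rightarrow> (nat \<times> nat) set \<Rightarrow> nat \<Rightarrow> nat" where
  "completion k l w = (THE v. v \<in> S_infty \<and> corner k l v = w \<and>
     (\<forall>u\<in>S_infty. corner k l u = w \<longrightarrow> perm_length v \<le> perm_length u))"

text \<open>The matrix \<open>m + w\<close>, for partial permutations and for permutations in \<open>S\<^sub>\<infinity>\<close>.\<close>

definition shift_partial :: "nat \<Rightarrow> (nat \<times> nat) set \<Rightarrow> (nat \<times> nat) set" where
  "shift_partial m w = {(p, p) | p. p \<in> {1..m}} \<union> {(m + p, m + q) | p q. (p, q) \<in> w}"

definition shift_perm :: "nat \<Rightarrow> (nat \<Rightarrow> nat) \<Rightarrow> nat \<Rightarrow> nat" where
  "shift_perm m v p = (if p \<le> m then p else m + v (p - m))"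


section \<open>Double Grothendieck polynomials\<close>

text \<open>
  Grothendieck polynomials live in the ring of Laurent polynomials with integer coefficients in
  the two alphabets \<open>Z 1, Z 2, \<dots>\<close> (undotted) and \<open>Zd 1, Zd 2, \<dots>\<close> (dotted), that is, in the
  monoid ring over \<open>\<int>\<close> of the group of finitely supported integer exponent vectors.
\<close>

datatype var = Z nat | Zd nat

type_synonym laurent = "(var \<Rightarrow>\<^sub>0 int) \<Rightarrow>\<^sub>0 int"

definition var_pow :: "var \<Rightarrow> int \<Rightarrow> laurent" where
  "var_pow x e = Poly_Mapping.single (Poly_Mapping.single x e) 1"

fun swap_var :: "nat \<Rightarrow> var \<Rightarrow> var" where
  "swap_var i (Z j) = Z (simple_refl i j)"
| "swap_var i (Zd j) = Zd j"

text \<open>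
  Interchange of \<open>Z i\<close> and \<open>Z (i + 1)\<close>. Since \<open>map_key\<close> precomposes with its argument and
  the interchange is an involution, this is the substitution itself.
\<close>

definition swap_vars :: "nat \<Rightarrow> laurent \<Rightarrow> laurent" where
  "swap_vars i = Poly_Mapping.map_key (Poly_Mapping.map_key (swap_var i))"

text \<open>
  The quotient by \<open>z\<^bsub>i+1\<^esub> - z\<^sub>i\<close> is exact, and unique because Laurent polynomials form an
  integral domain.
\<close>

definition demazure_op :: "nat \<Rightarrow> laurent \<Rightarrow> laurent" where
  "demazure_op i f = (THE g. (var_pow (Z (Suc i)) 1 - var_pow (Z i) 1) * g =
     var_pow (Z (Suc i)) 1 * f - var_pow (Z i) 1 * swap_vars i f)"

inductive is_groth :: "nat \<Rightarrow> (nat \<Rightarrow> nat) \<Rightarrow> laurent \<Rightarrow> bool" for k where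
  longest: "is_groth k (longest_perm k)
     (\<Prod>(i, j) | 1 \<le> i \<and> 1 \<le> j \<and> i + j \<le> k. 1 - var_pow (Z i) 1 * var_pow (Zd j) (- 1))"
| descend: "is_groth k v f \<Longrightarrow> 1 \<le> i \<Longrightarrow> i < k \<Longrightarrow>
     perm_length (v \<circ> simple_refl i) < perm_length v \<Longrightarrow>
     is_groth k (v \<circ> simple_refl i) (demazure_op i f)"

text \<open>
  The polynomial depends neither on the chain of simple reflections leading from the longest
  element down to \<open>v\<close> nor on the \<open>k\<close> for which \<open>v\<close> is regarded as an element of \<open>S\<^sub>k\<close>.
\<close>

definition groth :: "(nat \<Rightarrow> nat) \<Rightarrow> laurent" where
  "groth v = (THE f. \<exists>k. is_groth k v f)"

definition groth_partial :: "nat \<Rightarrow> nat \<Rightarrow> (nat \<times> nat) set \<Rightarrow> laurent" where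
  "groth_partial k l w = groth (completion k l w)"


section \<open>Stable double Grothendieck polynomials\<close>

text \<open>Setting all variables outside \<open>V\<close> to 1.\<close>

definition specialize :: "var set \<Rightarrow> laurent \<Rightarrow> laurent" where
  "specialize V f = (\<Sum>m\<in>Poly_Mapping.keys f.
     Poly_Mapping.single
       (\<Sum>x\<in>Poly_Mapping.keys m \<inter> V. Poly_Mapping.single x (Poly_Mapping.lookup m x))
       (Poly_Mapping.lookup f m))"

definition alphabets :: "nat \<Rightarrow> nat \<Rightarrow> var set" where
  "alphabets k l = Z ` {1..k} \<union> Zd ` {1..l}"

text \<open>
  In finitely many variables the sequences of which stable Grothendieck polynomials are limits
  are eventually constant, so the limit is taken in the discrete topology.
\<close>

definition stable_limit :: "nat \<Rightarrow> nat \<Rightarrow> (nat \<Rightarrow> laurent) \<Rightarrow> laurent" where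
  "stable_limit k l G = (THE g. \<forall>\<^sub>F m in sequentially. specialize (alphabets k l) (G m) = g)"

definition stable_groth_partial :: "nat \<Rightarrow> nat \<Rightarrow> (nat \<times> nat) set \<Rightarrow> laurent" where
  "stable_groth_partial k l w =
     stable_limit k l (\<lambda>m. groth_partial (m + k) (m + l) (shift_partial m w))"

definition stable_groth :: "nat \<Rightarrow> nat \<Rightarrow> (nat \<Rightarrow> nat) \<Rightarrow> laurent" where
  "stable_groth k l v = stable_limit k l (\<lambda>m. groth (shift_perm m v))"

text \<open>
  Grassmannian permutations \<open>\<mu>\<close> and \<open>1 + \<mu>\<close> have the same stable polynomial, and the stable
  polynomials of those whose partition contains a \<open>(k+1) \<times> (l+1)\<close> rectangle vanish in \<open>k\<close>
  undotted and \<open>l\<close> dotted variables. Uniqueness of the expansion therefore means that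
  the nonzero stable polynomials of grassmannian permutations, each of them counted once, are
  linearly independent over \<open>\<int>\<close>; the coefficient on \<open>\<mu>\<close> is the one on the polynomial
  of \<open>\<mu>\<close>.
\<close>

definition grassmannian_basis :: "nat \<Rightarrow> nat \<Rightarrow> laurent set" where
  "grassmannian_basis k l = stable_groth k l ` {\<mu>. grassmannian \<mu>} - {0}"

interpretation laurent: module "\<lambda>(c :: int) (f :: laurent). of_int c * f"
  by unfold_locales (simp_all add: algebra_simps)

definition alpha :: "nat \<Rightarrow> nat \<Rightarrow> (nat \<times> nat) set \<Rightarrow> (nat \<Rightarrow> nat) \<Rightarrow> int" where
  "alpha k l w \<mu> =
     laurent.representation (grassmannian_basis k l) (stable_groth_partial k l w)
       (stable_groth k l \<mu>)"


section \<open>Zelevinsky permutations\<close>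

text \<open>
  The block sizes are \<open>r 0, \<dots>, r n\<close>. Block rows are numbered from the top, block
  columns from the right.
\<close>

definition total_size :: "nat \<Rightarrow> (nat \<Rightarrow> nat) \<Rightarrow> nat" where
  "total_size n r = (\<Sum>j\<le>n. r j)"

definition row_offset :: "(nat \<Rightarrow> nat) \<Rightarrow> nat \<Rightarrow> nat" where
  "row_offset r j = (\<Sum>q<j. r q)"

definition col_offset :: "nat \<Rightarrow> (nat \<Rightarrow> nat) \<Rightarrow> nat \<Rightarrow> nat" where
  "col_offset n r i = (\<Sum>q\<in>{i<..n}. r q)"

definition row_block :: "(nat \<Rightarrow> nat) \<Rightarrow> nat \<Rightarrow> nat set" where
  "row_block r j = {row_offset r j <.. row_offset r j + r j}"

definition col_block :: "nat \<Rightarrow> (nat \<Rightarrow> nat) \<Rightarrow> nat \<Rightarrow> nat set" where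
  "col_block n r i = {col_offset n r i <.. col_offset n r i + r i}"

definition zelevinsky :: "nat \<Rightarrow> (nat \<Rightarrow> nat) \<Rightarrow> (nat \<Rightarrow> nat) \<Rightarrow> bool" where
  "zelevinsky n r v \<longleftrightarrow>
     v permutes {1..total_size n r} \<and>
     (\<forall>i\<le>n. \<forall>j. j + 2 \<le> i \<longrightarrow> (\<forall>p\<in>row_block r j. v p \<notin> col_block n r i)) \<and>
     (\<forall>j\<le>n. strict_mono_on (row_block r j) v) \<and>
     (\<forall>i\<le>n. strict_mono_on (col_block n r i) (inv v))"

definition rank_entry :: "nat \<Rightarrow> (nat \<Rightarrow> nat) \<Rightarrow> (nat \<Rightarrow> nat) \<Rightarrow> nat \<Rightarrow> nat \<Rightarrow> nat" where
  "rank_entry n r v i j =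
     card {p. p \<in> (\<Union>q\<in>{j..n}. row_block r q) \<and> v p \<in> (\<Union>m\<in>{..i}. col_block n r m)}"

text \<open>
  The entries of a rank array are indexed by \<open>i \<le> j \<le> n\<close>. For \<open>i > j\<close> the same
  count has the same value for all Zelevinsky permutations, because the 1's
  outside the region are exactly the 1's in block rows above \<open>j\<close> together with the 1's in block
  columns to the left of \<open>i\<close>, and no 1 is of both kinds.
\<close>

definition has_rank_array ::
  "nat \<Rightarrow> (nat \<Rightarrow> nat) \<Rightarrow> (nat \<Rightarrow> nat) \<Rightarrow> (nat \<Rightarrow> nat \<Rightarrow> nat) \<Rightarrow> bool" where
  "has_rank_array n r v R \<longleftrightarrow> (\<forall>j\<le>n. \<forall>i\<le>j. R i j = rank_entry n r v i j)"

definition is_rank_array :: "nat \<Rightarrow> (nat \<Rightarrow> nat) \<Rightarrow> (nat \<Rightarrow> nat \<Rightarrow> nat) \<Rightarrow> bool" where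
  "is_rank_array n r R \<longleftrightarrow> (\<exists>v. zelevinsky n r v \<and> has_rank_array n r v R)"

definition zel_perm :: "nat \<Rightarrow> (nat \<Rightarrow> nat) \<Rightarrow> (nat \<Rightarrow> nat \<Rightarrow> nat) \<Rightarrow> nat \<Rightarrow> nat" where
  "zel_perm n r R = (THE v. zelevinsky n r v \<and> has_rank_array n r v R)"

definition zel_Hom :: "nat \<Rightarrow> (nat \<Rightarrow> nat) \<Rightarrow> nat \<Rightarrow> nat" where
  "zel_Hom n r = (THE v. zelevinsky n r v \<and>
     (\<forall>u. zelevinsky n r u \<longrightarrow> (\<forall>j\<le>n. \<forall>i\<le>j. rank_entry n r u i j \<le> rank_entry n r v i j)))"

definition codim :: "nat \<Rightarrow> (nat \<Rightarrow> nat) \<Rightarrow> (nat \<Rightarrow> nat \<Rightarrow> nat) \<Rightarrow> int" where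
  "codim n r R = int (perm_length (zel_perm n r R)) - int (perm_length (zel_Hom n r))"


section \<open>Pipe dreams\<close>

text \<open>Equality of the products of two words, subject to \<open>s\<^sub>i s\<^sub>i = s\<^sub>i\<close> and the braid relations.\<close>

inductive hecke_equiv :: "nat list \<Rightarrow> nat list \<Rightarrow> bool" where
  refl: "hecke_equiv a a"
| sym: "hecke_equiv a b \<Longrightarrow> hecke_equiv b a"
| trans: "hecke_equiv a b \<Longrightarrow> hecke_equiv b c \<Longrightarrow> hecke_equiv a c"
| idem: "hecke_equiv (a @ [i, i] @ b) (a @ [i] @ b)"
| commute: "i + 2 \<le> j \<Longrightarrow> hecke_equiv (a @ [i, j] @ b) (a @ [j, i] @ b)"
| braid: "hecke_equiv (a @ [i, Suc i, i] @ b) (a @ [Suc i, i, Suc i] @ b)"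

definition word_prod :: "nat list \<Rightarrow> nat \<Rightarrow> nat" where
  "word_prod a = foldr (\<lambda>i v. simple_refl i \<circ> v) a id"

definition reduced_word :: "nat list \<Rightarrow> (nat \<Rightarrow> nat) \<Rightarrow> bool" where
  "reduced_word a v \<longleftrightarrow> word_prod a = v \<and> length a = perm_length v"

text \<open>
  The relations rewrite every word into a reduced word, and all reduced words
  obtained in this way belong to the same permutation.
\<close>

definition demazure_product :: "nat list \<Rightarrow> nat \<Rightarrow> nat" where
  "demazure_product a = (THE v. \<exists>b. hecke_equiv a b \<and> reduced_word b v)"

definition pd_word :: "nat \<Rightarrow> nat \<Rightarrow> (nat \<times> nat) set \<Rightarrow> nat list" where
  "pd_word k l P = [i + j - 1. i \<leftarrow> [1..<Suc k], j \<leftarrow> rev [1..<Suc l], (i, j) \<in> P]"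

text \<open>The pipe dreams for \<open>w\<close> that fit into the \<open>k \<times> l\<close> grid.\<close>

definition pipe_dreams :: "nat \<Rightarrow> nat \<Rightarrow> (nat \<times> nat) set \<Rightarrow> (nat \<times> nat) set set" where
  "pipe_dreams k l w =
     {P. P \<subseteq> {1..k} \<times> {1..l} \<and> demazure_product (pd_word k l P) = completion k l w}"

definition rotate_pd :: "nat \<Rightarrow> nat \<Rightarrow> (nat \<times> nat) set \<Rightarrow> (nat \<times> nat) set" where
  "rotate_pd k l P = (\<lambda>(i, j). (k + 1 - i, l + 1 - j)) ` P"


section \<open>Lacing diagrams\<close>

definition lacing_diagrams :: "nat \<Rightarrow> (nat \<Rightarrow> nat) \<Rightarrow> (nat \<Rightarrow> (nat \<times> nat) set) set" where
  "lacing_diagrams n r = Pi\<^sub>E {1..n} (\<lambda>j. {w. partial_perm (r (j - 1)) (r j) w})"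

definition lacing_completion ::
  "(nat \<Rightarrow> nat) \<Rightarrow> (nat \<Rightarrow> (nat \<times> nat) set) \<Rightarrow> nat \<Rightarrow> nat \<Rightarrow> nat" where
  "lacing_completion r w j = completion (r (j - 1)) (r j) (w j)"

definition lacing_length :: "nat \<Rightarrow> (nat \<Rightarrow> nat) \<Rightarrow> (nat \<Rightarrow> (nat \<times> nat) set) \<Rightarrow> nat" where
  "lacing_length n r w = (\<Sum>j\<in>{1..n}. perm_length (lacing_completion r w j))"

definition grassmannian_lacing_diagrams ::
  "nat \<Rightarrow> (nat \<Rightarrow> nat) \<Rightarrow> (nat \<Rightarrow> (nat \<times> nat) set) set" where
  "grassmannian_lacing_diagrams n r =
     {\<mu> \<in> lacing_diagrams n r. \<forall>j\<in>{1..n}. grassmannian (lacing_completion r \<mu> j)}"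

text \<open>The pipe dream \<open>P(P\<^sub>1, \<dots>, P\<^sub>n)\<close>: \<open>P\<^sub>j\<close> is placed in block row \<open>j - 1\<close> and block column \<open>j\<close>.\<close>

definition assembled_pd ::
  "nat \<Rightarrow> (nat \<Rightarrow> nat) \<Rightarrow> (nat \<Rightarrow> (nat \<times> nat) set) \<Rightarrow> (nat \<times> nat) set" where
  "assembled_pd n r P =
     (\<Union>i\<in>{..n}. \<Union>j\<in>{j. j + 2 \<le> i}. row_block r j \<times> col_block n r i) \<union>
     (\<Union>j\<in>{1..n}. (\<lambda>(p, q). (row_offset r (j - 1) + p, col_offset n r j + q)) ` P j)"

definition lacings_of_rank ::
  "nat \<Rightarrow> (nat \<Rightarrow> nat) \<Rightarrow> (nat \<Rightarrow> nat \<Rightarrow> nat) \<Rightarrow> (nat \<Rightarrow> (nat \<times> nat) set) set" where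
  "lacings_of_rank n r R = {w \<in> lacing_diagrams n r. \<exists>P.
     (\<forall>j\<in>{1..n}. P j \<subseteq> {1..r (j - 1)} \<times> {1..r j} \<and>
        rotate_pd (r (j - 1)) (r j) (P j) \<in> pipe_dreams (r (j - 1)) (r j) (w j)) \<and>
     demazure_product (pd_word (total_size n r) (total_size n r) (assembled_pd n r P))
       = zel_perm n r R}"

definition lacing_alpha ::
  "nat \<Rightarrow> (nat \<Rightarrow> nat) \<Rightarrow> (nat \<Rightarrow> (nat \<times> nat) set) \<Rightarrow> (nat \<Rightarrow> (nat \<times> nat) set) \<Rightarrow> int" where
  "lacing_alpha n r w \<mu> =
     (\<Prod>j\<in>{1..n}. alpha (r (j - 1)) (r j) (w j) (lacing_completion r \<mu> j))"

text \<open>\<open>(-1)\<^sup>e\<close> for a possibly negative integer exponent \<open>e\<close>.\<close>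

definition sign_pow :: "int \<Rightarrow> int" where
  "sign_pow e = (if even e then 1 else - 1)"

definition c_coeff ::
  "nat \<Rightarrow> (nat \<Rightarrow> nat) \<Rightarrow> (nat \<Rightarrow> (nat \<times> nat) set) \<Rightarrow> (nat \<Rightarrow> nat \<Rightarrow> nat) \<Rightarrow> int" where
  "c_coeff n r \<mu> R = (\<Sum>w\<in>lacings_of_rank n r R.
     sign_pow (int (lacing_length n r w) - codim n r R) * lacing_alpha n r w \<mu>)"

end

theory Submission
  imports Defs
begin

text \<open>
  Up to sign, \<open>c\<^sub>\<mu>(r)\<close> is a sum of products of coefficients \<open>\<alpha>\<close>, so it suffices that the
  expansion of a stable Grothendieck polynomial into Grassmannian ones alternates in sign. The
  argument is Lascoux's transition. Applying Demazure operators to the product formula for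
  \<open>w\<^sub>0\<close> gives a K-theoretic Monk formula for double Grothendieck polynomials; at the last descent
  \<open>r\<close> of \<open>w\<close> it reads
  \<open>G\<^sub>w = G\<^sub>v - z\<^sub>r/zd\<^bsub>v(r)\<^esub> (G\<^sub>v - \<Sum>G\<^bsub>v'\<^esub> + \<Sum>G\<^bsub>v''\<^esub> - \<dots>)\<close>, the sums being over chains of
  covers of \<open>v\<close>. Stably the leading factor becomes 1, the two copies of \<open>G\<^sub>v\<close>
  cancel, and an alternating sum remains. Shifting \<open>w\<close> by one before each step keeps
  chains available; each step lowers the entry of the code at \<open>r\<close> and keeps \<open>w\<close> increasing up
  to a fixed position \<open>f < r\<close>, so the recursion ends in permutations whose only descent is at \<open>f\<close>.

  The coefficient is attached to a polynomial and not to a permutation, so one also needs that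
  the polynomial determines the parity of the length. This follows from positivity: by the
  unspecialized transition, \<open>(-1)\<close> to the length times \<open>G\<^sub>w\<close> has nonnegative coefficients in the
  variables \<open>z\<^sub>i - 1\<close> and \<open>1/zd\<^sub>j - 1\<close>.
\<close>


section \<open>Substitutions and Demazure operators on Laurent polynomials\<close>

text \<open>Three obstacles shape the development. Grothendieck polynomials, stable limits and
  completions are all given by \<open>THE\<close>, so each needs a uniqueness argument before it can
  be used. The defining operators act on the undotted variables only, whereas stability under
  shifting needs symmetry in both alphabets; the analogous operators in 1/zd are therefore
  introduced and shown to act on permutations by multiplication from the left. Finally, the Monk
  formula must be in a form that every Demazure operator preserves. Equating z_r/zd_(v r) times the
  left chains with the right chains is such a form, and both sides can be followed through a single
  step.

  The limit disappears early: for permutations that fix 1, ..., max k l the specialization to k and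
  l variables is already the stable polynomial. For the same reason the two variables of the
  transition factor lie outside the alphabets and become 1.\<close>

instantiation var :: linorder
begin

text \<open>A linear order on the variables turns exponent vectors into a linearly ordered abelian
  group, so that Laurent polynomials have leading monomials and these multiply. This serves the
  proof that \<open>pos_cone\<close> contains no nonzero f together with - f.\<close>

fun var_code :: "var \<Rightarrow> nat" where
  "var_code (Z i) = 2 * i"
| "var_code (Zd i) = 2 * i + 1"

definition "x < y \<longleftrightarrow> var_code x < var_code y"
definition "x \<le> y \<longleftrightarrow> var_code x \<le> var_code y"

lemma var_code_inject: "var_code x = var_code y \<Longrightarrow> x = y"
  by (cases x; cases y) (auto, presburger+)

instance
  by intro_classes (auto simp: less_var_def less_eq_var_def intro: var_code_inject)

end

text \<open>Both layers of \<open>laurent\<close> are free abelian groups: monomials on the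
  variables, polynomials on the monomials. Applying \<open>frag_extend\<close> twice therefore gives
  the ring homomorphism that sends each variable to a Laurent monomial. Renaming variables,
  inverting them and setting them to 1 (the monomial 0) are all of this kind.\<close>

definition subst :: "(var \<Rightarrow> var \<Rightarrow>\<^sub>0 int) \<Rightarrow> laurent \<Rightarrow> laurent" where
  "subst g = frag_extend (\<lambda>m. frag_of (frag_extend g m))"

lemma frag_of_add: "frag_of (m + m') = (frag_of m * frag_of m' :: laurent)"
  by (simp add: mult_single)

lemma subst_0 [simp]: "subst g 0 = 0"
  and subst_add: "subst g (f + h) = subst g f + subst g h"
  and subst_diff: "subst g (f - h) = subst g f - subst g h"
  and subst_uminus: "subst g (- f) = - subst g f"
  by (simp_all add: subst_def frag_extend_add frag_extend_diff frag_extend_minus)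

lemma subst_frag_of: "subst g (frag_of m) = frag_of (frag_extend g m)"
  by (simp add: subst_def)

lemma subst_1 [simp]: "subst g 1 = 1"
  using subst_frag_of[of g 0] by simp

lemma laurent_induct [case_names zero mono diff]:
  assumes "P 0" "\<And>m. P (frag_of m)" "\<And>f h. P f \<Longrightarrow> P h \<Longrightarrow> P (f - h)"
  shows "P (f :: laurent)"
  by (rule frag_induction[of f UNIV P]) (use assms in auto)

lemma subst_mult: "subst g (f * h) = subst g f * subst g h"
proof (induction f rule: laurent_induct)
  case (mono m)
  show ?case
    by (induction h rule: laurent_induct)
      (simp_all add: right_diff_distrib subst_diff frag_of_add[symmetric] subst_frag_of frag_extend_add)
qed (simp_all add: left_diff_distrib subst_diff)

lemma subst_prod: "subst g (prod f A) = (\<Prod>x\<in>A. subst g (f x))"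
  by (induction A rule: infinite_finite_induct) (simp_all add: subst_mult)

lemma var_pow_cmul: "Poly_Mapping.single x e = frag_cmul e (frag_of x)"
  by (rule poly_mapping_eqI) (simp add: lookup_single when_def)

lemma subst_var_pow: "subst g (var_pow x e) = frag_of (frag_cmul e (g x))"
  by (simp add: var_pow_def subst_frag_of var_pow_cmul[of x e] frag_extend_cmul)

lemma subst_subst: "subst g (subst h f) = subst (\<lambda>x. frag_extend g (h x)) f"
proof -
  have "frag_extend g (frag_extend h m) = frag_extend (\<lambda>x. frag_extend g (h x)) m" for m
    using frag_extend_compose[of g] 
    by (rule_tac frag_induction[of m UNIV]) (simp_all add: frag_extend_diff)
  then show ?thesis
    by (induction f rule: laurent_induct) (simp_all add: subst_frag_of subst_diff)
qed

lemma subst_frag_of_id [simp]: "subst frag_of f = f"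
  by (induction f rule: laurent_induct)
    (simp_all add: subst_frag_of subst_diff frag_expansion[symmetric])

abbreviation rename :: "(var \<Rightarrow> var) \<Rightarrow> laurent \<Rightarrow> laurent" where
  "rename s \<equiv> subst (\<lambda>x. frag_of (s x))"

lemma rename_var_pow: "rename s (var_pow x e) = var_pow (s x) e"
  unfolding subst_var_pow unfolding var_pow_cmul[symmetric] var_pow_def by (rule HOL.refl)

text \<open>\<open>map_key\<close> is precomposition and moves keys along the inverse of s, while
  \<open>frag_extend\<close> moves them along s; for an involution the two agree.\<close>

lemma map_key_eq_frag_extend:
  assumes "bij s" "\<And>x. s (s x) = x"
  shows "Poly_Mapping.map_key s m = frag_extend (\<lambda>x. frag_of (s x)) m"
proof -
  have inj: "inj s" using assms(1) bij_is_inj by blast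
  show ?thesis
  proof (rule frag_induction[of m UNIV])
    fix x
    have "Poly_Mapping.map_key s (Poly_Mapping.single (s (s x)) 1) = frag_of (s x)"
      using map_key_single[OF inj, of "s x" "1::int"] by simp
    then show "Poly_Mapping.map_key s (frag_of x) = frag_extend (\<lambda>x. frag_of (s x)) (frag_of x)"
      using assms(2) by simp
  next
    have *: "Poly_Mapping.map_key s (a - b) = Poly_Mapping.map_key s a - Poly_Mapping.map_key s b"
      for a b :: "'a \<Rightarrow>\<^sub>0 int"
      by (rule poly_mapping_eqI) (simp add: map_key.rep_eq[OF inj] lookup_minus)
    show "Poly_Mapping.map_key s (a - b) = frag_extend (\<lambda>x. frag_of (s x)) (a - b)"
      if "Poly_Mapping.map_key s a = frag_extend (\<lambda>x. frag_of (s x)) a"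
         "Poly_Mapping.map_key s b = frag_extend (\<lambda>x. frag_of (s x)) b" for a b
      using that by (simp add: * frag_extend_diff)
  qed (use inj in auto)
qed

lemma swap_var_invol [simp]: "swap_var i (swap_var i x) = x"
  by (cases x) (simp_all add: simple_refl_def)

lemma bij_if_invol: "(\<And>x. s (s x) = x) \<Longrightarrow> bij s"
  by (metis bij_iff)

lemma swap_vars_eq: "swap_vars i = rename (swap_var i)"
proof
  fix f
  have key: "Poly_Mapping.map_key (swap_var i) = frag_extend (\<lambda>x. frag_of (swap_var i x))" 
    by (rule ext, rule map_key_eq_frag_extend) (auto intro: bij_if_invol)
  have "Poly_Mapping.map_key (swap_var i) (Poly_Mapping.map_key (swap_var i) (m :: var \<Rightarrow>\<^sub>0 int)) = m" for m
    using bij_is_inj[OF bij_if_invol[of "swap_var i"]]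
    by (intro poly_mapping_eqI) (simp add: map_key.rep_eq)
  then show "swap_vars i f = rename (swap_var i) f"
    unfolding swap_vars_def subst_def
    by (subst map_key_eq_frag_extend) (auto intro: bij_if_invol simp: key)
qed

lemma specialize_eq: "specialize V = subst (\<lambda>x. if x \<in> V then frag_of x else 0)"
proof
  fix f
  have *: "frag_extend (\<lambda>x. if x \<in> V then frag_of x else 0) m =
      (\<Sum>x\<in>Poly_Mapping.keys m \<inter> V. Poly_Mapping.single x (Poly_Mapping.lookup m x))" for m
    unfolding frag_extend_def
    by (subst sum.inter_restrict) (auto intro!: sum.cong var_pow_cmul[symmetric])
  show "specialize V f = subst (\<lambda>x. if x \<in> V then frag_of x else 0) f"
    unfolding specialize_def subst_def *[symmetric] frag_extend_def[of _ f]
    by (intro sum.cong HOL.refl var_pow_cmul)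
qed

lemma var_pow_add: "var_pow x (d + e) = var_pow x d * var_pow x e"
  by (simp add: var_pow_def single_add frag_of_add)

lemma var_pow_0 [simp]: "var_pow x 0 = 1"
  by (simp add: var_pow_def)

lemma var_pow_inverse: "var_pow x e * var_pow x (- e) = 1" "var_pow x (- e) * var_pow x e = 1"
  by (simp_all flip: var_pow_add)

lemma var_pow_eq_iff: "e \<noteq> 0 \<Longrightarrow> var_pow x e = var_pow y e \<longleftrightarrow> x = y"
proof -
  assume "e \<noteq> 0"
  have "Poly_Mapping.single x e = Poly_Mapping.single y e \<longleftrightarrow> x = y"
    by (metis \<open>e \<noteq> 0\<close> keys_single singleton_inject)
  then show ?thesis
    unfolding var_pow_def by (metis frag_of_eq)
qed

abbreviation zv :: "nat \<Rightarrow> laurent" where "zv i \<equiv> var_pow (Z i) 1"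
abbreviation yv :: "nat \<Rightarrow> laurent" where "yv j \<equiv> var_pow (Zd j) (- 1)"

text \<open>The exponent e lets one theory serve both alphabets: rows use the variables z
  themselves, columns the inverses 1/zd, and \<open>D\<close> is the Demazure operator in a and
  b.\<close>

locale exchange =
  fixes \<sigma> :: "laurent \<Rightarrow> laurent" and a b :: laurent and x y :: var and e :: int
  assumes \<sigma>: "\<sigma> = rename (transpose x y)" and a: "a = var_pow x e" and b: "b = var_pow y e"
    and ne: "x \<noteq> y" and e: "e = 1 \<or> e = - 1"
begin

lemma hom [simp]:
  "\<sigma> 0 = 0" "\<sigma> 1 = 1" "\<sigma> (f + g) = \<sigma> f + \<sigma> g" "\<sigma> (f - g) = \<sigma> f - \<sigma> g" "\<sigma> (f * g) = \<sigma> f * \<sigma> g"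
  "\<sigma> (- f) = - \<sigma> f"
  "\<sigma> a = b" "\<sigma> b = a"
  by (simp_all add: \<sigma> subst_add subst_diff subst_mult subst_uminus a b rename_var_pow)

lemma invol [simp]: "\<sigma> (\<sigma> f) = f"
  by (simp add: \<sigma> subst_subst)

lemma neq: "b - a \<noteq> 0"
  using e ne by (auto simp: a b var_pow_eq_iff)

text \<open>The map f - \<sigma> f obeys a twisted Leibniz rule, so it is enough to treat variables
  and their inverses. For exponent - e the difference of x and y powers is b - a times a
  unit.\<close>

lemma dvd: "b - a dvd f - \<sigma> f"
proof -
  have mult: "b - a dvd f * g - \<sigma> (f * g)" if "b - a dvd f - \<sigma> f" "b - a dvd g - \<sigma> g" for f g
  proof -
    have "f * g - \<sigma> (f * g) = (f - \<sigma> f) * g + \<sigma> f * (g - \<sigma> g)"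
      by (simp add: algebra_simps)
    then show ?thesis using that by (metis dvd_add dvd_mult dvd_mult2)
  qed
  have pow: "b - a dvd var_pow v d - \<sigma> (var_pow v d)" if "d = 1 \<or> d = - 1" for v d
  proof -
    have *: "b - a dvd var_pow x d - var_pow y d"
    proof (cases "d = e")
      case True
      then have "var_pow x d - var_pow y d = (b - a) * (- 1)" by (simp add: a b)
      then show ?thesis by (metis dvd_triv_left)
    next
      case False
      with that e have d: "d = - e" by auto
      have "var_pow x d - var_pow y d = (b - a) * (var_pow x d * var_pow y d)"
        using var_pow_inverse[of x e] var_pow_inverse[of y e]
        unfolding a b d by algebra
      then show ?thesis by simp
    qed
    then have "b - a dvd var_pow y d - var_pow x d"
      by (metis dvd_minus_iff minus_diff_eq)
    with * show ?thesis
      by (auto simp: \<sigma> rename_var_pow transpose_def)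
  qed
  \<comment> \<open>Both m and - m are carried along because the induction passes to m - m', whose
    monomial is the product of those of m and - m'.\<close>
  have mono: "b - a dvd frag_of m - \<sigma> (frag_of m) \<and> b - a dvd frag_of (- m) - \<sigma> (frag_of (- m))" for m
  proof (rule frag_induction[of m UNIV])
    show "b - a dvd frag_of 0 - \<sigma> (frag_of 0) \<and> b - a dvd frag_of (- 0) - \<sigma> (frag_of (- 0))" by simp
  next
    fix v
    show "b - a dvd frag_of (frag_of v) - \<sigma> (frag_of (frag_of v)) \<and>
        b - a dvd frag_of (- frag_of v) - \<sigma> (frag_of (- frag_of v))"
      using pow[of 1 v] pow[of "-1" v] by (simp add: var_pow_def single_uminus)
  next
    fix m m' :: "var \<Rightarrow>\<^sub>0 int"
    assume "b - a dvd frag_of m - \<sigma> (frag_of m) \<and> b - a dvd frag_of (- m) - \<sigma> (frag_of (- m))"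
      "b - a dvd frag_of m' - \<sigma> (frag_of m') \<and> b - a dvd frag_of (- m') - \<sigma> (frag_of (- m'))"
    then show "b - a dvd frag_of (m - m') - \<sigma> (frag_of (m - m')) \<and> 
        b - a dvd frag_of (- (m - m')) - \<sigma> (frag_of (- (m - m')))"
      using mult[of "frag_of m" "frag_of (- m')"] mult[of "frag_of m'" "frag_of (- m)"]
        frag_of_add[of m "- m'"] frag_of_add[of m' "- m"] by simp
  qed simp
  show ?thesis
  proof (induction f rule: laurent_induct)
    case (diff f h)
    have "f - h - \<sigma> (f - h) = (f - \<sigma> f) - (h - \<sigma> h)" by simp
    then show ?case using diff by (metis dvd_diff)
  qed (use mono in auto)
qed

definition D :: "laurent \<Rightarrow> laurent" where
  "D f = (THE g. (b - a) * g = b * f - a * \<sigma> f)"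

lemma cancel: "(b - a) * f = (b - a) * g \<Longrightarrow> f = g"
  using neq by simp

lemma D_eqI:
  assumes "(b - a) * g = b * f - a * \<sigma> f"
  shows "D f = g"
  unfolding D_def
proof (rule the_equality, rule assms)
  fix h assume "(b - a) * h = b * f - a * \<sigma> f"
  then show "h = g" using assms cancel by metis
qed

lemma D_rel: "(b - a) * D f = b * f - a * \<sigma> f"
proof -
  have "b * f - a * \<sigma> f = (b - a) * f + a * (f - \<sigma> f)" by (simp add: algebra_simps)
  then have "b - a dvd b * f - a * \<sigma> f" using dvd[of f] by (metis dvd_add dvd_mult dvd_triv_left)
  then obtain g where "b * f - a * \<sigma> f = (b - a) * g" by blast
  then show ?thesis using D_eqI[of g f] by simp
qed

lemma D_invariant [simp]: "\<sigma> (D f) = D f"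
proof (rule cancel)
  have "\<sigma> ((b - a) * D f) = \<sigma> (b * f - a * \<sigma> f)" by (simp only: D_rel)
  then have "(a - b) * \<sigma> (D f) = a * \<sigma> f - b * f"
    by (simp only: hom invol)
  then show "(b - a) * \<sigma> (D f) = (b - a) * D f"
    unfolding D_rel by algebra
qed

lemma D_mult_invariant: 
  assumes "\<sigma> h = h"
  shows "D (h * f) = h * D f"
proof (rule D_eqI)
  have "(b - a) * (h * D f) = h * ((b - a) * D f)" by (simp only: mult.left_commute)
  then show "(b - a) * (h * D f) = b * (h * f) - a * \<sigma> (h * f)"
    by (simp only: D_rel hom assms) (simp add: algebra_simps)
qed

lemma D_of_invariant: "\<sigma> h = h \<Longrightarrow> D h = h"
  by (intro D_eqI) (simp add: algebra_simps)

lemma D_add: "D (f + g) = D f + D g" and D_diff: "D (f - g) = D f - D g"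
proof -
  have "(b - a) * (D f + D g) = (b - a) * D f + (b - a) * D g"
    "(b - a) * (D f - D g) = (b - a) * D f - (b - a) * D g"
    by (simp_all only: distrib_left right_diff_distrib)
  then show "D (f + g) = D f + D g" "D (f - g) = D f - D g"
    unfolding D_rel by (auto intro!: D_eqI simp: right_diff_distrib distrib_left)
qed

lemma D_0 [simp]: "D 0 = 0" by (rule D_of_invariant) simp

end

text \<open>\<open>D\<close> is the unique solution of a linear equation, so every ring homomorphism
  that intertwines the two exchanges intertwines the operators. It is applied to renumbering of
  rows, to setting variables to 1 and to exchanges in the other alphabet.\<close>

lemma exchange_D_hom:
  assumes "exchange \<sigma> a b x y e" "exchange \<sigma>' a' b' x' y' e'"
    and "\<And>f g. \<tau> (f * g) = \<tau> f * \<tau> g" "\<And>f g. \<tau> (f - g) = \<tau> f - \<tau> g"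
    and "\<tau> a = a'" "\<tau> b = b'" "\<tau> (\<sigma> f) = \<sigma>' (\<tau> f)"
  shows "\<tau> (exchange.D \<sigma> a b f) = exchange.D \<sigma>' a' b' (\<tau> f)"
proof -
  interpret A: exchange \<sigma> a b x y e by fact
  interpret B: exchange \<sigma>' a' b' x' y' e' by fact
  have "\<tau> ((b - a) * A.D f) = \<tau> (b * f - a * \<sigma> f)" by (simp add: A.D_rel)
  then show ?thesis using assms(3-7) by (intro B.D_eqI[symmetric]) simp
qed

lemma exchange_D_commute:
  assumes "exchange \<sigma> a b x y e" "exchange \<sigma>' a' b' x' y' e'" "{x, y} \<inter> {x', y'} = {}"
  shows "exchange.D \<sigma> a b (exchange.D \<sigma>' a' b' f) = exchange.D \<sigma>' a' b' (exchange.D \<sigma> a b f)"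
proof -
  interpret A: exchange \<sigma> a b x y e by fact
  interpret B: exchange \<sigma>' a' b' x' y' e' by fact
  have fix1: "\<sigma> a' = a'" "\<sigma> b' = b'" "\<sigma>' a = a" "\<sigma>' b = b"
    using assms(3) by (auto simp: A.\<sigma> B.\<sigma> B.a B.b A.a A.b rename_var_pow transpose_def)
  have comm: "\<sigma> (\<sigma>' g) = \<sigma>' (\<sigma> g)" for g
  proof -
    have "transpose x y (transpose x' y' v) = transpose x' y' (transpose x y v)" for v
      using assms(3) by (auto simp: transpose_def)
    then show ?thesis by (simp add: A.\<sigma> B.\<sigma> subst_subst)
  qed
  have s: "\<sigma> (B.D f) = B.D (\<sigma> f)"
    by (rule exchange_D_hom[OF assms(2,2)]) (simp_all add: fix1 comm)
  show ?thesis
  proof (rule A.D_eqI)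
    have "(b - a) * B.D (A.D f) = B.D ((b - a) * A.D f)"
      using fix1 by (simp add: B.D_mult_invariant)
    also have "\<dots> = b * B.D f - a * B.D (\<sigma> f)"
      using fix1 by (simp add: A.D_rel B.D_diff B.D_mult_invariant)
    finally show "(b - a) * B.D (A.D f) = b * B.D f - a * \<sigma> (B.D f)" by (simp add: s)
  qed
qed

text \<open>Multiplied by the Vandermonde product \<open>?V\<close>, either side becomes
  \<open>?R\<close>, the antisymmetrization of c^2 b f over the six permutations of a, b, c; and
  \<open>?V\<close> can be cancelled.\<close>

lemma exchange_D_braid:
  assumes "exchange \<sigma> a b x y e" "exchange \<sigma>' b c y z e" "x \<noteq> z"
  shows "exchange.D \<sigma> a b (exchange.D \<sigma>' b c (exchange.D \<sigma> a b f)) =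
    exchange.D \<sigma>' b c (exchange.D \<sigma> a b (exchange.D \<sigma>' b c f))"
proof -
  interpret A: exchange \<sigma> a b x y e by fact
  interpret B: exchange \<sigma>' b c y z e by fact
  have fix1: "\<sigma> c = c" "\<sigma>' a = a"
    using assms(3) A.ne B.ne by (auto simp: A.\<sigma> B.\<sigma> B.b A.a rename_var_pow transpose_def)
  have ca: "c - a \<noteq> 0"
    using assms(3) A.e by (auto simp: B.b A.a var_pow_eq_iff)
  have braid: "\<sigma> (\<sigma>' (\<sigma> g)) = \<sigma>' (\<sigma> (\<sigma>' g))" for g
  proof -
    have "transpose x y (transpose y z (transpose x y v)) =
        transpose y z (transpose x y (transpose y z v))" for v
      using assms(3) A.ne B.ne by (auto simp: transpose_def)
    then show ?thesis by (simp add: A.\<sigma> B.\<sigma> subst_subst)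
  qed
  let ?V = "(b - a) * (c - a) * (c - b)"
  let ?R = "c^2 * b * f - c^2 * a * \<sigma> f - b^2 * c * \<sigma>' f + b^2 * a * \<sigma>' (\<sigma> f)
      + a^2 * c * \<sigma> (\<sigma>' f) - a^2 * b * \<sigma> (\<sigma>' (\<sigma> f))"
  have 1: "?V * A.D (B.D (A.D f)) = ?R"
  proof -
    define P where "P = A.D f"
    define Q where "Q = B.D P"
    have r: "(b - a) * P = b * f - a * \<sigma> f" "(c - b) * Q = c * P - b * \<sigma>' P"
      "(b - a) * A.D Q = b * Q - a * \<sigma> Q"
      unfolding P_def Q_def by (rule A.D_rel B.D_rel)+
    have sP: "\<sigma> P = P" by (simp add: P_def)
    have "\<sigma>' ((b - a) * P) = \<sigma>' (b * f - a * \<sigma> f)" "\<sigma> ((c - b) * Q) = \<sigma> (c * P - b * \<sigma>' P)"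
      using r by simp_all
    then have r2: "(c - a) * \<sigma>' P = c * \<sigma>' f - a * \<sigma>' (\<sigma> f)" "(c - a) * \<sigma> Q = c * P - a * \<sigma> (\<sigma>' P)"
      by (simp_all add: fix1 sP)
    then have "\<sigma> ((c - a) * \<sigma>' P) = \<sigma> (c * \<sigma>' f - a * \<sigma>' (\<sigma> f))" by simp
    then have r3: "(c - b) * \<sigma> (\<sigma>' P) = c * \<sigma> (\<sigma>' f) - b * \<sigma> (\<sigma>' (\<sigma> f))"
      by (simp add: fix1)
    show ?thesis unfolding P_def[symmetric] Q_def[symmetric] using r r2 r3 by algebra
  qed
  have 2: "?V * B.D (A.D (B.D f)) = ?R"
  proof -
    define P where "P = B.D f"
    define Q where "Q = A.D P"
    have r: "(c - b) * P = c * f - b * \<sigma>' f" "(b - a) * Q = b * P - a * \<sigma> P"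
      "(c - b) * B.D Q = c * Q - b * \<sigma>' Q"
      unfolding P_def Q_def by (rule A.D_rel B.D_rel)+
    have sP: "\<sigma>' P = P" by (simp add: P_def)
    have "\<sigma> ((c - b) * P) = \<sigma> (c * f - b * \<sigma>' f)" "\<sigma>' ((b - a) * Q) = \<sigma>' (b * P - a * \<sigma> P)"
      using r by simp_all
    then have r2: "(c - a) * \<sigma> P = c * \<sigma> f - a * \<sigma> (\<sigma>' f)" "(c - a) * \<sigma>' Q = c * P - a * \<sigma>' (\<sigma> P)"
      by (simp_all add: fix1 sP)
    then have "\<sigma>' ((c - a) * \<sigma> P) = \<sigma>' (c * \<sigma> f - a * \<sigma> (\<sigma>' f))" by simp
    then have r3: "(b - a) * \<sigma>' (\<sigma> P) = b * \<sigma>' (\<sigma> f) - a * \<sigma> (\<sigma>' (\<sigma> f))"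
      by (simp add: fix1 braid)
    show ?thesis unfolding P_def[symmetric] Q_def[symmetric] using r r2 r3 by algebra
  qed
  have "?V \<noteq> 0" using A.neq B.neq ca by simp
  with 1 2 show ?thesis by (metis mult_left_cancel)
qed

abbreviation swap_dvars :: "nat \<Rightarrow> laurent \<Rightarrow> laurent" where
  "swap_dvars j \<equiv> rename (transpose (Zd j) (Zd (Suc j)))"

interpretation row: exchange "swap_vars i" "zv i" "zv (Suc i)" "Z i" "Z (Suc i)" 1 for i
proof
  have "swap_var i v = transpose (Z i) (Z (Suc i)) v" for v
    by (cases v) (auto simp: simple_refl_def transpose_def)
  then show "swap_vars i = rename (transpose (Z i) (Z (Suc i)))" by (simp add: swap_vars_eq)
qed auto

interpretation col: exchange "swap_dvars j" "yv j" "yv (Suc j)" "Zd j" "Zd (Suc j)" "- 1" for j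
  by unfold_locales auto

lemma demazure_op_eq: "demazure_op = row.D"
  by (intro ext) (simp add: demazure_op_def row.D_def)

lemma swap_vars_zv: "swap_vars i (zv j) = zv (simple_refl i j)"
  and swap_vars_yv [simp]: "swap_vars i (yv j) = yv j"
  and swap_dvars_yv: "swap_dvars i (yv j) = yv (simple_refl i j)"
  and swap_dvars_zv [simp]: "swap_dvars i (zv j) = zv j"
  by (simp_all add: swap_vars_eq rename_var_pow) (auto simp: transpose_def simple_refl_def)


section \<open>Well-definedness of Grothendieck polynomials\<close>

lemma simple_refl_simps [simp]:
  "simple_refl i i = Suc i" "simple_refl i (Suc i) = i"
  "p \<noteq> i \<Longrightarrow> p \<noteq> Suc i \<Longrightarrow> simple_refl i p = p"
  by (auto simp: simple_refl_def)

lemma simple_refl_invol [simp]: "simple_refl i (simple_refl i p) = p"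
  "simple_refl i \<circ> simple_refl i = id" "v \<circ> simple_refl i \<circ> simple_refl i = v"
  by (auto simp: simple_refl_def fun_eq_iff)

lemma simple_refl_permutes: "1 \<le> i \<Longrightarrow> i < k \<Longrightarrow> simple_refl i permutes {1..k}"
  unfolding simple_refl_def by (rule permutes_swap_id) auto

lemma S_inftyI: "v permutes {1..k} \<Longrightarrow> v \<in> S_infty"
  by (auto simp: S_infty_def)

lemma S_infty_obtain:
  assumes "v \<in> S_infty"
  obtains k where "v permutes {1..k}" "N \<le> k"
proof -
  obtain k where "v permutes {1..k}" using assms by (auto simp: S_infty_def)
  then have "v permutes {1..max k N}" by (rule permutes_subset) auto
  then show ?thesis using that by auto
qed

lemma S_infty_comp: "v \<in> S_infty \<Longrightarrow> w \<in> S_infty \<Longrightarrow> v \<circ> w \<in> S_infty"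
  by (metis S_inftyI S_infty_obtain permutes_compose permutes_subset atLeastatMost_subset_iff le_refl)

lemma S_infty_transpose: "1 \<le> a \<Longrightarrow> 1 \<le> b \<Longrightarrow> transpose a b \<in> S_infty"
  by (rule S_inftyI[of _ "max a b"], rule permutes_swap_id) auto

lemma S_infty_simple_refl: "1 \<le> i \<Longrightarrow> simple_refl i \<in> S_infty"
  by (simp add: simple_refl_def S_infty_transpose)

lemma S_infty_eq_iff: "v \<in> S_infty \<Longrightarrow> v p = v q \<longleftrightarrow> p = q"
  by (metis S_infty_obtain permutes_inj inj_eq)

lemma S_infty_0: "v \<in> S_infty \<Longrightarrow> v 0 = 0"
  by (metis S_infty_obtain permutes_not_in atLeastAtMost_iff not_one_le_zero)

lemma S_infty_pos: "v \<in> S_infty \<Longrightarrow> v p > 0 \<longleftrightarrow> p > 0"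
  by (metis S_infty_0 S_infty_eq_iff gr0I)

lemma S_infty_bij: "v \<in> S_infty \<Longrightarrow> bij v"
  by (metis S_infty_obtain permutes_bij)

lemma S_infty_inv: "v \<in> S_infty \<Longrightarrow> inv v \<in> S_infty"
  by (metis S_infty_obtain permutes_inv S_inftyI)

definition inversions :: "(nat \<Rightarrow> nat) \<Rightarrow> (nat \<times> nat) set" where
  "inversions v = {(p, q). p < q \<and> v p > v q}"

lemma inversions_subset:
  assumes "v permutes {1..k}"
  shows "inversions v \<subseteq> {..k} \<times> {..k}"
proof -
  have "q \<le> k" if "p < q" "v p > v q" for p q
  proof (rule ccontr)
    assume "\<not> q \<le> k"
    then have "v q = q" using assms by (intro permutes_not_in) auto
    moreover have "v p \<le> max k p"
      using permutes_in_image[OF assms, of p] permutes_not_in[OF assms, of p]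
      by (cases "p \<in> {1..k}") auto
    ultimately show False using that \<open>\<not> q \<le> k\<close> by auto
  qed
  then show ?thesis unfolding inversions_def by fastforce
qed

lemma perm_length_eq: "perm_length v = card (inversions v)"
  by (simp add: perm_length_def inversions_def)

lemma perm_length_le: "v permutes {1..k} \<Longrightarrow> perm_length v \<le> Suc k * Suc k"
  using card_mono[OF _ inversions_subset, of k v] by (simp add: perm_length_eq)

lemma perm_length_ascent:
  assumes "v \<in> S_infty" "v i < v (Suc i)"
  shows "perm_length (v \<circ> simple_refl i) = Suc (perm_length v)"
proof -
  let ?s = "simple_refl i" let ?S = "map_prod ?s ?s"
  obtain k where k: "v permutes {1..k}" using assms(1) by (auto simp: S_infty_def)
  then have fin: "finite (inversions v)" using finite_subset[OF inversions_subset] by blast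
  have mono: "?s p < ?s q" if "p < q" "(p, q) \<noteq> (i, Suc i)" for p q
    using that by (auto simp: simple_refl_def transpose_def)
  have sub: "?S ` (inversions u - {(i, Suc i)}) \<subseteq> inversions (u \<circ> ?s) - {(i, Suc i)}" for u
  proof
    fix x assume "x \<in> ?S ` (inversions u - {(i, Suc i)})"
    then obtain p q where x: "x = (?s p, ?s q)" and pq: "p < q" "u p > u q" "(p, q) \<noteq> (i, Suc i)"
      by (auto simp: inversions_def)
    have "(?s p, ?s q) \<noteq> (i, Suc i)" using pq(1)
      by (metis Pair_inject lessI not_less_iff_gr_or_eq simple_refl_invol(1) simple_refl_simps(1))
    then show "x \<in> inversions (u \<circ> ?s) - {(i, Suc i)}"
      using mono[OF pq(1,3)] pq x by (auto simp: inversions_def)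
  qed
  have "inversions (v \<circ> ?s) - {(i, Suc i)} = ?S ` (inversions v - {(i, Suc i)})"
  proof
    have "?S ` (inversions (v \<circ> ?s) - {(i, Suc i)}) \<subseteq> inversions v - {(i, Suc i)}"
      using sub[of "v \<circ> ?s"] by simp
    then have "?S ` ?S ` (inversions (v \<circ> ?s) - {(i, Suc i)}) \<subseteq> ?S ` (inversions v - {(i, Suc i)})"
      by (rule image_mono)
    then show "inversions (v \<circ> ?s) - {(i, Suc i)} \<subseteq> ?S ` (inversions v - {(i, Suc i)})"
      by (simp add: image_image map_prod_def split_def)
  qed (rule sub)
  moreover have "(i, Suc i) \<in> inversions (v \<circ> ?s)" "(i, Suc i) \<notin> inversions v"
    using assms(2) by (auto simp: inversions_def)
  ultimately have eq: "inversions (v \<circ> ?s) = insert (i, Suc i) (?S ` inversions v)"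
    by auto
  have "inj ?S" by (rule prod.inj_map) (metis injI simple_refl_invol(1))+
  then have "card (?S ` inversions v) = card (inversions v)"
    by (intro card_image) (metis inj_on_subset subset_UNIV)
  moreover have "(i, Suc i) \<notin> ?S ` inversions v"
  proof
    assume "(i, Suc i) \<in> ?S ` inversions v"
    then obtain p q where "i = ?s p" "Suc i = ?s q" "p < q" by (auto simp: inversions_def)
    then show False by (metis lessI not_less_iff_gr_or_eq simple_refl_invol(1) simple_refl_simps(1))
  qed
  ultimately show ?thesis using fin by (simp add: perm_length_eq eq)
qed

lemma perm_length_less_iff:
  assumes "v \<in> S_infty" "1 \<le> i"
  shows "perm_length (v \<circ> simple_refl i) < perm_length v \<longleftrightarrow> v (Suc i) < v i"
proof (cases "v i < v (Suc i)")
  case True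
  then show ?thesis using perm_length_ascent[OF assms(1) True] by simp
next
  case False
  then have d: "v (Suc i) < v i" using S_infty_eq_iff[OF assms(1), of i "Suc i"] by simp
  then have "(v \<circ> simple_refl i) i < (v \<circ> simple_refl i) (Suc i)" by simp
  then have "perm_length v = Suc (perm_length (v \<circ> simple_refl i))"
    using perm_length_ascent[OF S_infty_comp[OF assms(1) S_infty_simple_refl[OF assms(2)]]]
    by (metis simple_refl_invol(3))
  then show ?thesis using d by simp
qed

definition diagram_prod :: "(nat \<times> nat) set \<Rightarrow> laurent" where
  "diagram_prod L = (\<Prod>(i, j)\<in>L. 1 - zv i * yv j)"

lemma diagram_prod_remove:
  "finite L \<Longrightarrow> (i, j) \<in> L \<Longrightarrow> diagram_prod L = diagram_prod (L - {(i, j)}) * (1 - zv i * yv j)"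
  unfolding diagram_prod_def by (simp add: prod.remove[of L "(i, j)"] mult.commute)

text \<open>The factors other than that of (t, c) form a product symmetric in z_t and z_(t+1), which
  can be pulled out, and the operator takes 1 - z_t/zd_c to 1. In this way the polynomial of a
  dominant permutation loses a box.\<close>

lemma row_D_diagram_prod:
  assumes "finite L" "(t, c) \<in> L"
    and inv: "\<And>i j. (i, j) \<in> L - {(t, c)} \<Longrightarrow> (simple_refl t i, j) \<in> L - {(t, c)}"
  shows "row.D t (diagram_prod L) = diagram_prod (L - {(t, c)})"
proof -
  let ?M = "L - {(t, c)}"
  have "swap_vars t (diagram_prod ?M) = (\<Prod>(i, j)\<in>?M. 1 - zv (simple_refl t i) * yv j)"
    by (simp add: diagram_prod_def swap_vars_eq subst_prod split_def)
      (simp flip: swap_vars_eq add: swap_vars_zv)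
  also have "\<dots> = diagram_prod ?M"
    unfolding diagram_prod_def
    by (rule prod.reindex_bij_witness[of _ "map_prod (simple_refl t) id" "map_prod (simple_refl t) id"])
      (insert inv, auto split: prod.splits, fastforce+)
  finally have "row.D t (diagram_prod L) = diagram_prod ?M * row.D t (1 - zv t * yv c)"
    using assms(1,2) by (simp only: diagram_prod_remove row.D_mult_invariant)
  moreover have "row.D t (1 - zv t * yv c) = 1"
    by (rule row.D_eqI) (simp add: swap_vars_zv algebra_simps)
  ultimately show ?thesis by simp
qed

lemma col_D_diagram_prod:
  assumes "finite L" "(c, t) \<in> L"
    and inv: "\<And>i j. (i, j) \<in> L - {(c, t)} \<Longrightarrow> (i, simple_refl t j) \<in> L - {(c, t)}"
  shows "col.D t (diagram_prod L) = diagram_prod (L - {(c, t)})"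
proof -
  let ?M = "L - {(c, t)}"
  have "swap_dvars t (diagram_prod ?M) = (\<Prod>(i, j)\<in>?M. 1 - zv i * yv (simple_refl t j))"
    by (simp add: diagram_prod_def subst_prod split_def swap_dvars_yv)
  also have "\<dots> = diagram_prod ?M"
    unfolding diagram_prod_def
    by (rule prod.reindex_bij_witness[of _ "map_prod id (simple_refl t)" "map_prod id (simple_refl t)"])
      (insert inv, auto split: prod.splits, fastforce+)
  finally have "col.D t (diagram_prod L) = diagram_prod ?M * col.D t (1 - zv c * yv t)"
    using assms(1,2) by (simp only: diagram_prod_remove col.D_mult_invariant)
  moreover have "col.D t (1 - zv c * yv t) = 1"
    by (rule col.D_eqI) (simp add: swap_dvars_yv algebra_simps)
  ultimately show ?thesis by simp
qed

section \<open>Existence of Grothendieck polynomials and independence of the chain\<close>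

definition staircase :: "nat \<Rightarrow> (nat \<times> nat) set" where
  "staircase k = {(i, j). 1 \<le> i \<and> 1 \<le> j \<and> i + j \<le> k}"

lemma finite_staircase [simp]: "finite (staircase k)"
  by (rule finite_subset[of _ "{..k} \<times> {..k}"]) (auto simp: staircase_def)

lemma is_groth_longest: "is_groth k (longest_perm k) (diagram_prod (staircase k))"
proof -
  have "staircase k = {(i, j) | i j. 1 \<le> i \<and> 1 \<le> j \<and> i + j \<le> k}" by (auto simp: staircase_def)
  then show ?thesis using is_groth.longest[of k] by (simp add: diagram_prod_def)
qed

lemma longest_permutes: "longest_perm k permutes {1..k}"
  by (rule bij_imp_permutes, rule bij_betw_byWitness[where f' = "longest_perm k"])
    (auto simp: longest_perm_def)

lemma is_groth_permutes: "is_groth k v f \<Longrightarrow> v permutes {1..k}"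
  by (induction rule: is_groth.induct)
    (simp_all only: longest_permutes permutes_compose simple_refl_permutes)

lemma is_groth_descend:
  assumes "is_groth k v f" "1 \<le> i" "i < k" "v (Suc i) < v i"
  shows "is_groth k (v \<circ> simple_refl i) (row.D i f)"
  using is_groth.descend[OF assms(1-3)] perm_length_less_iff[OF S_inftyI[OF is_groth_permutes[OF assms(1)]] assms(2)]
    assms(4) by (simp add: demazure_op_eq)

text \<open>Descending through all of {1..k} leaves no slack: counting from the right end gives v p
  \<ge> k + 1 - p, counting from the left end the opposite inequality.\<close>

lemma no_ascent_longest:
  assumes v: "v permutes {1..k}" and desc: "\<And>i. 1 \<le> i \<Longrightarrow> i < k \<Longrightarrow> v (Suc i) < v i"
  shows "v = longest_perm k"
proof
  fix p
  have lo: "k + 1 \<le> v (k - d) + (k - d)" if "d < k" for d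
    using that
  proof (induction d)
    case 0
    then show ?case using permutes_in_image[OF v, of k] by auto
  next
    case (Suc d)
    then show ?case using desc[of "k - Suc d"] by (simp add: Suc_diff_Suc Suc_le_eq)
  qed
  have hi: "v (Suc d) + d \<le> k" if "d < k" for d
    using that
  proof (induction d)
    case 0
    then show ?case using permutes_in_image[OF v, of 1] by auto
  next
    case (Suc d)
    then show ?case using desc[of "Suc d"] by simp
  qed
  show "v p = longest_perm k p"
  proof (cases "p \<in> {1..k}")
    case True
    then have "p - 1 < k" "k - p < k" by auto
    then show ?thesis using lo[of "k - p"] hi[of "p - 1"] True by (auto simp: longest_perm_def)
  next
    case False
    then show ?thesis using permutes_not_in[OF v] by (auto simp: longest_perm_def)
  qed
qed

lemma longest_perm_descent: "1 \<le> i \<Longrightarrow> i < k \<Longrightarrow> longest_perm k (Suc i) < longest_perm k i"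
  by (auto simp: longest_perm_def)

lemma ascent_cases:
  assumes "v permutes {1..k}"
  obtains "v = longest_perm k" | i where "1 \<le> i" "i < k" "v i < v (Suc i)"
proof (cases "v = longest_perm k")
  case False
  then obtain i where "1 \<le> i" "i < k" "\<not> v (Suc i) < v i" using no_ascent_longest[OF assms] by blast
  then show ?thesis using that(2)[of i] S_infty_eq_iff[OF S_inftyI[OF assms], of i "Suc i"] by auto
qed (use that in blast)

lemma is_groth_exists: "v permutes {1..k} \<Longrightarrow> \<exists>f. is_groth k v f"
\<comment> \<open>The square is a crude bound for the length on \<open>S_k\<close>; any bound makes
  the ascent towards the longest element terminate.\<close>
proof (induction "Suc k * Suc k - perm_length v" arbitrary: v rule: less_induct)
  case less
  show ?case
  proof (cases rule: ascent_cases[OF less.prems])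
    case 1
    then show ?thesis using is_groth_longest by blast
  next
    case (2 i)
    let ?u = "v \<circ> simple_refl i"
    have u: "?u permutes {1..k}" using less.prems 2 by (intro permutes_compose simple_refl_permutes)
    have "perm_length ?u = Suc (perm_length v)"
      using less.prems 2 by (intro perm_length_ascent S_inftyI)
    then obtain f where "is_groth k ?u f" using less.hyps[OF _ u] perm_length_le[OF u] by fastforce
    from is_groth_descend[OF this 2(1,2)] 2(3) show ?thesis by auto
  qed
qed

lemma is_groth_ascend:
  assumes "is_groth k v f" "v \<noteq> longest_perm k"
  obtains i F where "1 \<le> i" "i < k" "v i < v (Suc i)" "is_groth k (v \<circ> simple_refl i) F" "f = row.D i F"
  using assms(1)
proof cases
  case (descend u F i)
  have "u \<in> S_infty" using descend(3) is_groth_permutes S_inftyI by blast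
  then have "u (Suc i) < u i" using perm_length_less_iff descend(4,6) by blast
  then show ?thesis using that[of i F] descend by (auto simp: demazure_op_eq)
qed (use assms(2) in simp)

text \<open>A diamond argument from the longest element downwards. Two different last steps i and j
  into v are completed upwards to a common ancestor, v s_i s_j s_i if they are adjacent and v s_i
  s_j otherwise. By induction the polynomials of v s_i and v s_j are unique, hence both come from
  that ancestor, and the braid or commutation relation compares the two ways down.\<close>

lemma is_groth_unique:
  "is_groth k v f \<Longrightarrow> is_groth k v g \<Longrightarrow> f = g"
proof (induction "Suc k * Suc k - perm_length v" arbitrary: v f g rule: less_induct)
  case less
  have v: "v permutes {1..k}" using less.prems(1) by (rule is_groth_permutes)
  have vS: "v \<in> S_infty" using v by (rule S_inftyI)
  show ?case
  proof (cases "v = longest_perm k")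
    case True
    have "h = diagram_prod (staircase k)" if "is_groth k v h" for h
      using that
    proof cases
      case longest
      then show ?thesis using is_groth_longest[of k]
        by (simp add: diagram_prod_def staircase_def)
    next
      case (descend u F i)
      have "u \<in> S_infty" using descend(3) is_groth_permutes S_inftyI by blast
      then have "u (Suc i) < u i" using perm_length_less_iff descend(4,6) by blast
      then have "v i < v (Suc i)" using descend(1) by simp
      then show ?thesis using longest_perm_descent[of i k] descend True by simp
    qed
    then show ?thesis using less.prems by blast
  next
    case False
    obtain i F where i: "1 \<le> i" "i < k" "v i < v (Suc i)" "is_groth k (v \<circ> simple_refl i) F" "f = row.D i F"
      using is_groth_ascend[OF less.prems(1) False] .
    obtain j G where j: "1 \<le> j" "j < k" "v j < v (Suc j)" "is_groth k (v \<circ> simple_refl j) G" "g = row.D j G"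
      using is_groth_ascend[OF less.prems(2) False] .
    have IH: "F' = G'" if "is_groth k (v \<circ> simple_refl i) F'" "is_groth k (v \<circ> simple_refl i) G'"
      "1 \<le> i" "v i < v (Suc i)" for i F' G'
    proof (rule less.hyps[OF _ that(1,2)])
      show "Suc k * Suc k - perm_length (v \<circ> simple_refl i) < Suc k * Suc k - perm_length v"
        using perm_length_ascent[OF vS that(4)] perm_length_le[OF is_groth_permutes[OF that(1)]] by simp
    qed
    have adj: "f = g" if ij: "j = Suc i" and i: "1 \<le> i" "i < k" "v i < v (Suc i)" "is_groth k (v \<circ> simple_refl i) F" "f = row.D i F"
      and j: "1 \<le> j" "j < k" "v j < v (Suc j)" "is_groth k (v \<circ> simple_refl j) G" "g = row.D j G" for i j F G f g
    proof -
      let ?u = "v \<circ> simple_refl i \<circ> simple_refl j \<circ> simple_refl i"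
      have u: "?u permutes {1..k}"
        using v i j by (intro permutes_compose simple_refl_permutes)
      obtain H where H: "is_groth k ?u H" using is_groth_exists[OF u] by blast
      have u2: "?u = v \<circ> simple_refl j \<circ> simple_refl i \<circ> simple_refl j"
        by (auto simp: fun_eq_iff ij simple_refl_def transpose_def)
      have val: "?u i = v (Suc j)" "?u j = v j" "?u (Suc j) = v i"
        "(v \<circ> simple_refl i \<circ> simple_refl j) j = v (Suc j)" "(v \<circ> simple_refl i \<circ> simple_refl j) (Suc j) = v i"
        "(v \<circ> simple_refl j \<circ> simple_refl i) i = v (Suc j)" "(v \<circ> simple_refl j \<circ> simple_refl i) j = v i"
        by (simp_all add: ij)
      have lt: "v i < v j" "v j < v (Suc j)" using i j ij by auto
      have 1: "is_groth k (v \<circ> simple_refl i \<circ> simple_refl j) (row.D i H)"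
        using is_groth_descend[OF H i(1,2)] val lt ij by simp
      have 2: "is_groth k (v \<circ> simple_refl i) (row.D j (row.D i H))"
        using is_groth_descend[OF 1 j(1,2)] val lt by simp
      have H': "is_groth k (v \<circ> simple_refl j \<circ> simple_refl i \<circ> simple_refl j) H" using H u2 by simp
      have 3: "is_groth k (v \<circ> simple_refl j \<circ> simple_refl i) (row.D j H)"
        using is_groth_descend[OF H' j(1,2)] val lt u2 by simp
      have 4: "is_groth k (v \<circ> simple_refl j) (row.D i (row.D j H))"
        using is_groth_descend[OF 3 i(1,2)] val lt ij by simp
      have "F = row.D j (row.D i H)" "G = row.D i (row.D j H)"
        using IH 2 4 i j by blast+
      then show ?thesis using i(5) j(5) ij
        exchange_D_braid[OF row.exchange_axioms[of i] row.exchange_axioms[of "Suc i"]] by simp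
    qed
    have comm: "f = g" if "Suc i < j" and i: "1 \<le> i" "i < k" "v i < v (Suc i)" "is_groth k (v \<circ> simple_refl i) F" "f = row.D i F"
      and j: "1 \<le> j" "j < k" "v j < v (Suc j)" "is_groth k (v \<circ> simple_refl j) G" "g = row.D j G" for i j F G f g
    proof -
      let ?u = "v \<circ> simple_refl i \<circ> simple_refl j"
      have u: "?u permutes {1..k}"
        using v i j by (intro permutes_compose simple_refl_permutes)
      obtain H where H: "is_groth k ?u H" using is_groth_exists[OF u] by blast
      have u2: "?u = v \<circ> simple_refl j \<circ> simple_refl i"
        using that(1) by (auto simp: fun_eq_iff simple_refl_def transpose_def)
      have 1: "is_groth k (v \<circ> simple_refl i) (row.D j H)"
        using is_groth_descend[OF H j(1,2)] j(3) that(1) by simp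
      have H': "is_groth k (v \<circ> simple_refl j \<circ> simple_refl i) H" using H u2 by simp
      have 2: "is_groth k (v \<circ> simple_refl j) (row.D i H)"
        using is_groth_descend[OF H' i(1,2)] i(3) that(1) by simp
      have "F = row.D j H" "G = row.D i H" using IH 1 2 i j by blast+
      moreover have "row.D i (row.D j H) = row.D j (row.D i H)"
        using that(1) by (intro exchange_D_commute[OF row.exchange_axioms row.exchange_axioms]) auto
      ultimately show ?thesis using i(5) j(5) by simp
    qed
    consider "i = j" | "j = Suc i" | "i = Suc j" | "Suc i < j" | "Suc j < i" by linarith
    then show ?thesis
    proof cases
      case 1
      then show ?thesis using IH i j by blast
    next
      case 2
      show ?thesis by (rule adj[OF 2 i j])
    next
      case 3
      show ?thesis by (rule adj[OF 3 j i, symmetric])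
    next
      case 4
      show ?thesis by (rule comm[OF 4 i j])
    next
      case 5
      show ?thesis by (rule comm[OF 5 j i, symmetric])
    qed
  qed
qed

text \<open>
  The chain \<open>w\<^sub>0\<^bsup>N+1\<^esup>, w\<^sub>0\<^bsup>N+1\<^esup>s\<^sub>1, w\<^sub>0\<^bsup>N+1\<^esup>s\<^sub>1s\<^sub>2, \<dots>\<close> in which the factor \<open>s\<^sub>r\<close> is left out (none
  if \<open>r = 0\<close>). All its members are dominant.
\<close>

definition chain_perm :: "nat \<Rightarrow> nat \<Rightarrow> nat \<Rightarrow> nat \<Rightarrow> nat" where
  "chain_perm N r t p = (if p = 0 then 0 else if p \<le> t then (if p = r then N + 1 else N + 1 - p)
     else if p = Suc t then N + 1 - r else if p \<le> N + 1 then N + 2 - p else p)"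

text \<open>For r \<le> t \<le> N this is the Rothe diagram of the dominant permutation
  \<open>chain_perm N r t\<close>: each step removes one box of the longest antidiagonal of the
  staircase, and the box in row r is kept.\<close>

definition chain_diagram :: "nat \<Rightarrow> nat \<Rightarrow> nat \<Rightarrow> (nat \<times> nat) set" where
  "chain_diagram N r t = staircase (Suc N) - {(i, j). i \<le> t \<and> i \<noteq> r \<and> i + j = Suc N}"

lemma is_groth_chain_step:
  assumes "is_groth (Suc N) (chain_perm N r t) (diagram_prod (chain_diagram N r t))" "r \<le> t" "t < N"
  shows "is_groth (Suc N) (chain_perm N r (Suc t)) (diagram_prod (chain_diagram N r (Suc t)))"
proof -
  let ?v = "chain_perm N r t" and ?L = "chain_diagram N r t"
  have d: "is_groth (Suc N) (?v \<circ> simple_refl (Suc t)) (row.D (Suc t) (diagram_prod ?L))"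
    using assms by (intro is_groth_descend) (auto simp: chain_perm_def)
  have v: "?v \<circ> simple_refl (Suc t) = chain_perm N r (Suc t)"
    using assms(2,3) by (auto simp: fun_eq_iff chain_perm_def simple_refl_def transpose_def)
  have L: "chain_diagram N r (Suc t) = ?L - {(Suc t, N - t)}"
    using assms(2,3) by (auto simp: chain_diagram_def staircase_def)
  have "row.D (Suc t) (diagram_prod ?L) = diagram_prod (?L - {(Suc t, N - t)})"
  proof (rule row_D_diagram_prod)
    show "finite ?L" by (simp add: chain_diagram_def)
    show "(Suc t, N - t) \<in> ?L" using assms(3) by (auto simp: chain_diagram_def staircase_def)
    show "(simple_refl (Suc t) i, j) \<in> ?L - {(Suc t, N - t)}" if "(i, j) \<in> ?L - {(Suc t, N - t)}" for i j
      using that assms(2,3)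
      by (cases "i = Suc t"; cases "i = Suc (Suc t)") (auto simp: chain_diagram_def staircase_def)
  qed
  then show ?thesis using d v L by simp
qed

lemma is_groth_chain:
  assumes "r \<le> t" "t \<le> N"
  shows "is_groth (Suc N) (chain_perm N r t) (diagram_prod (chain_diagram N r t))"
proof -
  have base: "is_groth (Suc N) (chain_perm N 0 t) (diagram_prod (chain_diagram N 0 t))" if "t \<le> N" for t
    using that
  proof (induction t)
    case 0
    have "chain_perm N 0 0 = longest_perm (Suc N)" "chain_diagram N 0 0 = staircase (Suc N)"
      by (auto simp: fun_eq_iff chain_perm_def longest_perm_def chain_diagram_def staircase_def)
    then show ?case using is_groth_longest by simp
  next
    case (Suc t)
    then show ?case by (intro is_groth_chain_step) auto
  qed
  show ?thesis
  proof (cases "r = 0")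
    case True
    then show ?thesis using base assms by simp
  next
    case False
    show ?thesis using assms
    proof (induction t rule: dec_induct)
      case base
      \<comment> \<open>Leaving out s_r means that at t = r nothing has been applied beyond s_1,
        ..., s_(r-1), so the chain branches off from the full chain at its member r - 1.\<close>
      have "chain_perm N r r = chain_perm N 0 (r - 1)" "chain_diagram N r r = chain_diagram N 0 (r - 1)"
        using False assms by (auto simp: fun_eq_iff chain_perm_def chain_diagram_def staircase_def)
      then show ?case using \<open>\<And>t. t \<le> N \<Longrightarrow> is_groth (Suc N) (chain_perm N 0 t) _\<close>[of "r - 1"] assms by simp
    next
      case (step t)
      then show ?case by (intro is_groth_chain_step) auto
    qed
  qed
qed

text \<open>The complete chain s_1, ..., s_N leads from the longest element of
  \<open>S_(N+1)\<close> down to that of \<open>S_N\<close>. This is what makes the polynomial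
  independent of the ambient symmetric group.\<close>

lemma is_groth_Suc_longest: "is_groth (Suc N) (longest_perm N) (diagram_prod (staircase N))"
proof -
  have "chain_perm N 0 N = longest_perm N" "chain_diagram N 0 N = staircase N"
    by (auto simp: fun_eq_iff chain_perm_def longest_perm_def chain_diagram_def staircase_def)
  then show ?thesis using is_groth_chain[of 0 N N] by simp
qed

text \<open>The chain that omits s_r ends in a cover of the longest element of \<open>S_N\<close>,
  whose diagram is the staircase with one box added to row r. The extra factor is the starting case
  of the Monk formula.\<close>

lemma is_groth_longest_transpose:
  assumes "1 \<le> r" "r \<le> N"
  shows "is_groth (Suc N) (longest_perm N \<circ> transpose r (Suc N))
    (diagram_prod (staircase N) * (1 - zv r * yv (Suc N - r)))"
proof -
  have 1: "chain_perm N r N = longest_perm N \<circ> transpose r (Suc N)"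
    using assms by (auto simp: fun_eq_iff chain_perm_def longest_perm_def transpose_def)
  have 2: "chain_diagram N r N - {(r, Suc N - r)} = staircase N"
    "(r, Suc N - r) \<in> chain_diagram N r N" "finite (chain_diagram N r N)"
    using assms finite_staircase[of "Suc N"]
    by (auto simp: chain_diagram_def staircase_def simp del: finite_staircase)
  show ?thesis using is_groth_chain[of r N N] assms(2) diagram_prod_remove[OF 2(3,2)] 1 2(1) by simp
qed

section \<open>Independence of the ambient symmetric group, basic properties of
  \<open>groth\<close>\<close>

lemma is_groth_Suc: "is_groth k v f \<Longrightarrow> is_groth (Suc k) v f"
proof (induction rule: is_groth.induct)
  case longest
  show ?case using is_groth_Suc_longest[of k] by (simp add: diagram_prod_def staircase_def)
next
  case (descend v f i)
  then show ?case by (intro is_groth.descend) auto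
qed

lemma is_groth_mono: "is_groth k v f \<Longrightarrow> k \<le> k' \<Longrightarrow> is_groth k' v f"
  by (rule dec_induct[of k k']) (auto intro: is_groth_Suc)

lemma groth_eqI: 
  assumes "is_groth k v f"
  shows "groth v = f"
  unfolding groth_def
proof (rule the_equality)
  fix g assume "\<exists>k. is_groth k v g"
  then obtain k' where "is_groth k' v g" by blast
  then have "is_groth (max k k') v g" "is_groth (max k k') v f"
    using assms is_groth_mono by auto
  then show "g = f" by (rule is_groth_unique)
qed (use assms in blast)

lemma is_groth_groth: "v permutes {1..k} \<Longrightarrow> is_groth k v (groth v)"
  using is_groth_exists[of v k] groth_eqI[of k v] by fastforce

lemma groth_longest: "groth (longest_perm k) = diagram_prod (staircase k)"
  by (rule groth_eqI[OF is_groth_longest])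

lemma groth_id [simp]: "groth id = 1"
proof -
  have "longest_perm 0 = id" "staircase 0 = {}"
    by (auto simp: fun_eq_iff longest_perm_def staircase_def)
  then show ?thesis using groth_longest[of 0] by (simp add: diagram_prod_def)
qed

lemma groth_descend:
  assumes "v \<in> S_infty" "1 \<le> i" "v (Suc i) < v i"
  shows "row.D i (groth v) = groth (v \<circ> simple_refl i)"
proof -
  obtain k where "v permutes {1..k}" "Suc i \<le> k" using S_infty_obtain[OF assms(1)] .
  then show ?thesis using is_groth_descend[OF is_groth_groth, of v k i] assms groth_eqI by simp
qed

lemma swap_vars_groth:
  assumes "v \<in> S_infty" "1 \<le> i" "v i < v (Suc i)"
  shows "swap_vars i (groth v) = groth v"
proof -
  have "v \<circ> simple_refl i \<in> S_infty" using assms by (intro S_infty_comp S_infty_simple_refl)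
  from groth_descend[OF this assms(2)] have "groth v = row.D i (groth (v \<circ> simple_refl i))"
    using assms(3) by simp
  then show ?thesis using row.D_invariant by metis
qed

lemma row_D_groth_ascent:
  assumes "v \<in> S_infty" "1 \<le> i" "v i < v (Suc i)"
  shows "row.D i (groth v) = groth v"
  by (rule row.D_of_invariant, rule swap_vars_groth[OF assms])

lemma perm_descend_induct [consumes 1, case_names longest descend]:
  assumes "v permutes {1..k}" and "P (longest_perm k)"
    and "\<And>v i. v permutes {1..k} \<Longrightarrow> P v \<Longrightarrow> 1 \<le> i \<Longrightarrow> i < k \<Longrightarrow> v (Suc i) < v i \<Longrightarrow> P (v \<circ> simple_refl i)"
  shows "P v"
proof -
  have "is_groth k v (groth v)" using assms(1) by (rule is_groth_groth)
  then show ?thesis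
  proof (induction rule: is_groth.induct)
    case (descend v f i)
    then show ?case using assms(3) perm_length_less_iff is_groth_permutes S_inftyI by meson
  qed (rule assms(2))
qed

lemma sign_perm_length:
  assumes "v \<in> S_infty"
  shows "sign v = (-1) ^ perm_length v"
proof -
  obtain k where k: "v permutes {1..k}" using assms by (auto simp: S_infty_def)
  \<comment> \<open>Both factors change sign at each descent step, so the product is constant on
    \<open>S_k\<close>; its value 1 is read off at the identity.\<close>
  have *: "sign u * (-1) ^ perm_length u = sign (longest_perm k) * (-1) ^ perm_length (longest_perm k)"
    if "u permutes {1..k}" for u
    using that
  proof (induction rule: perm_descend_induct)
    case (descend u i)
    have p: "permutation u" "permutation (simple_refl i)"
      using descend(1) by (auto intro: permutes_imp_permutation simp: simple_refl_def permutation_swap_id)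
    let ?u = "u \<circ> simple_refl i"
    have "perm_length u = Suc (perm_length ?u)"
      using perm_length_ascent[of ?u i] S_infty_comp[OF S_inftyI S_infty_simple_refl] descend by simp
    moreover have "sign ?u = - sign u"
      using sign_compose[OF p] by (simp add: simple_refl_def sign_swap_id)
    ultimately show ?case using descend.IH by (simp add: comp_def)
  qed simp
  have "{(p, q). p < q \<and> q < (p :: nat)} = {}" by auto
  then have "perm_length id = 0" by (simp only: perm_length_def id_apply card.empty)
  then have "sign v * (-1) ^ perm_length v = 1" using *[OF k] *[OF permutes_id] by simp
  then show ?thesis by (cases "even (perm_length v)") auto
qed


section \<open>Monk formula and transition\<close>

text \<open>
  \<open>cov r a u\<close>: exchanging the entries at \<open>a\<close> and \<open>r\<close> covers \<open>u\<close> in the Bruhat order.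
\<close>

definition cov :: "nat \<Rightarrow> nat \<Rightarrow> (nat \<Rightarrow> nat) \<Rightarrow> bool" where
  "cov r a u \<longleftrightarrow> (a < r \<and> u a < u r \<or> r < a \<and> u r < u a) \<and>
     (\<forall>x. a < x \<and> x < r \<or> r < x \<and> x < a \<longrightarrow> \<not> (u a < u x \<and> u x < u r \<or> u r < u x \<and> u x < u a))"

text \<open>Expanded, this is the sum over all subsequences of the list whose successive exchanges
  with r are covers, with sign (-1) to the number of exchanges. Each cover condition refers to the
  permutation reached so far, so the order of the list matters.\<close>

fun chain_sum :: "((nat \<Rightarrow> nat) \<Rightarrow> laurent) \<Rightarrow> nat \<Rightarrow> nat list \<Rightarrow> (nat \<Rightarrow> nat) \<Rightarrow> laurent" where
  "chain_sum g r [] u = g u"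
| "chain_sum g r (a # as) u = chain_sum g r as u -
     (if cov r a u then chain_sum g r as (u \<circ> transpose a r) else 0)"

section \<open>Demazure operators applied to chain sums\<close>

lemma cov_simple_refl:
  assumes "i \<notin> {a, r}" "Suc i \<notin> {a, r}"
  shows "cov r a (u \<circ> simple_refl i) \<longleftrightarrow> cov r a u"
proof -
  have *: "a < simple_refl i x \<and> simple_refl i x < r \<or> r < simple_refl i x \<and> simple_refl i x < a \<longleftrightarrow>
      a < x \<and> x < r \<or> r < x \<and> x < a" for x
    using assms by (cases "x = i"; cases "x = Suc i") auto
  have all: "(\<forall>x. P (simple_refl i x)) \<longleftrightarrow> (\<forall>x. P x)" for P
    by (metis simple_refl_invol(1))
  have "simple_refl i a = a" "simple_refl i r = r" using assms by auto
  then show ?thesis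
    unfolding cov_def o_apply
    by (subst (2) all[symmetric]) (simp add: *)
qed

lemma transpose_simple_refl:
  assumes "i \<notin> {a, r}" "Suc i \<notin> {a, r}"
  shows "u \<circ> transpose a r \<circ> simple_refl i = u \<circ> simple_refl i \<circ> transpose a r"
  using assms by (auto simp: fun_eq_iff simple_refl_def transpose_def)

text \<open>The right action of the 0-Hecke monoid, by which the Demazure operator acts on
  \<open>groth\<close> at ascents and descents alike.\<close>

definition descend_at :: "nat \<Rightarrow> (nat \<Rightarrow> nat) \<Rightarrow> nat \<Rightarrow> nat" where
  "descend_at i u = (if u (Suc i) < u i then u \<circ> simple_refl i else u)"

lemma row_D_groth: "u \<in> S_infty \<Longrightarrow> 1 \<le> i \<Longrightarrow> row.D i (groth u) = groth (descend_at i u)"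
  using groth_descend[of u i] row_D_groth_ascent[of u i] S_infty_eq_iff[of u i "Suc i"]
  by (auto simp: descend_at_def)

text \<open>Exchanges that avoid i and i + 1 commute with s_i and keep their cover conditions, so
  the operator acts on each term through its starting permutation.\<close>

lemma row_D_chain_sum:
  assumes "1 \<le> i" "1 \<le> r" "i \<notin> insert r (set as)" "Suc i \<notin> insert r (set as)" "0 \<notin> set as" "u \<in> S_infty"
  shows "row.D i (chain_sum groth r as u) = chain_sum groth r as (descend_at i u)"
  using assms(3-6)
proof (induction as arbitrary: u)
  case Nil
  then show ?case using assms(1) by (simp add: row_D_groth)
next
  case (Cons a as)
  have [simp]: "cov r a (descend_at i u) = cov r a u"
    using Cons.prems by (auto simp: descend_at_def cov_simple_refl)
  have "transpose a r i = i" "transpose a r (Suc i) = Suc i" using Cons.prems by auto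
  then have [simp]: "descend_at i (u \<circ> transpose a r) = descend_at i u \<circ> transpose a r"
    using Cons.prems transpose_simple_refl[of i a r u] by (simp add: descend_at_def)
  have "u \<circ> transpose a r \<in> S_infty"
    using Cons.prems assms(2) by (intro S_infty_comp S_infty_transpose) auto
  note IH = Cons.IH[OF _ _ _ this] Cons.IH[of u]
  show ?case using IH Cons.prems by (simp add: row.D_diff del: o_apply)
qed

lemma row_D_chain_sum_descent:
  assumes "1 \<le> i" "1 \<le> r" "i \<notin> insert r (set as)" "Suc i \<notin> insert r (set as)" "0 \<notin> set as" "u \<in> S_infty"
    and "u (Suc i) < u i"
  shows "row.D i (chain_sum groth r as u) = chain_sum groth r as (u \<circ> simple_refl i)"
  using row_D_chain_sum[OF assms(1-6)] assms(7) by (simp add: descend_at_def)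

lemma row_D_chain_sum_ascent:
  assumes "1 \<le> i" "1 \<le> r" "i \<notin> insert r (set as)" "Suc i \<notin> insert r (set as)" "0 \<notin> set as" "u \<in> S_infty"
    and "u i < u (Suc i)"
  shows "row.D i (chain_sum groth r as u) = chain_sum groth r as u"
  using row_D_chain_sum[OF assms(1-6)] assms(7) by (simp add: descend_at_def)

text \<open>If u r lies below u i, then only i + 1 can be exchanged before and only i after applying
  s_i, and these terms correspond. Otherwise u (i+1) < u i < u r: the operator sends the exchange at
  i + 1 and the double exchange to the same sum with opposite signs, they cancel, and the exchange
  at i becomes that at i + 1.\<close>

lemma row_D_chain_sum_pair_left:
  assumes i: "1 \<le> i" "Suc i < r" and as: "i \<notin> set as" "Suc i \<notin> set as" "r \<notin> set as" "0 \<notin> set as"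
    and u: "u \<in> S_infty" and d: "u (Suc i) < u i"
  shows "row.D i (chain_sum groth r (i # Suc i # as) u) =
    chain_sum groth r (i # Suc i # as) (u \<circ> simple_refl i)"
proof -
  let ?j = "Suc i" and ?X = "chain_sum groth r as"
  let ?ti = "transpose i r" and ?tj = "transpose (Suc i) r" and ?v = "u \<circ> simple_refl i"
  note val = S_infty_eq_iff[OF u]
  have S: "u \<circ> ?ti \<in> S_infty" "u \<circ> ?tj \<in> S_infty" "u \<circ> ?ti \<circ> ?tj \<in> S_infty"
    using u i by (auto intro!: S_infty_comp S_infty_transpose)
  have D: "row.D i (?X w) = ?X (w \<circ> simple_refl i)" if "w \<in> S_infty" "w (Suc i) < w i" for w
    using that i as by (intro row_D_chain_sum_descent) auto
  have A: "row.D i (?X w) = ?X w" if "w \<in> S_infty" "w i < w (Suc i)" for w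
    using that i as by (intro row_D_chain_sum_ascent) auto
  \<comment> \<open>\<open>B c\<close>: beyond i + 1 and before r there is no entry strictly between
    c and u r. All four cover conditions reduce to it.\<close>
  define B where "B c \<longleftrightarrow> (\<forall>x. Suc i < x \<and> x < r \<longrightarrow> \<not> (c < u x \<and> u x < u r))" for c
  have split: "(\<forall>x. i < x \<and> x < r \<longrightarrow> P x) \<longleftrightarrow> P (Suc i) \<and> (\<forall>x. Suc i < x \<and> x < r \<longrightarrow> P x)" for P
    using i by (metis Suc_lessI lessI less_trans)
  have sv: "?v i = u (Suc i)" "?v (Suc i) = u i" "?v r = u r" "\<And>x. Suc i < x \<Longrightarrow> ?v x = u x"
    using i by auto
  have iv: "a < x \<and> x < r \<or> r < x \<and> x < a \<longleftrightarrow> a < x \<and> x < r" if "a < r" for a x :: nat using that by auto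
  have cj: "cov r ?j u \<longleftrightarrow> u ?j < u r \<and> B (u ?j)"
    using i by (auto simp: cov_def B_def)
  have ci: "cov r i u \<longleftrightarrow> u i < u r \<and> B (u i)"
    using i d unfolding cov_def iv[of i, OF Suc_lessD[OF i(2)]] split by (auto simp: B_def)
  have cjv: "cov r ?j ?v \<longleftrightarrow> u i < u r \<and> B (u i)"
    using i sv unfolding cov_def by (auto simp: B_def)
  have civ: "cov r i ?v \<longleftrightarrow> u ?j < u r \<and> u r < u i \<and> B (u ?j)"
    using i d sv val[of i r] unfolding cov_def iv[of i, OF Suc_lessD[OF i(2)]] split by (auto simp: B_def)
  show ?thesis
  proof (cases "u r < u i")
    case True
    have e: "u \<circ> ?tj \<circ> simple_refl i = ?v \<circ> ?ti"
      using i by (auto simp: fun_eq_iff simple_refl_def transpose_def)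
    have "\<not> cov r ?j (?v \<circ> ?ti)"
      using d i sv by (simp add: cov_def transpose_def)
    moreover have "row.D i (?X (u \<circ> ?tj)) = ?X (?v \<circ> ?ti)"
      using D[OF S(2)] True i e by (simp add: transpose_def)
    moreover have "row.D i (?X u) = ?X ?v" using D[OF u d] .
    ultimately show ?thesis
      using True d by (simp add: ci cj cjv civ row.D_diff del: o_apply)
  next
    case False
    then have lt: "u i < u r" using val[of i r] i by auto
    have e: "u \<circ> ?ti \<circ> simple_refl i = ?v \<circ> ?tj" "u \<circ> ?ti \<circ> ?tj \<circ> simple_refl i = u \<circ> ?tj"
      using i by (auto simp: fun_eq_iff simple_refl_def transpose_def)
    have d0: "row.D i (?X u) = ?X ?v" using D[OF u d] .
    have d1: "row.D i (?X (u \<circ> ?ti)) = ?X (?v \<circ> ?tj)"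
      using D[OF S(1)] lt d i e by (simp add: transpose_def)
    have d2: "row.D i (?X (u \<circ> ?tj)) = ?X (u \<circ> ?tj)"
      using A[OF S(2)] lt i by (simp add: transpose_def)
    have d3: "row.D i (?X (u \<circ> ?ti \<circ> ?tj)) = ?X (u \<circ> ?tj)"
      using D[OF S(3)] lt i e by (simp add: transpose_def)
    have ut: "(u \<circ> ?ti) (Suc i) = u (Suc i)" "(u \<circ> ?ti) r = u i" "\<And>x. Suc i < x \<Longrightarrow> x < r \<Longrightarrow> (u \<circ> ?ti) x = u x"
      using i by (auto simp: transpose_def)
    have "cov r ?j (u \<circ> ?ti) \<longleftrightarrow> (\<forall>x. Suc i < x \<and> x < r \<longrightarrow> \<not> (u ?j < u x \<and> u x < u i))"
      using i d ut unfolding cov_def by auto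
    moreover have "u ?j < u x \<and> u x < u i \<longleftrightarrow> u ?j < u x \<and> u x < u r"
      if "B (u i)" "Suc i < x" "x < r" for x
    proof -
      have "u x \<noteq> u i" using that val[of x i] by simp
      moreover have "\<not> (u i < u x \<and> u x < u r)" using that by (simp add: B_def)
      ultimately show ?thesis using lt by linarith
    qed
    ultimately have c: "B (u i) \<Longrightarrow> cov r ?j (u \<circ> ?ti) \<longleftrightarrow> B (u ?j)"
      unfolding B_def by blast
    have b: "B (u ?j) \<Longrightarrow> B (u i)" using d unfolding B_def by (meson order.strict_trans)
    show ?thesis
    proof (cases "B (u i)")
      case True
      show ?thesis
        using lt d True c[OF True] by (cases "B (u ?j)")
          (simp_all add: ci cj cjv civ row.D_diff row.D_add d0 d1 d2 d3 del: o_apply)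
    next
      case False
      then show ?thesis
        using lt d b by (auto simp: ci cj cjv civ d0 simp del: o_apply)
    qed
  qed
qed

text \<open>The mirror image of the previous argument. The larger position comes first because the
  positions to the right of the pivot are processed from the far end.\<close>

lemma row_D_chain_sum_pair_right:
  assumes i: "1 \<le> r" "r < i" and as: "i \<notin> set as" "Suc i \<notin> set as" "r \<notin> set as" "0 \<notin> set as"
    and u: "u \<in> S_infty" and d: "u (Suc i) < u i"
  shows "row.D i (chain_sum groth r (Suc i # i # as) u) =
    chain_sum groth r (Suc i # i # as) (u \<circ> simple_refl i)"
proof -
  let ?j = "Suc i" and ?X = "chain_sum groth r as"
  let ?ti = "transpose i r" and ?tj = "transpose (Suc i) r" and ?v = "u \<circ> simple_refl i"
  note val = S_infty_eq_iff[OF u]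
  have S: "u \<circ> ?ti \<in> S_infty" "u \<circ> ?tj \<in> S_infty" "u \<circ> ?tj \<circ> ?ti \<in> S_infty"
    using u i by (auto intro!: S_infty_comp S_infty_transpose)
  have D: "row.D i (?X w) = ?X (w \<circ> simple_refl i)" if "w \<in> S_infty" "w (Suc i) < w i" for w
    using that i as by (intro row_D_chain_sum_descent) auto
  have A: "row.D i (?X w) = ?X w" if "w \<in> S_infty" "w i < w (Suc i)" for w
    using that i as by (intro row_D_chain_sum_ascent) auto
  define B where "B c \<longleftrightarrow> (\<forall>x. r < x \<and> x < i \<longrightarrow> \<not> (u r < u x \<and> u x < c))" for c
  have split: "(\<forall>x. r < x \<and> x < Suc i \<longrightarrow> P x) \<longleftrightarrow> P i \<and> (\<forall>x. r < x \<and> x < i \<longrightarrow> P x)" for P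
    using i by (metis less_Suc_eq)
  have sv: "?v i = u (Suc i)" "?v (Suc i) = u i" "?v r = u r" "\<And>x. x < i \<Longrightarrow> ?v x = u x"
    using i by auto
  have iv: "a < x \<and> x < r \<or> r < x \<and> x < a \<longleftrightarrow> r < x \<and> x < a" if "r < a" for a x :: nat using that by auto
  have ci: "cov r i u \<longleftrightarrow> u r < u i \<and> B (u i)"
    using i by (auto simp: cov_def B_def)
  have cj: "cov r ?j u \<longleftrightarrow> u r < u ?j \<and> B (u ?j)"
    using i d unfolding cov_def iv[of ?j, OF less_SucI[OF i(2)]] split by (auto simp: B_def)
  have civ: "cov r i ?v \<longleftrightarrow> u r < u ?j \<and> B (u ?j)"
    using i sv unfolding cov_def by (auto simp: B_def)
  have cjv: "cov r ?j ?v \<longleftrightarrow> u ?j < u r \<and> u r < u i \<and> B (u i)"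
    using i d sv val[of ?j r] unfolding cov_def iv[of ?j, OF less_SucI[OF i(2)]] split by (auto simp: B_def)
  show ?thesis
  proof (cases "u ?j < u r")
    case True
    have e: "u \<circ> ?ti \<circ> simple_refl i = ?v \<circ> ?tj"
      using i by (auto simp: fun_eq_iff simple_refl_def transpose_def)
    have "\<not> cov r i (?v \<circ> ?tj)"
      using d i sv by (simp add: cov_def transpose_def)
    moreover have "row.D i (?X (u \<circ> ?ti)) = ?X (?v \<circ> ?tj)"
      using D[OF S(1)] True i e by (simp add: transpose_def)
    moreover have "row.D i (?X u) = ?X ?v" using D[OF u d] .
    ultimately show ?thesis
      using True d by (simp add: ci cj cjv civ row.D_diff del: o_apply)
  next
    case False
    then have lt: "u r < u ?j" using val[of ?j r] i by auto
    have e: "u \<circ> ?tj \<circ> simple_refl i = ?v \<circ> ?ti" "u \<circ> ?tj \<circ> ?ti \<circ> simple_refl i = u \<circ> ?ti"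
      using i by (auto simp: fun_eq_iff simple_refl_def transpose_def)
    have d0: "row.D i (?X u) = ?X ?v" using D[OF u d] .
    have d1: "row.D i (?X (u \<circ> ?tj)) = ?X (?v \<circ> ?ti)"
      using D[OF S(2)] lt d i e by (simp add: transpose_def)
    have d2: "row.D i (?X (u \<circ> ?ti)) = ?X (u \<circ> ?ti)"
      using A[OF S(1)] lt i by (simp add: transpose_def)
    have d3: "row.D i (?X (u \<circ> ?tj \<circ> ?ti)) = ?X (u \<circ> ?ti)"
      using D[OF S(3)] lt i e by (simp add: transpose_def)
    have ut: "(u \<circ> ?tj) i = u i" "(u \<circ> ?tj) r = u ?j" "\<And>x. r < x \<Longrightarrow> x < i \<Longrightarrow> (u \<circ> ?tj) x = u x"
      using i by (auto simp: transpose_def)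
    have "cov r i (u \<circ> ?tj) \<longleftrightarrow> (\<forall>x. r < x \<and> x < i \<longrightarrow> \<not> (u ?j < u x \<and> u x < u i))"
      using i d ut unfolding cov_def by auto
    moreover have "u ?j < u x \<and> u x < u i \<longleftrightarrow> u r < u x \<and> u x < u i"
      if "B (u ?j)" "r < x" "x < i" for x
    proof -
      have "u x \<noteq> u ?j" using that val[of x ?j] by simp
      moreover have "\<not> (u r < u x \<and> u x < u ?j)" using that by (simp add: B_def)
      ultimately show ?thesis using lt by linarith
    qed
    ultimately have c: "B (u ?j) \<Longrightarrow> cov r i (u \<circ> ?tj) \<longleftrightarrow> B (u i)"
      unfolding B_def by blast
    have b: "B (u i) \<Longrightarrow> B (u ?j)" using d unfolding B_def by (meson order.strict_trans)
    show ?thesis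
    proof (cases "B (u ?j)")
      case True
      show ?thesis
        using lt d True c[OF True] by (cases "B (u i)")
          (simp_all add: ci cj cjv civ row.D_diff row.D_add d0 d1 d2 d3 del: o_apply)
    next
      case False
      then show ?thesis
        using lt d b by (auto simp: ci cj cjv civ d0 simp del: o_apply)
    qed
  qed
qed

text \<open>Carries a result for the tail of the list, in practice one of the two adjacent-pair
  lemmas, over the positions processed before it.\<close>

lemma row_D_chain_sum_append:
  assumes xs: "\<And>u. u \<in> S_infty \<Longrightarrow> u (Suc i) < u i \<Longrightarrow>
      row.D i (chain_sum groth r xs u) = chain_sum groth r xs (u \<circ> simple_refl i)"
    and "1 \<le> i" "1 \<le> r" "i \<notin> insert r (set as)" "Suc i \<notin> insert r (set as)" "0 \<notin> set as" "u \<in> S_infty"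
    "u (Suc i) < u i"
  shows "row.D i (chain_sum groth r (as @ xs) u) = chain_sum groth r (as @ xs) (u \<circ> simple_refl i)"
  using assms(4-8)
proof (induction as arbitrary: u)
  case Nil
  then show ?case using xs by (simp del: o_apply)
next
  case (Cons a as)
  have [simp]: "cov r a (u \<circ> simple_refl i) = cov r a u"
    using Cons.prems by (auto simp: cov_simple_refl)
  have t: "(u \<circ> transpose a r) i = u i" "(u \<circ> transpose a r) (Suc i) = u (Suc i)"
    using Cons.prems by auto
  have [simp]: "u \<circ> simple_refl i \<circ> transpose a r = u \<circ> transpose a r \<circ> simple_refl i"
    using Cons.prems transpose_simple_refl[of i a r u] by simp
  have "u \<circ> transpose a r \<in> S_infty"
    using Cons.prems assms(3) by (intro S_infty_comp S_infty_transpose) auto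
  then show ?case using Cons.IH[of u] Cons.IH[of "u \<circ> transpose a r"] Cons.prems t
    by (auto simp add: row.D_diff simp del: o_apply)
qed

text \<open>Here the pivot itself is moved by s_r. The entry at r + 1 only decreases along a left
  chain, so it stays below the entry at r; the final position r is never a cover and is listed only
  to complete the range to the left of r + 1.\<close>

lemma chain_sum_left_descend:
  assumes "1 \<le> r" "\<forall>a\<in>set as. 1 \<le> a \<and> a < r" "u \<in> S_infty" "u (Suc r) < u r"
  shows "chain_sum groth r as (u \<circ> simple_refl r) = row.D r (chain_sum groth (Suc r) (as @ [r]) u)"
  using assms(2-4)
proof (induction as arbitrary: u)
  case Nil
  have "\<not> cov (Suc r) r u" using Nil by (auto simp: cov_def)
  then show ?case using Nil assms(1) by (simp add: groth_descend del: o_apply)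
next
  case (Cons a as)
  have a: "1 \<le> a" "a < r" using Cons.prems by auto
  have sv: "(u \<circ> simple_refl r) r = u (Suc r)" "\<And>x. x < r \<Longrightarrow> (u \<circ> simple_refl r) x = u x" by auto
  have "cov r a (u \<circ> simple_refl r) \<longleftrightarrow> u a < u (Suc r) \<and> (\<forall>x. a < x \<and> x < r \<longrightarrow> \<not> (u a < u x \<and> u x < u (Suc r)))"
    unfolding cov_def sv(1) using a sv(2) by auto
  also have "\<dots> \<longleftrightarrow> cov (Suc r) a u"
    using a Cons.prems(3) by (auto simp: cov_def less_Suc_eq)
  finally have c: "cov r a (u \<circ> simple_refl r) = cov (Suc r) a u" .
  have e: "u \<circ> simple_refl r \<circ> transpose a r = u \<circ> transpose a (Suc r) \<circ> simple_refl r"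
    using a by (auto simp: fun_eq_iff simple_refl_def transpose_def)
  have "u \<circ> transpose a (Suc r) \<in> S_infty"
    using Cons.prems a by (intro S_infty_comp S_infty_transpose) auto
  moreover have "(u \<circ> transpose a (Suc r)) (Suc r) < (u \<circ> transpose a (Suc r)) r" if "cov (Suc r) a u"
    using that a Cons.prems(3) by (auto simp: cov_def transpose_def)
  ultimately show ?case using Cons.IH[of u] Cons.IH[of "u \<circ> transpose a (Suc r)"] Cons.prems
    by (simp add: c e row.D_diff del: o_apply)
qed

text \<open>In the second claim the final position r contributes the difference D_r - 1. If a chain
  lowers the entry at r below that at r + 1, its terms are fixed by D_r and vanish under D_r - 1; on
  the other side the entry at r then blocks the corresponding exchange with pivot r + 1.\<close>

lemma chain_sum_left_ascend:
  assumes "1 \<le> r" "\<forall>a\<in>set as. 1 \<le> a \<and> a < r" "u \<in> S_infty"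
  shows "u r < u (Suc r) \<Longrightarrow> row.D r (chain_sum groth r as u) = chain_sum groth r as u"
    and "u (Suc r) < u r \<Longrightarrow> chain_sum groth (Suc r) (as @ [r]) (u \<circ> simple_refl r) =
      row.D r (chain_sum groth r as u) - chain_sum groth r as u"
proof -
  have "(u r < u (Suc r) \<longrightarrow> row.D r (chain_sum groth r as u) = chain_sum groth r as u) \<and>
    (u (Suc r) < u r \<longrightarrow> chain_sum groth (Suc r) (as @ [r]) (u \<circ> simple_refl r) =
      row.D r (chain_sum groth r as u) - chain_sum groth r as u)"
    using assms(2,3)
  proof (induction as arbitrary: u)
    case Nil
    have "u \<circ> simple_refl r \<circ> transpose r (Suc r) = u"
      by (auto simp: fun_eq_iff simple_refl_def)
    moreover have "cov (Suc r) r (u \<circ> simple_refl r)" if "u (Suc r) < u r"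
      using that by (auto simp: cov_def)
    ultimately show ?case using Nil assms(1)
      by (auto simp: groth_descend row_D_groth_ascent simp del: o_apply)
  next
    case (Cons a as)
    have a: "1 \<le> a" "a < r" using Cons.prems by auto
    have tS: "u \<circ> transpose a r \<in> S_infty"
      using Cons.prems a by (intro S_infty_comp S_infty_transpose) auto
    have tv: "(u \<circ> transpose a r) r = u a" "(u \<circ> transpose a r) (Suc r) = u (Suc r)"
      using a by (auto simp: transpose_def)
    note IH = Cons.IH[of u] Cons.IH[OF _ tS]
    have as: "\<forall>a\<in>set as. 1 \<le> a \<and> a < r" using Cons.prems by auto
    show ?case
    proof (intro conjI impI)
      assume "u r < u (Suc r)"
      moreover have "(u \<circ> transpose a r) r < (u \<circ> transpose a r) (Suc r)" if "cov r a u"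
        using that calculation a tv by (auto simp: cov_def)
      ultimately show "row.D r (chain_sum groth r (a # as) u) = chain_sum groth r (a # as) u"
        using IH as Cons.prems by (simp add: row.D_diff del: o_apply)
    next
      assume d: "u (Suc r) < u r"
      let ?v = "u \<circ> simple_refl r"
      have sv: "?v r = u (Suc r)" "?v (Suc r) = u r" "\<And>x. x < r \<Longrightarrow> ?v x = u x" by auto
      have "cov (Suc r) a ?v \<longleftrightarrow> u a < u r \<and> (\<forall>x. a < x \<and> x < Suc r \<longrightarrow> \<not> (u a < ?v x \<and> ?v x < u r))"
        unfolding cov_def sv(2) using a sv(3) by auto
      also have "\<dots> \<longleftrightarrow> cov r a u \<and> u (Suc r) < u a"
        unfolding cov_def less_Suc_eq using a sv(1,3) d S_infty_eq_iff[OF Cons.prems(2), of a "Suc r"]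
        by (auto simp del: o_apply)
      finally have c: "cov (Suc r) a ?v \<longleftrightarrow> cov r a u \<and> u (Suc r) < u a" .
      have e: "?v \<circ> transpose a (Suc r) = u \<circ> transpose a r \<circ> simple_refl r"
        using a by (auto simp: fun_eq_iff simple_refl_def transpose_def)
      have "u a \<noteq> u (Suc r)" using S_infty_eq_iff[OF Cons.prems(2)] a by simp
      then consider "u a < u (Suc r)" | "u (Suc r) < u a" by linarith
      then show "chain_sum groth (Suc r) ((a # as) @ [r]) ?v =
          row.D r (chain_sum groth r (a # as) u) - chain_sum groth r (a # as) u"
      proof cases
        case 1
        then show ?thesis using IH as Cons.prems d tv c
          by (simp add: row.D_diff del: o_apply)
      next
        case 2
        then show ?thesis using IH as Cons.prems d tv c e
          by (simp add: row.D_diff del: o_apply)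
      qed
    qed
  qed
  then show "u r < u (Suc r) \<Longrightarrow> row.D r (chain_sum groth r as u) = chain_sum groth r as u"
    and "u (Suc r) < u r \<Longrightarrow> chain_sum groth (Suc r) (as @ [r]) (u \<circ> simple_refl r) =
      row.D r (chain_sum groth r as u) - chain_sum groth r as u"
    by blast+
qed

text \<open>Right chains raise the entry at the pivot r, so it stays above the entry at r + 1, and
  the final position r + 1 is never a cover.\<close>

lemma chain_sum_right_ascend:
  assumes "1 \<le> r" "\<forall>b\<in>set bs. Suc r < b" "u \<in> S_infty" "u (Suc r) < u r"
  shows "chain_sum groth (Suc r) bs (u \<circ> simple_refl r) = row.D r (chain_sum groth r (bs @ [Suc r]) u)"
  using assms(2-4)
proof (induction bs arbitrary: u)
  case Nil
  have "\<not> cov r (Suc r) u" using Nil by (auto simp: cov_def)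
  then show ?case using Nil assms(1) by (simp add: groth_descend del: o_apply)
next
  case (Cons b bs)
  have b: "Suc r < b" using Cons.prems by auto
  have sv: "(u \<circ> simple_refl r) (Suc r) = u r" "\<And>x. Suc r < x \<Longrightarrow> (u \<circ> simple_refl r) x = u x" by auto
  have "cov (Suc r) b (u \<circ> simple_refl r) \<longleftrightarrow> u r < u b \<and> (\<forall>x. Suc r < x \<and> x < b \<longrightarrow> \<not> (u r < u x \<and> u x < u b))"
    unfolding cov_def sv(1) using b sv(2) by auto
  also have "\<dots> \<longleftrightarrow> cov r b u"
    unfolding cov_def using b Cons.prems(3)
    by (auto simp: Suc_lessI dest: Suc_lessI)
  finally have c: "cov (Suc r) b (u \<circ> simple_refl r) = cov r b u" .
  have e: "u \<circ> simple_refl r \<circ> transpose b (Suc r) = u \<circ> transpose b r \<circ> simple_refl r"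
    using b by (auto simp: fun_eq_iff simple_refl_def transpose_def)
  have "u \<circ> transpose b r \<in> S_infty"
    using Cons.prems b assms(1) by (intro S_infty_comp S_infty_transpose) auto
  moreover have "(u \<circ> transpose b r) (Suc r) < (u \<circ> transpose b r) r" if "cov r b u"
    using that b Cons.prems(3) by (auto simp: cov_def transpose_def)
  ultimately show ?case using Cons.IH[of u] Cons.IH[of "u \<circ> transpose b r"] Cons.prems
    by (simp add: c e row.D_diff del: o_apply)
qed

text \<open>As for left chains, the final position yields D_r - 1, which kills the chains that have
  raised the entry at r + 1 above the entry at r.\<close>

lemma chain_sum_right_descend:
  assumes "1 \<le> r" "\<forall>b\<in>set bs. Suc r < b" "u \<in> S_infty"
  shows "u r < u (Suc r) \<Longrightarrow> row.D r (chain_sum groth (Suc r) bs u) = chain_sum groth (Suc r) bs u"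
    and "u (Suc r) < u r \<Longrightarrow> chain_sum groth r (bs @ [Suc r]) (u \<circ> simple_refl r) =
      row.D r (chain_sum groth (Suc r) bs u) - chain_sum groth (Suc r) bs u"
proof -
  have "(u r < u (Suc r) \<longrightarrow> row.D r (chain_sum groth (Suc r) bs u) = chain_sum groth (Suc r) bs u) \<and>
    (u (Suc r) < u r \<longrightarrow> chain_sum groth r (bs @ [Suc r]) (u \<circ> simple_refl r) =
      row.D r (chain_sum groth (Suc r) bs u) - chain_sum groth (Suc r) bs u)"
    using assms(2,3)
  proof (induction bs arbitrary: u)
    case Nil
    have "u \<circ> simple_refl r \<circ> transpose (Suc r) r = u"
      by (auto simp: fun_eq_iff simple_refl_def transpose_def)
    moreover have "cov r (Suc r) (u \<circ> simple_refl r)" if "u (Suc r) < u r"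
      using that by (auto simp: cov_def)
    ultimately show ?case using Nil assms(1)
      by (auto simp: groth_descend row_D_groth_ascent simp del: o_apply)
  next
    case (Cons b bs)
    have b: "Suc r < b" using Cons.prems by auto
    have tS: "u \<circ> transpose b (Suc r) \<in> S_infty"
      using Cons.prems b by (intro S_infty_comp S_infty_transpose) auto
    have tv: "(u \<circ> transpose b (Suc r)) (Suc r) = u b" "(u \<circ> transpose b (Suc r)) r = u r"
      using b by (auto simp: transpose_def)
    note IH = Cons.IH[of u] Cons.IH[OF _ tS]
    have bs: "\<forall>b\<in>set bs. Suc r < b" using Cons.prems by auto
    show ?case
    proof (intro conjI impI)
      assume "u r < u (Suc r)"
      moreover have "(u \<circ> transpose b (Suc r)) r < (u \<circ> transpose b (Suc r)) (Suc r)" if "cov (Suc r) b u"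
        using that calculation b tv by (auto simp: cov_def)
      ultimately show "row.D r (chain_sum groth (Suc r) (b # bs) u) = chain_sum groth (Suc r) (b # bs) u"
        using IH bs Cons.prems by (simp add: row.D_diff del: o_apply)
    next
      assume d: "u (Suc r) < u r"
      let ?v = "u \<circ> simple_refl r"
      have sv: "?v r = u (Suc r)" "?v (Suc r) = u r" "\<And>x. Suc r < x \<Longrightarrow> ?v x = u x" by auto
      have split: "(\<forall>x. r < x \<and> x < b \<longrightarrow> P x) \<longleftrightarrow> P (Suc r) \<and> (\<forall>x. Suc r < x \<and> x < b \<longrightarrow> P x)" for P
        using b by (metis Suc_lessI lessI less_trans)
      have "cov r b ?v \<longleftrightarrow> u (Suc r) < u b \<and> (\<forall>x. r < x \<and> x < b \<longrightarrow> \<not> (u (Suc r) < ?v x \<and> ?v x < u b))"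
        unfolding cov_def sv(1) using b sv(3) by auto
      also have "\<dots> \<longleftrightarrow> cov (Suc r) b u \<and> u b < u r"
        unfolding cov_def split using b sv(2,3) d S_infty_eq_iff[OF Cons.prems(2), of b r]
        by (auto simp del: o_apply)
      finally have c: "cov r b ?v \<longleftrightarrow> cov (Suc r) b u \<and> u b < u r" .
      have e: "?v \<circ> transpose b r = u \<circ> transpose b (Suc r) \<circ> simple_refl r"
        using b by (auto simp: fun_eq_iff simple_refl_def transpose_def)
      have "u b \<noteq> u r" using S_infty_eq_iff[OF Cons.prems(2)] b by simp
      then consider "u r < u b" | "u b < u r" by linarith
      then show "chain_sum groth r ((b # bs) @ [Suc r]) ?v =
          row.D r (chain_sum groth (Suc r) (b # bs) u) - chain_sum groth (Suc r) (b # bs) u"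
      proof cases
        case 1
        then show ?thesis using IH bs Cons.prems d tv c
          by (simp add: row.D_diff del: o_apply)
      next
        case 2
        then show ?thesis using IH bs Cons.prems d tv c e
          by (simp add: row.D_diff del: o_apply)
      qed
    qed
  qed
  then show "u r < u (Suc r) \<Longrightarrow> row.D r (chain_sum groth (Suc r) bs u) = chain_sum groth (Suc r) bs u"
    and "u (Suc r) < u r \<Longrightarrow> chain_sum groth r (bs @ [Suc r]) (u \<circ> simple_refl r) =
      row.D r (chain_sum groth (Suc r) bs u) - chain_sum groth (Suc r) bs u"
    by blast+
qed

lemma chain_sum_append_no_cov:
  "(\<And>a. a \<in> set as \<Longrightarrow> \<not> cov r a u) \<Longrightarrow> chain_sum g r (as @ bs) u = chain_sum g r bs u"
  by (induction as) auto

lemma chain_sum_no_cov: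
  "(\<And>a. a \<in> set as \<Longrightarrow> \<not> cov r a u) \<Longrightarrow> chain_sum g r as u = g u"
  using chain_sum_append_no_cov[of as r u g "[]"] by simp

lemma upt_split: "i \<le> j \<Longrightarrow> j \<le> k \<Longrightarrow> [i..<k] = [i..<j] @ [j..<k]"
  by (metis le_Suc_ex upt_add_eq_append)

text \<open>
  Lenart's K-theoretic Monk formula for double Grothendieck polynomials, in a form symmetric in
  the two alphabets: chains to the left of \<open>r\<close> against chains to the right of \<open>r\<close>.
\<close>

lemma monk:
  assumes "v permutes {1..N}" "1 \<le> r" "r \<le> N"
  shows "zv r * yv (v r) * chain_sum groth r [1..<r] v =
    chain_sum groth r (rev [Suc r..<Suc (Suc N)]) v"
proof -
  \<comment> \<open>All r are treated at once: the step along s_i derives the formula at i from the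
    one at i + 1, and conversely.\<close>
  have "\<forall>r. 1 \<le> r \<longrightarrow> r \<le> N \<longrightarrow> zv r * yv (v r) * chain_sum groth r [1..<r] v =
      chain_sum groth r (rev [Suc r..<Suc (Suc N)]) v"
    using assms(1)
  proof (induction rule: perm_descend_induct)
    case longest
    show ?case
    proof (intro allI impI)
      fix r assume r: "1 \<le> r" "r \<le> N"
      let ?w = "longest_perm N" and ?t = "transpose (Suc N) r"
      \<comment> \<open>In the longest element larger entries stand to the left of r and smaller
        ones to its right, up to position N + 1. The only chain is the single exchange with N + 1,
        which is why the right-hand range must include that position.\<close>
      have "cov r (Suc N) ?w"
        using r by (auto simp: cov_def longest_perm_def)
      moreover have "chain_sum groth r [1..<r] ?w = groth ?w"
      proof (rule chain_sum_no_cov)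
        fix a assume "a \<in> set [1..<r]"
        then have "a < r" "?w r < ?w a" using r by (auto simp: longest_perm_def)
        then show "\<not> cov r a ?w" by (simp add: cov_def)
      qed
      moreover have "chain_sum groth r (rev [Suc r..<Suc N]) ?w = groth ?w"
      proof (rule chain_sum_no_cov)
        fix a assume "a \<in> set (rev [Suc r..<Suc N])"
        then have "r < a" "?w a < ?w r" using r by (auto simp: longest_perm_def)
        then show "\<not> cov r a ?w" by (simp add: cov_def)
      qed
      moreover have "chain_sum groth r (rev [Suc r..<Suc N]) (?w \<circ> ?t) = groth (?w \<circ> ?t)"
      proof (rule chain_sum_no_cov)
        fix a assume "a \<in> set (rev [Suc r..<Suc N])"
        then have "r < a" "(?w \<circ> ?t) a < (?w \<circ> ?t) r" using r by (auto simp: longest_perm_def transpose_def)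
        then show "\<not> cov r a (?w \<circ> ?t)" by (simp add: cov_def del: o_apply)
      qed
      moreover have "groth (?w \<circ> ?t) = groth ?w * (1 - zv r * yv (?w r))"
        using groth_eqI[OF is_groth_longest_transpose[OF r]] r
        by (simp add: transpose_commute[of "Suc N"] groth_longest longest_perm_def)
      moreover have "rev [Suc r..<Suc (Suc N)] = Suc N # rev [Suc r..<Suc N]"
        using r by simp
      ultimately show "zv r * yv (?w r) * chain_sum groth r [1..<r] ?w =
          chain_sum groth r (rev [Suc r..<Suc (Suc N)]) ?w"
        by (simp add: algebra_simps del: upt_Suc)
    qed
  next
    case (descend v i)
    let ?v = "v \<circ> simple_refl i"
    have vS: "v \<in> S_infty" using descend(1) by (rule S_inftyI)
    have d: "v (Suc i) < v i" and i: "1 \<le> i" "i < N" by fact+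
    note M = descend.IH[rule_format]
    show ?case
    proof (intro allI impI)
      fix r assume r: "1 \<le> r" "r \<le> N"
      consider "r = i" | "r = Suc i" | "i \<noteq> r" "Suc i \<noteq> r" by blast
      then show "zv r * yv (?v r) * chain_sum groth r [1..<r] ?v =
          chain_sum groth r (rev [Suc r..<Suc (Suc N)]) ?v"
      proof cases
        case 1
        define X where "X = chain_sum groth (Suc i) [1..<Suc i] v"
        define Y where "Y = chain_sum groth (Suc i) (rev [Suc (Suc i)..<Suc (Suc N)]) v"
        have XY: "Y = zv (Suc i) * yv (v (Suc i)) * X"
          using M[of "Suc i"] i by (simp add: X_def Y_def del: upt_Suc)
        have "chain_sum groth r [1..<r] ?v = row.D i X"
          using chain_sum_left_descend[of i "[1..<i]" v] i vS d by (simp add: X_def 1 del: o_apply)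
        moreover have "chain_sum groth r (rev [Suc r..<Suc (Suc N)]) ?v = row.D i Y - Y"
          using chain_sum_right_descend(2)[of i "rev [Suc (Suc i)..<Suc (Suc N)]" v] i vS d
          by (simp add: Y_def 1 upt_conv_Cons[of "Suc i" "Suc (Suc N)"] del: o_apply upt_Suc)
        \<comment> \<open>Up to the dotted factor this is the identity D_i (z_(i+1) X) - z_(i+1) X =
          z_i D_i X.\<close>
        moreover have "zv i * yv (v (Suc i)) * row.D i X = row.D i Y - Y"
        proof (rule row.cancel[of i])
          have s: "swap_vars i Y = zv i * yv (v (Suc i)) * swap_vars i X" by (simp add: XY)
          show "(zv (Suc i) - zv i) * (zv i * yv (v (Suc i)) * row.D i X) =
              (zv (Suc i) - zv i) * (row.D i Y - Y)"
            using row.D_rel[of i X] row.D_rel[of i Y] XY s by algebra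
        qed
        ultimately show ?thesis by (simp add: 1)
      next
        case 2
        define X where "X = chain_sum groth i [1..<i] v"
        define Y where "Y = chain_sum groth i (rev [Suc i..<Suc (Suc N)]) v"
        have XY: "Y = zv i * yv (v i) * X"
          using M[of i] i by (simp add: X_def Y_def del: upt_Suc)
        have "chain_sum groth r [1..<r] ?v = row.D i X - X"
          using chain_sum_left_ascend(2)[of i "[1..<i]" v] i vS d by (simp add: X_def 2 del: o_apply)
        moreover have "chain_sum groth r (rev [Suc r..<Suc (Suc N)]) ?v = row.D i Y"
          using chain_sum_right_ascend[of i "rev [Suc (Suc i)..<Suc (Suc N)]" v] i vS d
          by (simp add: Y_def 2 upt_conv_Cons[of "Suc i" "Suc (Suc N)"] del: o_apply upt_Suc)
        \<comment> \<open>Up to the dotted factor this is the identity D_i (z_i X) = z_(i+1) (D_i X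
          - X).\<close>
        moreover have "zv (Suc i) * yv (v i) * (row.D i X - X) = row.D i Y"
        proof (rule row.cancel[of i])
          have s: "swap_vars i Y = zv (Suc i) * yv (v i) * swap_vars i X" by (simp add: XY)
          show "(zv (Suc i) - zv i) * (zv (Suc i) * yv (v i) * (row.D i X - X)) =
              (zv (Suc i) - zv i) * row.D i Y"
            using row.D_rel[of i X] row.D_rel[of i Y] XY s by algebra
        qed
        ultimately show ?thesis by (simp add: 2)
      next
        case 3
        have L: "row.D i (chain_sum groth r [1..<r] v) = chain_sum groth r [1..<r] ?v"
        proof (cases "r < i")
          case True
          then show ?thesis using i r vS d by (intro row_D_chain_sum_descent) auto
        next
          case False
          then have "Suc i < r" using 3 by auto
          then have "[1..<r] = [1..<i] @ i # Suc i # [Suc (Suc i)..<r]"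
            using i by (metis Suc_lessD less_imp_le upt_split upt_conv_Cons)
          moreover have "row.D i (chain_sum groth r ([1..<i] @ i # Suc i # [Suc (Suc i)..<r]) v) =
              chain_sum groth r ([1..<i] @ i # Suc i # [Suc (Suc i)..<r]) ?v"
            using i r vS d \<open>Suc i < r\<close>
            by (intro row_D_chain_sum_append row_D_chain_sum_pair_left) auto
          ultimately show ?thesis by simp
        qed
        have R: "row.D i (chain_sum groth r (rev [Suc r..<Suc (Suc N)]) v) =
            chain_sum groth r (rev [Suc r..<Suc (Suc N)]) ?v"
        proof (cases "r < i")
          case False
          then show ?thesis using i r vS d 3 by (intro row_D_chain_sum_descent) auto
        next
          case True
          have "[Suc r..<Suc (Suc N)] = [Suc r..<i] @ i # Suc i # [Suc (Suc i)..<Suc (Suc N)]"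
            using i True
            by (metis Suc_leI less_SucI less_imp_le Suc_mono upt_split upt_conv_Cons)
          then have "rev [Suc r..<Suc (Suc N)] = rev [Suc (Suc i)..<Suc (Suc N)] @ Suc i # i # rev [Suc r..<i]"
            by (simp del: upt_Suc)
          moreover have "row.D i (chain_sum groth r (rev [Suc (Suc i)..<Suc (Suc N)] @ Suc i # i # rev [Suc r..<i]) v) =
              chain_sum groth r (rev [Suc (Suc i)..<Suc (Suc N)] @ Suc i # i # rev [Suc r..<i]) ?v"
            using i r vS d True
            by (intro row_D_chain_sum_append row_D_chain_sum_pair_right) auto
          ultimately show ?thesis by simp
        qed
        have "swap_vars i (zv r * yv (v r)) = zv r * yv (v r)"
          using 3 by (simp add: swap_vars_zv)
        then have "zv r * yv (v r) * row.D i (chain_sum groth r [1..<r] v) =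
            row.D i (chain_sum groth r (rev [Suc r..<Suc (Suc N)]) v)"
          using M[OF r] by (metis row.D_mult_invariant)
        then show ?thesis using L R 3 by simp
      qed
    qed
  qed
  then show ?thesis using assms by blast
qed

text \<open>The Monk formula for v at r. Since w increases after r and s is the last position there
  with an entry below w r, the only right chains of v are the empty one and the exchange with s,
  which gives back w. The right side thus collapses to the difference of the polynomials of v and
  w.\<close>

lemma transition:
  assumes w: "w \<in> S_infty" and r: "1 \<le> r" and inc: "\<And>q. r < q \<Longrightarrow> w q < w (Suc q)"
    and s: "r < s" "w s < w r" "w r < w (Suc s)" and v: "v = w \<circ> transpose r s"
  shows "groth w = groth v - zv r * yv (w s) * chain_sum groth r [1..<r] v"
proof -
  have vS: "v \<in> S_infty" unfolding v using w r s by (intro S_infty_comp S_infty_transpose) auto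
  obtain N where N: "v permutes {1..N}" "s \<le> N" using S_infty_obtain[OF vS] .
  have mono: "w p < w q" if "r < p" "p < q" for p q
    using that(2,1)
    by (induction rule: less_Suc_induct) (auto intro: inc less_trans)
  have vr: "v r = w s" "v s = w r" "\<And>q. q \<noteq> r \<Longrightarrow> q \<noteq> s \<Longrightarrow> v q = w q" by (auto simp: v transpose_def)
  have w_eq: "v \<circ> transpose s r = w" by (auto simp: v fun_eq_iff transpose_def)
  have "[Suc r..<Suc (Suc N)] = [Suc r..<s] @ s # [Suc s..<Suc (Suc N)]"
    using s N by (metis Suc_leI less_SucI less_Suc_eq_le less_imp_le upt_split upt_conv_Cons)
  then have "chain_sum groth r (rev [Suc r..<Suc (Suc N)]) v =
      chain_sum groth r (rev [Suc s..<Suc (Suc N)] @ s # rev [Suc r..<s]) v"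
    by (simp del: upt_Suc)
  also have "\<dots> = chain_sum groth r (s # rev [Suc r..<s]) v"
  proof (rule chain_sum_append_no_cov)
    fix a assume "a \<in> set (rev [Suc s..<Suc (Suc N)])"
    then have "s < a" by auto
    then have "w r < w a" using s mono[of "Suc s" a] by (cases "a = Suc s") auto
    then show "\<not> cov r a v" using s \<open>s < a\<close> vr unfolding cov_def by fastforce
  qed
  also have "\<dots> = groth v - groth w"
  proof -
    have less: "w q < w s" if "r < q" "q < s" for q using that mono by blast
    have "cov r s v"
      unfolding cov_def
    proof (intro conjI allI impI)
      show "s < r \<and> v s < v r \<or> r < s \<and> v r < v s" using s vr by simp
      fix x assume "s < x \<and> x < r \<or> r < x \<and> x < s"
      then have "v x < v r" using s less[of x] vr by auto
      then show "\<not> (v s < v x \<and> v x < v r \<or> v r < v x \<and> v x < v s)" using s vr by simp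
    qed
    moreover have "chain_sum groth r (rev [Suc r..<s]) u = groth u" if "u = v \<or> u = w" for u
    proof (rule chain_sum_no_cov)
      fix a assume "a \<in> set (rev [Suc r..<s])"
      then have "r < a" "u a < u r" using that less[of a] vr s by auto
      then show "\<not> cov r a u" by (simp add: cov_def)
    qed
    ultimately show ?thesis using w_eq by simp
  qed
  finally show ?thesis using monk[OF N(1) r] s N(2) vr by simp
qed


section \<open>Symmetry in the dotted variables and stable limits\<close>

text \<open>The column operator D_j multiplies the permutation by s_j from the left. For the longest
  element, row operator k - j and column operator j remove the same box (k - j, j) of the staircase;
  the statement then descends because row and column operators commute.\<close>

lemma col_groth_aux:
  assumes "v permutes {1..k}" "1 \<le> j" "j < k"
  shows "\<forall>a b. v a = j \<longrightarrow> v b = Suc j \<longrightarrow>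
      (a < b \<longrightarrow> swap_dvars j (groth v) = groth v) \<and>
      (b < a \<longrightarrow> col.D j (groth v) = groth (simple_refl j \<circ> v))"
  using assms(1)
proof (induction rule: perm_descend_induct)
  case longest
  let ?w = "longest_perm k" and ?L = "staircase k"
  have a: "a = k + 1 - j" if "?w a = j" for a using that assms by (auto simp: longest_perm_def split: if_splits)
  have b: "b = k - j" if "?w b = Suc j" for b using that assms by (auto simp: longest_perm_def split: if_splits)
  have "simple_refl j \<circ> ?w = ?w \<circ> simple_refl (k - j)"
  proof
    fix p
    consider "p = k - j" | "p = Suc (k - j)" | "p \<noteq> k - j" "p \<noteq> Suc (k - j)" by blast
    then show "(simple_refl j \<circ> ?w) p = (?w \<circ> simple_refl (k - j)) p"
    proof cases
      case 1
      then have "?w p = Suc j" "?w (Suc p) = j" using assms by (auto simp: longest_perm_def)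
      then show ?thesis using 1 by simp
    next
      case 2
      then have "?w p = j" "?w (k - j) = Suc j" using assms by (auto simp: longest_perm_def)
      then show ?thesis using 2 by simp
    next
      case 3
      then have "?w p \<noteq> j" "?w p \<noteq> Suc j" using assms by (auto simp: longest_perm_def)
      then show ?thesis using 3 by simp
    qed
  qed
  then have "groth (simple_refl j \<circ> ?w) = row.D (k - j) (groth ?w)"
    using assms longest_perm_descent[of "k - j" k]
    by (subst groth_descend) (auto intro: S_inftyI[OF longest_permutes])
  also have "\<dots> = diagram_prod (?L - {(k - j, j)})"
    unfolding groth_longest using assms
    by (intro row_D_diagram_prod finite_staircase) (auto simp: staircase_def, auto simp: simple_refl_def transpose_def)
  also have "\<dots> = col.D j (groth ?w)"
    unfolding groth_longest using assms
    by (intro col_D_diagram_prod[symmetric] finite_staircase) (auto simp: staircase_def, auto simp: simple_refl_def transpose_def)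
  finally have eq: "groth (simple_refl j \<circ> ?w) = col.D j (groth ?w)" .
  show ?case
  proof (intro allI impI)
    fix p q assume "?w p = j" "?w q = Suc j"
    then have "q < p" using a[of p] b[of q] assms by simp
    then show "(p < q \<longrightarrow> swap_dvars j (groth ?w) = groth ?w) \<and>
        (q < p \<longrightarrow> col.D j (groth ?w) = groth (simple_refl j \<circ> ?w))"
      by (simp add: eq del: o_apply)
  qed
next
  case (descend v i)
  have vS: "v \<in> S_infty" using descend(1) by (rule S_inftyI)
  have d: "v (Suc i) < v i" and i: "1 \<le> i" "i < k" by fact+
  have G: "groth (v \<circ> simple_refl i) = row.D i (groth v)"
    using groth_descend[OF vS i(1) d] by simp
  show ?case
  proof (intro allI impI)
    fix a b assume "(v \<circ> simple_refl i) a = j" "(v \<circ> simple_refl i) b = Suc j"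
    then have v': "v (simple_refl i a) = j" "v (simple_refl i b) = Suc j" by auto
    note IH = descend.IH[rule_format, OF v']
    show "(a < b \<longrightarrow> swap_dvars j (groth (v \<circ> simple_refl i)) = groth (v \<circ> simple_refl i)) \<and>
        (b < a \<longrightarrow> col.D j (groth (v \<circ> simple_refl i)) = groth (simple_refl j \<circ> (v \<circ> simple_refl i)))"
    proof (cases "{simple_refl i a, simple_refl i b} = {i, Suc i}")
      \<comment> \<open>The positions of j and j + 1 are exactly those exchanged by s_i, so left
        multiplication by s_j coincides with right multiplication by s_i, and the new polynomial is
        in the image of the column operator.\<close>
      case True
      then have ab: "simple_refl i a = Suc i" "simple_refl i b = i"
        using d v' by (auto simp: doubleton_eq_iff)
      then have "a = i" "b = Suc i" by (metis simple_refl_invol(1) simple_refl_simps(1))+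
      moreover have "simple_refl j \<circ> v = v \<circ> simple_refl i"
      proof
        fix p
        have "v p = j \<longleftrightarrow> p = Suc i" "v p = Suc j \<longleftrightarrow> p = i"
          using v' ab S_infty_eq_iff[OF vS] by metis+
        then show "(simple_refl j \<circ> v) p = (v \<circ> simple_refl i) p"
          using v' ab by (cases "p = i"; cases "p = Suc i") auto
      qed
      moreover have "col.D j (groth v) = groth (simple_refl j \<circ> v)" using IH ab by simp
      ultimately show ?thesis using col.D_invariant[of j "groth v"] by simp
    next
      case False
      have lt: "a < b \<longleftrightarrow> simple_refl i a < simple_refl i b" "b < a \<longleftrightarrow> simple_refl i b < simple_refl i a"
        using False by (auto simp: simple_refl_def transpose_def split: if_splits)
      have "swap_dvars j (row.D i (groth v)) = row.D i (swap_dvars j (groth v))"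
      proof (rule exchange_D_hom[OF row.exchange_axioms row.exchange_axioms])
        have "swap_var i (transpose (Zd j) (Zd (Suc j)) x) = transpose (Zd j) (Zd (Suc j)) (swap_var i x)" for x
          by (cases x) (auto simp: transpose_def)
        then show "swap_dvars j (swap_vars i (groth v)) = swap_vars i (swap_dvars j (groth v))"
          by (simp add: swap_vars_eq subst_subst)
      qed (simp_all add: subst_mult subst_diff)
      moreover have "col.D j (row.D i (groth v)) = row.D i (col.D j (groth v))"
        by (rule exchange_D_commute[OF col.exchange_axioms row.exchange_axioms]) auto
      moreover have "row.D i (groth (simple_refl j \<circ> v)) = groth (simple_refl j \<circ> v \<circ> simple_refl i)"
      proof (rule groth_descend)
        have "v (Suc i) \<noteq> j \<or> v i \<noteq> Suc j"
          using False v' S_infty_eq_iff[OF vS] by (metis doubleton_eq_iff)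
        then show "(simple_refl j \<circ> v) (Suc i) < (simple_refl j \<circ> v) i"
          using d by (auto simp: simple_refl_def transpose_def)
        show "simple_refl j \<circ> v \<in> S_infty" by (intro S_infty_comp S_infty_simple_refl assms(2) vS)
      qed (rule i(1))
      ultimately show ?thesis using IH lt unfolding G o_assoc by presburger
    qed
  qed
qed

lemma swap_dvars_groth:
  assumes "v \<in> S_infty" "1 \<le> j" "v a = j" "v b = Suc j" "a < b"
  shows "swap_dvars j (groth v) = groth v"
proof -
  obtain k where "v permutes {1..k}" "Suc j \<le> k" using S_infty_obtain[OF assms(1)] .
  then show ?thesis using col_groth_aux[of v k j] assms by auto
qed

section \<open>Stability under shifting\<close>

fun up_var :: "var \<Rightarrow> var" where
  "up_var (Z i) = Z (Suc i)"
| "up_var (Zd j) = Zd j"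

text \<open>In one-line notation k + 1 is put in front of a permutation of 1, ..., k, which adds a
  full first row to the diagram.\<close>

definition cons_perm :: "nat \<Rightarrow> (nat \<Rightarrow> nat) \<Rightarrow> nat \<Rightarrow> nat" where
  "cons_perm k u p = (if p = 0 then 0 else if p = 1 then Suc k else if p \<le> Suc k then u (p - 1) else p)"

definition first_row :: "nat \<Rightarrow> laurent" where
  "first_row k = (\<Prod>j\<in>{1..k}. 1 - zv 1 * yv j)"

text \<open>A staircase is a full first row on top of a smaller staircase. The factor of that row
  contains only z_1 among the undotted variables, hence is untouched by D_2, D_3, ..., and it
  persists all the way down from the longest element.\<close>

lemma groth_cons:
  assumes "u permutes {1..k}"
  shows "groth (cons_perm k u) = first_row k * rename up_var (groth u)"
proof -
  have "is_groth k u f \<Longrightarrow> is_groth (Suc k) (cons_perm k u) (first_row k * rename up_var f)" for u f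
  proof (induction rule: is_groth.induct)
    case longest
    have "cons_perm k (longest_perm k) = longest_perm (Suc k)"
      by (auto simp: fun_eq_iff cons_perm_def longest_perm_def)
    moreover have "diagram_prod (staircase (Suc k)) =
        first_row k * rename up_var (diagram_prod (staircase k))"
    proof -
      have un: "staircase (Suc k) = Pair 1 ` {1..k} \<union> map_prod Suc id ` staircase k"
      proof (intro set_eqI iffI)
        fix x assume "x \<in> staircase (Suc k)"
        then obtain i j where x: "x = (i, j)" and ij: "1 \<le> i" "1 \<le> j" "i + j \<le> Suc k" by (auto simp: staircase_def)
        show "x \<in> Pair 1 ` {1..k} \<union> map_prod Suc id ` staircase k"
        proof (cases "i = 1")
          case False
          then have "(i - 1, j) \<in> staircase k" "x = map_prod Suc id (i - 1, j)"
            using ij x by (auto simp: staircase_def)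
          then show ?thesis by blast
        qed (use x ij in auto)
      qed (auto simp: staircase_def)
      have "Pair 1 ` {1..k} \<inter> map_prod Suc id ` staircase k = {}" by (auto simp: staircase_def)
      then have "diagram_prod (staircase (Suc k)) = diagram_prod (Pair 1 ` {1..k}) * diagram_prod (map_prod Suc id ` staircase k)"
        unfolding diagram_prod_def un by (intro prod.union_disjoint) auto
      moreover have "diagram_prod (Pair 1 ` {1..k}) = first_row k"
        unfolding diagram_prod_def first_row_def by (subst prod.reindex) (auto simp: inj_on_def)
      moreover have "diagram_prod (map_prod Suc id ` staircase k) = rename up_var (diagram_prod (staircase k))"
        unfolding diagram_prod_def
        by (subst prod.reindex) (auto simp: inj_on_def subst_prod split_def subst_diff subst_mult rename_var_pow)
      ultimately show ?thesis by simp
    qed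
    ultimately show ?case
      using is_groth_longest[of "Suc k"] by (simp add: diagram_prod_def staircase_def)
  next
    case (descend v f i)
    have vp: "v permutes {1..k}" and vS: "v \<in> S_infty"
      using descend(1) is_groth_permutes S_inftyI by blast+
    have d: "v (Suc i) < v i" using perm_length_less_iff[OF vS] descend by blast
    have "cons_perm k v (Suc (Suc i)) < cons_perm k v (Suc i)"
      using d descend(2,3) by (simp add: cons_perm_def)
    then have "is_groth (Suc k) (cons_perm k v \<circ> simple_refl (Suc i))
        (row.D (Suc i) (first_row k * rename up_var f))"
      using descend.IH descend(2,3) by (intro is_groth_descend) simp_all
    moreover have "cons_perm k v \<circ> simple_refl (Suc i) = cons_perm k (v \<circ> simple_refl i)"
    proof
      fix p
      show "(cons_perm k v \<circ> simple_refl (Suc i)) p = cons_perm k (v \<circ> simple_refl i) p"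
        using descend(2,3) permutes_not_in[OF vp]
        by (cases "p = Suc i"; cases "p = Suc (Suc i)") (auto simp: cons_perm_def)
    qed
    moreover have "row.D (Suc i) (first_row k * rename up_var f) = first_row k * rename up_var (row.D i f)"
    proof -
      have "swap_vars (Suc i) (first_row k) = (\<Prod>j\<in>{1..k}. swap_vars (Suc i) (1 - zv 1 * yv j))"
        unfolding first_row_def swap_vars_eq by (rule subst_prod)
      also have "\<dots> = first_row k"
        using descend(2) by (auto simp: first_row_def swap_vars_zv intro!: prod.cong)
      finally have "row.D (Suc i) (first_row k * rename up_var f) = first_row k * row.D (Suc i) (rename up_var f)"
        by (rule row.D_mult_invariant)
      moreover have "rename up_var (row.D i f) = row.D (Suc i) (rename up_var f)"
      proof (rule exchange_D_hom[OF row.exchange_axioms row.exchange_axioms])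
        have "up_var (swap_var i x) = swap_var (Suc i) (up_var x)" for x
          by (cases x) (auto simp: simple_refl_def transpose_def)
        then show "rename up_var (swap_vars i f) = swap_vars (Suc i) (rename up_var f)"
          by (simp add: swap_vars_eq subst_subst)
      qed (simp_all add: subst_mult subst_diff rename_var_pow)
      ultimately show ?thesis by simp
    qed
    ultimately show ?case by (simp only: demazure_op_eq)
  qed
  then show ?thesis using groth_eqI is_groth_groth[OF assms] by blast
qed

fun down_var :: "var \<Rightarrow> var \<Rightarrow>\<^sub>0 int" where
  "down_var (Z i) = (if i = 1 then 0 else frag_of (Z (i - 1)))"
| "down_var (Zd j) = (if j = 1 then 0 else frag_of (Zd (j - 1)))"

lemma down_zv: "subst down_var (zv i) = (if i = 1 then 1 else zv (i - 1))"
  and down_yv: "subst down_var (yv j) = (if j = 1 then 1 else yv (j - 1))"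
  by (auto simp: subst_var_pow) (auto simp: var_pow_def single_uminus)

lemma shift_perm_permutes:
  assumes "v permutes {1..k}"
  shows "shift_perm m v permutes {1..m + k}"
proof (rule bij_imp_permutes)
  have "shift_perm m (inv v) (shift_perm m v p) = p" "shift_perm m v (shift_perm m (inv v) p) = p" for p
  proof -
    have pos: "u q > 0" if "u permutes {1..k}" "q > 0" for u q
      using S_infty_pos[OF S_inftyI[OF that(1)]] that by simp
    show "shift_perm m (inv v) (shift_perm m v p) = p" "shift_perm m v (shift_perm m (inv v) p) = p"
      using pos[OF assms, of "p - m"] pos[OF permutes_inv[OF assms], of "p - m"] permutes_inverses[OF assms]
      by (auto simp: shift_perm_def)
  qed
  moreover have "shift_perm m u p \<in> {1..m + k}" if "p \<in> {1..m + k}" "u permutes {1..k}" for u p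
    using that permutes_in_image[OF that(2), of "p - m"] by (auto simp: shift_perm_def)
  ultimately show "bij_betw (shift_perm m v) {1..m + k} {1..m + k}"
    using assms permutes_inv by (intro bij_betw_byWitness[where f' = "shift_perm m (inv v)"]) blast+
  show "shift_perm m v x = x" if "x \<notin> {1..m + k}" for x
  proof (cases "x \<le> m")
    case False
    then have "v (x - m) = x - m" using that by (intro permutes_not_in[OF assms]) auto
    then show ?thesis using False by (simp add: shift_perm_def)
  qed (simp add: shift_perm_def)
qed

lemma shift_perm_S_infty: "v \<in> S_infty \<Longrightarrow> shift_perm m v \<in> S_infty"
  by (metis S_infty_obtain shift_perm_permutes S_inftyI)

lemma shift_perm_shift_perm: "shift_perm m (shift_perm n v) = shift_perm (m + n) v"
  by (auto simp: fun_eq_iff shift_perm_def)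

lemma shift_perm_comp_simple_refl:
  assumes "v \<in> S_infty" "1 \<le> i"
  shows "shift_perm m (v \<circ> simple_refl i) = shift_perm m v \<circ> simple_refl (m + i)"
proof
  fix p
  show "shift_perm m (v \<circ> simple_refl i) p = (shift_perm m v \<circ> simple_refl (m + i)) p"
  proof (cases "p \<le> m")
    case True
    then show ?thesis using assms(2) by (simp add: shift_perm_def)
  next
    case False
    then obtain q where q: "p = m + q" "0 < q" by (metis less_imp_add_positive not_le)
    have "simple_refl (m + i) (m + q) = m + simple_refl i q"
      by (auto simp: simple_refl_def transpose_def)
    moreover have "simple_refl i q > 0" using q assms(2) by (cases "q = i"; cases "q = Suc i") auto
    ultimately show ?thesis using q by (simp add: shift_perm_def)
  qed
qed

text \<open>The shifted longest element arises by one step D_1 from a permutation with its largest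
  value in front, whose polynomial F factors by \<open>groth_cons\<close>. At z_1 = zd_1 = 1 the
  term with F vanishes and only the exchanged term survives; the induction hypothesis evaluates it,
  and a common factor z_1 - 1 is cancelled.\<close>

lemma down_groth_shift_longest: "subst down_var (groth (shift_perm 1 (longest_perm k))) = groth (longest_perm k)"
proof (induction k)
  case 0
  have "shift_perm 1 (longest_perm 0) = id" "longest_perm 0 = id"
    by (auto simp: fun_eq_iff shift_perm_def longest_perm_def)
  then show ?case by (simp only: groth_id subst_1)
next
  case (Suc k)
  let ?u = "shift_perm 1 (longest_perm k)"
  have up: "?u permutes {1..Suc k}"
    using shift_perm_permutes[OF longest_permutes, of 1 k] by simp
  define F where "F = groth (cons_perm (Suc k) ?u)"
  define G where "G = groth (shift_perm 1 (longest_perm (Suc k)))"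
  have F: "F = first_row (Suc k) * rename up_var (groth ?u)"
    unfolding F_def by (rule groth_cons[OF up])
  have cS: "cons_perm (Suc k) ?u \<in> S_infty"
  proof -
    have "cons_perm (Suc k) ?u = shift_perm 1 (longest_perm (Suc k)) \<circ> simple_refl 1"
      by (auto simp: fun_eq_iff cons_perm_def shift_perm_def longest_perm_def simple_refl_def transpose_def)
    then show ?thesis
      using S_infty_comp[OF shift_perm_S_infty[OF S_inftyI[OF longest_permutes]] S_infty_simple_refl[of 1]] by simp
  qed
  have "cons_perm (Suc k) ?u \<circ> simple_refl 1 = shift_perm 1 (longest_perm (Suc k))"
    by (auto simp: fun_eq_iff cons_perm_def shift_perm_def longest_perm_def simple_refl_def transpose_def)
  moreover have "cons_perm (Suc k) ?u (Suc 1) < cons_perm (Suc k) ?u 1"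
    by (simp add: cons_perm_def shift_perm_def)
  ultimately have "row.D 1 F = G"
    unfolding F_def G_def using groth_descend[OF cS, of 1] by simp
  then have rel: "(zv 2 - zv 1) * G = zv 2 * F - zv 1 * swap_vars 1 F"
    using row.D_rel[of 1 F] by (simp add: numeral_2_eq_2)
  have fr: "first_row (Suc k) = (1 - zv 1 * yv 1) * (\<Prod>j\<in>{1..k}. 1 - zv 1 * yv (Suc j))"
    unfolding first_row_def using prod.atLeast1_atMost_eq[of _ "Suc k"] 
    by (subst prod.atLeast_Suc_atMost) (auto simp: prod.shift_bounds_cl_Suc_ivl simp del: prod.cl_ivl_Suc)
  \<comment> \<open>The factor 1 - z_1/zd_1 of the first row becomes zero.\<close>
  have F0: "subst down_var F = 0"
    unfolding F fr by (simp add: subst_mult subst_diff down_zv down_yv)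
  have "swap_vars 1 (first_row (Suc k)) = (1 - zv 2 * yv 1) * (\<Prod>j\<in>{1..k}. 1 - zv 2 * yv (Suc j))"
    unfolding fr by (simp add: swap_vars_zv) (simp add: swap_vars_eq subst_prod subst_diff subst_mult rename_var_pow numeral_2_eq_2)
  then have 1: "subst down_var (swap_vars 1 (first_row (Suc k))) = (1 - zv 1) * first_row k"
    by (simp add: subst_mult subst_diff subst_prod down_zv down_yv first_row_def)
  have 2: "subst down_var (swap_vars 1 (rename up_var (groth ?u))) = rename up_var (groth (longest_perm k))"
  proof -
    have "frag_extend down_var (frag_of (swap_var 1 (up_var x))) = frag_extend (\<lambda>x. frag_of (up_var x)) (down_var x)" for x
      by (cases x) (auto simp: simple_refl_def transpose_def)
    then have "subst down_var (swap_vars 1 (rename up_var (groth ?u))) = rename up_var (subst down_var (groth ?u))"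
      by (simp add: swap_vars_eq subst_subst)
    then show ?thesis using Suc.IH by simp
  qed
  have "subst down_var ((zv 2 - zv 1) * G) = subst down_var (zv 2 * F - zv 1 * swap_vars 1 F)"
    by (simp only: rel)
  then have "(zv 1 - 1) * subst down_var G = - ((1 - zv 1) * first_row k * rename up_var (groth (longest_perm k)))"
    by (simp add: subst_mult subst_diff down_zv F0 del: One_nat_def,
        simp add: F subst_mult 1 2 del: One_nat_def, simp)
  also have "\<dots> = (zv 1 - 1) * groth (cons_perm k (longest_perm k))"
    by (simp add: groth_cons[OF longest_permutes] algebra_simps)
  also have "cons_perm k (longest_perm k) = longest_perm (Suc k)"
    by (auto simp: fun_eq_iff cons_perm_def longest_perm_def)
  finally have "(zv 1 - 1) * subst down_var G = (zv 1 - 1) * groth (longest_perm (Suc k))" .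
  moreover have "zv 1 - 1 \<noteq> (0 :: laurent)"
  proof
    assume "zv 1 - 1 = 0"
    then have "Poly_Mapping.keys (zv 1) = Poly_Mapping.keys (1 :: laurent)" by simp
    then show False by (simp add: var_pow_def)
  qed
  ultimately show ?case by (simp add: G_def)
qed

text \<open>Setting the first variable of each alphabet to 1 and renumbering turns D_(i+1) into D_i,
  which reduces the claim to longest elements.\<close>

lemma down_groth_shift:
  assumes "v \<in> S_infty"
  shows "subst down_var (groth (shift_perm 1 v)) = groth v"
proof -
  obtain k where "v permutes {1..k}" using assms by (auto simp: S_infty_def)
  then show ?thesis
  proof (induction rule: perm_descend_induct)
    case longest
    then show ?case by (rule down_groth_shift_longest)
  next
    case (descend v i)
    have vS: "v \<in> S_infty" using descend(1) by (rule S_inftyI)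
    have d: "v (Suc i) < v i" and i: "1 \<le> i" by fact+
    have "groth (shift_perm 1 (v \<circ> simple_refl i)) = row.D (Suc i) (groth (shift_perm 1 v))"
      using groth_descend[OF shift_perm_S_infty[OF vS], of "Suc i" 1] d i vS
      by (simp add: shift_perm_comp_simple_refl) (simp add: shift_perm_def)
    moreover have "subst down_var (row.D (Suc i) (groth (shift_perm 1 v))) =
        row.D i (subst down_var (groth (shift_perm 1 v)))"
    proof (rule exchange_D_hom[OF row.exchange_axioms row.exchange_axioms])
      have "frag_extend down_var (frag_of (swap_var (Suc i) x)) = frag_extend (\<lambda>x. frag_of (swap_var i x)) (down_var x)" for x
        using i by (cases x) (auto simp: simple_refl_def transpose_def)
      then show "subst down_var (swap_vars (Suc i) (groth (shift_perm 1 v))) =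
          swap_vars i (subst down_var (groth (shift_perm 1 v)))"
        by (simp add: swap_vars_eq subst_subst)
    qed (use i in \<open>simp_all add: subst_mult subst_diff down_zv\<close>)
    ultimately show ?case using descend.IH groth_descend[OF vS i d] by (simp del: o_apply)
  qed
qed

abbreviation fixes_upto :: "nat \<Rightarrow> (nat \<Rightarrow> nat) \<Rightarrow> bool" where
  "fixes_upto m v \<equiv> (\<forall>p\<le>m. v p = p)"

definition finite_vars :: "nat \<Rightarrow> nat \<Rightarrow> (nat \<Rightarrow> nat) \<Rightarrow> laurent" where
  "finite_vars k l v = specialize (alphabets k l) (groth v)"

text \<open>Maps k + 1 variables to k variables with a gap at a + 1: that variable becomes 1, later
  ones move down by one, and those after k + 1 become 1. Gap a = 0 is the substitution of
  \<open>down_var\<close>, gap a = k the plain specialization.\<close>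

definition omit :: "(nat \<Rightarrow> var) \<Rightarrow> nat \<Rightarrow> nat \<Rightarrow> nat \<Rightarrow> var \<Rightarrow>\<^sub>0 int" where
  "omit c a k i = (if 1 \<le> i \<and> i \<le> a then frag_of (c i)
     else if Suc a < i \<and> i \<le> Suc k then frag_of (c (i - 1)) else 0)"

fun omit_var :: "nat \<Rightarrow> nat \<Rightarrow> nat \<Rightarrow> nat \<Rightarrow> var \<Rightarrow> var \<Rightarrow>\<^sub>0 int" where
  "omit_var k l a b (Z i) = omit Z a k i"
| "omit_var k l a b (Zd j) = omit Zd b l j"

lemma Z_in_alphabets: "Z i \<in> alphabets k l \<longleftrightarrow> 1 \<le> i \<and> i \<le> k"
  and Zd_in_alphabets: "Zd j \<in> alphabets k l \<longleftrightarrow> 1 \<le> j \<and> j \<le> l"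
  by (auto simp: alphabets_def)

lemma omit_simple_refl: "a < k \<Longrightarrow> omit c a k (simple_refl (Suc a) i) = omit c (Suc a) k i"
  by (auto simp: omit_def simple_refl_def transpose_def)

text \<open>The polynomial of the shifted permutation, with the gap at the first place in both
  alphabets, gives the left-out side v; with the gap at the end it gives the shifted side. Between
  the two the gap moves one place at a time, by symmetry in neighbouring variables belonging to
  fixed points.\<close>

lemma finite_vars_shift:
  assumes v: "v \<in> S_infty" and M: "fixes_upto M v" "k \<le> M" "l \<le> M"
  shows "finite_vars k l (shift_perm 1 v) = finite_vars k l v"
proof -
  let ?v = "shift_perm 1 v"
  let ?G = "groth ?v"
  have vS: "?v \<in> S_infty" using v by (rule shift_perm_S_infty)
  have fx: "?v p = p" if "p \<le> Suc M" for p
    using that M(1) by (cases p) (auto simp: shift_perm_def)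
  have row: "subst (omit_var k l a b) ?G = subst (omit_var k l (Suc a) b) ?G" if "a < k" for a b
  proof -
    have "swap_vars (Suc a) ?G = ?G"
      using fx[of "Suc a"] fx[of "Suc (Suc a)"] that M(2) by (intro swap_vars_groth[OF vS]) auto
    then have "subst (omit_var k l a b) ?G = subst (omit_var k l a b) (swap_vars (Suc a) ?G)" by simp
    also have "frag_extend (omit_var k l a b) (frag_of (swap_var (Suc a) x)) = omit_var k l (Suc a) b x" for x
      using that by (cases x) (auto simp: omit_simple_refl)
    then have "subst (omit_var k l a b) (swap_vars (Suc a) ?G) = subst (omit_var k l (Suc a) b) ?G"
      by (simp add: swap_vars_eq subst_subst)
    finally show ?thesis .
  qed
  have col: "subst (omit_var k l a b) ?G = subst (omit_var k l a (Suc b)) ?G" if "b < l" for a b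
  proof -
    have "swap_dvars (Suc b) ?G = ?G"
      using swap_dvars_groth[OF vS _ fx[of "Suc b"] fx[of "Suc (Suc b)"]] that M(3) by simp
    then have "subst (omit_var k l a b) ?G = subst (omit_var k l a b) (swap_dvars (Suc b) ?G)" by simp
    also have "frag_extend (omit_var k l a b) (frag_of (transpose (Zd (Suc b)) (Zd (Suc (Suc b))) x)) =
        omit_var k l a (Suc b) x" for x
    proof (cases x)
      case (Zd j)
      have "transpose (Zd (Suc b)) (Zd (Suc (Suc b))) (Zd j) = Zd (simple_refl (Suc b) j)"
        by (auto simp: simple_refl_def transpose_def)
      then show ?thesis using that Zd by (simp add: omit_simple_refl)
    qed auto
    then have "subst (omit_var k l a b) (swap_dvars (Suc b) ?G) = subst (omit_var k l a (Suc b)) ?G"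
      by (simp add: subst_subst)
    finally show ?thesis .
  qed
  have rows: "a \<le> k \<Longrightarrow> subst (omit_var k l 0 b) ?G = subst (omit_var k l a b) ?G" for a b
    by (induction a) (simp_all add: row del: One_nat_def)
  have cols: "b \<le> l \<Longrightarrow> subst (omit_var k l a 0) ?G = subst (omit_var k l a b) ?G" for a b
    by (induction b) (simp_all add: col del: One_nat_def)
  have "finite_vars k l v = specialize (alphabets k l) (subst down_var ?G)"
    by (simp only: finite_vars_def down_groth_shift[OF v])
  also have "\<dots> = subst (omit_var k l 0 0) ?G"
  proof -
    have "frag_extend (\<lambda>x. if x \<in> alphabets k l then frag_of x else 0) (down_var x) = omit_var k l 0 0 x" for x
    proof (cases x)
      case (Z i)
      show ?thesis by (cases "i = 1") (auto simp: Z omit_def Z_in_alphabets)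
    next
      case (Zd j)
      show ?thesis by (cases "j = 1") (auto simp: Zd omit_def Zd_in_alphabets)
    qed
    then show ?thesis by (simp add: specialize_eq subst_subst)
  qed
  also have "\<dots> = subst (omit_var k l k l) ?G" using rows[of k 0] cols[of l k] by simp
  also have "\<dots> = finite_vars k l ?v"
  proof -
    have "omit_var k l k l x = (if x \<in> alphabets k l then frag_of x else 0)" for x
      by (cases x) (auto simp: omit_def Z_in_alphabets Zd_in_alphabets)
    then have "omit_var k l k l = (\<lambda>x. if x \<in> alphabets k l then frag_of x else 0)" by (rule ext)
    then show ?thesis by (simp add: finite_vars_def specialize_eq)
  qed
  finally show ?thesis by simp
qed

lemma finite_vars_shift_perm:
  assumes "v \<in> S_infty" "max k l \<le> m"
  shows "finite_vars k l (shift_perm m v) = finite_vars k l (shift_perm (max k l) v)"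
  using assms(2)
proof (induction m rule: dec_induct)
  case (step n)
  have "shift_perm (Suc n) v = shift_perm 1 (shift_perm n v)"
    by (simp add: shift_perm_shift_perm)
  moreover have "fixes_upto n (shift_perm n v)" by (simp add: shift_perm_def)
  ultimately show ?case
    using finite_vars_shift[OF shift_perm_S_infty[OF assms(1)], of n n k l] step by simp
qed simp

lemma stable_limit_eqI:
  assumes "\<And>m. N \<le> m \<Longrightarrow> specialize (alphabets k l) (G m) = g"
  shows "stable_limit k l G = g"
  unfolding stable_limit_def
proof (rule the_equality)
  show ev: "\<forall>\<^sub>F m in sequentially. specialize (alphabets k l) (G m) = g"
    using assms unfolding eventually_sequentially by blast
  fix h assume "\<forall>\<^sub>F m in sequentially. specialize (alphabets k l) (G m) = h"
  with ev have "\<forall>\<^sub>F m in sequentially. h = g" by eventually_elim simp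
  then show "h = g" by simp
qed

lemma stable_groth_eq:
  assumes "v \<in> S_infty"
  shows "stable_groth k l v = finite_vars k l (shift_perm (max k l) v)"
  unfolding stable_groth_def
  by (rule stable_limit_eqI, fold finite_vars_def, rule finite_vars_shift_perm[OF assms])

lemma stable_groth_fixes_upto:
  assumes "v \<in> S_infty" "fixes_upto (max k l) v"
  shows "stable_groth k l v = finite_vars k l v"
proof -
  have "finite_vars k l (shift_perm m v) = finite_vars k l v" for m
  proof (induction m)
    case 0
    have "shift_perm 0 v = v" using assms by (auto simp: fun_eq_iff shift_perm_def)
    then show ?case by simp
  next
    case (Suc m)
    have "fixes_upto (max k l) (shift_perm m v)" using assms(2) by (auto simp: shift_perm_def)
    then have "finite_vars k l (shift_perm 1 (shift_perm m v)) = finite_vars k l (shift_perm m v)"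
      using finite_vars_shift[OF shift_perm_S_infty[OF assms(1)], of "max k l" m] by simp
    then show ?case using Suc by (simp add: shift_perm_shift_perm)
  qed
  then show ?thesis using stable_groth_eq[OF assms(1)] by simp
qed


section \<open>Positivity and alternating expansions\<close>

inductive_set pos_cone :: "laurent set" where
  zero: "0 \<in> pos_cone"
| one: "1 \<in> pos_cone"
| z: "zv i - 1 \<in> pos_cone"
| y: "yv j - 1 \<in> pos_cone"
| add: "f \<in> pos_cone \<Longrightarrow> g \<in> pos_cone \<Longrightarrow> f + g \<in> pos_cone"
| mult: "f \<in> pos_cone \<Longrightarrow> g \<in> pos_cone \<Longrightarrow> f * g \<in> pos_cone"

text \<open>The leading coefficient with respect to the ordered group of exponent vectors is
  positive, or the polynomial is zero. The property survives sums and products, yet for nonzero f it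
  cannot hold for both f and - f.\<close>

definition lead_pos :: "laurent \<Rightarrow> bool" where
  "lead_pos f \<longleftrightarrow> f = 0 \<or> (\<exists>m. Poly_Mapping.lookup f m > 0 \<and> (\<forall>m'\<in>Poly_Mapping.keys f. m' \<le> m))"

lemma lead_pos_add:
  assumes "lead_pos f" "lead_pos g"
  shows "lead_pos (f + g)"
proof (cases "f = 0 \<or> g = 0")
  case False
  then obtain m n where m: "Poly_Mapping.lookup f m > 0" "\<forall>m'\<in>Poly_Mapping.keys f. m' \<le> m"
    and n: "Poly_Mapping.lookup g n > 0" "\<forall>m'\<in>Poly_Mapping.keys g. m' \<le> n"
    using assms by (auto simp: lead_pos_def)
  let ?p = "max m n"
  have "Poly_Mapping.lookup f ?p = (if m = ?p then Poly_Mapping.lookup f m else 0)"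
  proof (cases "m = ?p")
    case False
    then have "?p \<notin> Poly_Mapping.keys f" using m(2) by (metis max.cobounded1 antisym)
    then show ?thesis using False by (simp add: in_keys_iff)
  qed simp
  moreover have "Poly_Mapping.lookup g ?p = (if n = ?p then Poly_Mapping.lookup g n else 0)"
  proof (cases "n = ?p")
    case False
    then have "?p \<notin> Poly_Mapping.keys g" using n(2) by (metis max.cobounded2 antisym)
    then show ?thesis using False by (simp add: in_keys_iff)
  qed simp
  moreover have "m = ?p \<or> n = ?p" by (auto simp: max_def)
  ultimately have "Poly_Mapping.lookup f ?p + Poly_Mapping.lookup g ?p > 0"
    using m(1) n(1) by auto
  moreover have "\<forall>m'\<in>Poly_Mapping.keys (f + g). m' \<le> ?p"
    using m n keys_add[of f g] by (auto simp: le_max_iff_disj)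
  ultimately show ?thesis unfolding lead_pos_def by (intro disjI2 exI[of _ ?p]) (auto simp: lookup_add)
qed (use assms in auto)

lemma lead_pos_mult:
  assumes "lead_pos f" "lead_pos g"
  shows "lead_pos (f * g)"
proof (cases "f = 0 \<or> g = 0")
  case False
  then obtain m n where m: "Poly_Mapping.lookup f m > 0" "\<forall>m'\<in>Poly_Mapping.keys f. m' \<le> m"
    and n: "Poly_Mapping.lookup g n > 0" "\<forall>m'\<in>Poly_Mapping.keys g. m' \<le> n"
    using assms by (auto simp: lead_pos_def)
  define c where "c = Poly_Mapping.lookup f m"
  define d where "d = Poly_Mapping.lookup g n"
  define f' where "f' = f - Poly_Mapping.single m c"
  define g' where "g' = g - Poly_Mapping.single n d"
  have f': "a < m" if "a \<in> Poly_Mapping.keys f'" for a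
  proof -
    have "a \<noteq> m" "a \<in> Poly_Mapping.keys f"
      using that by (auto simp: f'_def c_def in_keys_iff lookup_minus lookup_single when_def split: if_splits)
    then show ?thesis using m(2) by (simp add: less_le)
  qed
  have g': "a < n" if "a \<in> Poly_Mapping.keys g'" for a
  proof -
    have "a \<noteq> n" "a \<in> Poly_Mapping.keys g"
      using that by (auto simp: g'_def d_def in_keys_iff lookup_minus lookup_single when_def split: if_splits)
    then show ?thesis using n(2) by (simp add: less_le)
  qed
  have "m + n \<notin> Poly_Mapping.keys (Poly_Mapping.single m c * g')"
    using keys_mult[of "Poly_Mapping.single m c" g'] g' by (fastforce split: if_splits)
  moreover have "m + n \<notin> Poly_Mapping.keys (f' * g)"
  proof
    assume "m + n \<in> Poly_Mapping.keys (f' * g)"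
    then obtain a b where "m + n = a + b" "a \<in> Poly_Mapping.keys f'" "b \<in> Poly_Mapping.keys g"
      using keys_mult[of f' g] by blast
    then show False using add_less_le_mono[OF f'[of a], of b n] n(2) by simp
  qed
  moreover have "f * g = Poly_Mapping.single (m + n) (c * d) + Poly_Mapping.single m c * g' + f' * g"
    by (simp add: f'_def g'_def algebra_simps mult_single)
  ultimately have "Poly_Mapping.lookup (f * g) (m + n) = c * d"
    by (simp add: lookup_add in_keys_iff)
  moreover have "\<forall>m'\<in>Poly_Mapping.keys (f * g). m' \<le> m + n"
    using keys_mult[of f g] m(2) n(2) by (fastforce intro: add_mono)
  ultimately show ?thesis
    using m(1) n(1) unfolding lead_pos_def c_def d_def by (intro disjI2 exI[of _ "m + n"]) auto
qed (auto simp: lead_pos_def)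

lemma single_pos: "(0 :: 'a :: linorder \<Rightarrow>\<^sub>0 int) < frag_of x"
  unfolding less_poly_mapping.rep_eq less_fun_def
  by (rule exI[of _ x]) (auto simp: lookup_single when_def)

lemma lead_pos_var: "lead_pos (var_pow x 1 - 1)"
proof -
  have "frag_of x \<noteq> (0 :: var \<Rightarrow>\<^sub>0 int)" by simp
  then have "Poly_Mapping.lookup (var_pow x 1 - 1) (frag_of x) = 1"
    by (simp add: var_pow_def lookup_minus lookup_one)
  moreover have "m \<le> frag_of x" if "m \<in> Poly_Mapping.keys (var_pow x 1 - 1)" for m
    using that keys_diff[of "var_pow x 1" 1] single_pos[of x] by (auto simp: var_pow_def)
  ultimately show ?thesis unfolding lead_pos_def by (intro disjI2 exI[of _ "frag_of x"]) auto
qed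

text \<open>The generators 1/zd_j - 1 have leading coefficient - 1, since 1/zd_j is a smaller
  monomial than 1. After inverting the dotted variables all generators of the cone have positive
  leading coefficient.\<close>

fun flip_var :: "var \<Rightarrow> var \<Rightarrow>\<^sub>0 int" where
  "flip_var (Z i) = frag_of (Z i)"
| "flip_var (Zd j) = - frag_of (Zd j)"

lemma flip_flip: "subst flip_var (subst flip_var f) = f"
proof -
  have "frag_extend flip_var (flip_var x) = frag_of x" for x
    by (cases x) (simp_all add: frag_extend_minus)
  then show ?thesis by (simp add: subst_subst)
qed

lemma lead_pos_flip: "f \<in> pos_cone \<Longrightarrow> lead_pos (subst flip_var f)"
proof (induction rule: pos_cone.induct)
  case zero
  show ?case by (simp add: lead_pos_def)
next
  case one
  show ?case by (auto simp: lead_pos_def intro!: exI[of _ 0])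
next
  case (z i)
  have "subst flip_var (zv i) = zv i" by (simp add: subst_var_pow) (simp add: var_pow_def)
  then show ?case using lead_pos_var by (simp add: subst_diff)
next
  case (y j)
  have "subst flip_var (yv j) = var_pow (Zd j) 1" by (simp add: subst_var_pow) (simp add: var_pow_def)
  then show ?case using lead_pos_var by (simp add: subst_diff)
qed (auto simp: subst_add subst_mult intro: lead_pos_add lead_pos_mult)

lemma pos_cone_pointed:
  assumes "f \<in> pos_cone" "- f \<in> pos_cone"
  shows "f = 0"
proof (rule ccontr)
  assume "f \<noteq> 0"
  define h where "h = subst flip_var f"
  have "h \<noteq> 0" using flip_flip[of f] \<open>f \<noteq> 0\<close> unfolding h_def by (metis subst_0)
  have "lead_pos h" "lead_pos (- h)" using lead_pos_flip[OF assms(1)] lead_pos_flip[OF assms(2)]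
    by (simp_all add: h_def subst_uminus)
  then obtain m n where "Poly_Mapping.lookup h m > 0" "\<forall>m'\<in>Poly_Mapping.keys h. m' \<le> m"
    "Poly_Mapping.lookup h n < 0" "\<forall>m'\<in>Poly_Mapping.keys h. m' \<le> n"
    using \<open>h \<noteq> 0\<close> by (auto simp: lead_pos_def)
  then have "m = n" by (metis antisym in_keys_iff less_irrefl)
  then show False using \<open>Poly_Mapping.lookup h m > 0\<close> \<open>Poly_Mapping.lookup h n < 0\<close> by simp
qed

lemma specialize_pos_cone: "f \<in> pos_cone \<Longrightarrow> specialize V f \<in> pos_cone"
proof (induction rule: pos_cone.induct)
  case (z i)
  have "specialize V (zv i) = zv i \<or> specialize V (zv i) = 1"
    unfolding specialize_eq subst_var_pow by (simp add: var_pow_def)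
  then show ?case by (auto simp: specialize_eq subst_diff intro: pos_cone.intros)
next
  case (y j)
  have "specialize V (yv j) = yv j \<or> specialize V (yv j) = 1"
    unfolding specialize_eq subst_var_pow by (simp add: var_pow_def single_uminus)
  then show ?case by (auto simp: specialize_eq subst_diff intro: pos_cone.intros)
qed (auto simp: specialize_eq subst_add subst_mult intro: pos_cone.intros)

text \<open>The parity of the length is expressed by \<open>sign\<close>, which a transposition
  visibly reverses; \<open>sign_perm_length\<close> identifies the two.\<close>

definition signed :: "(nat \<Rightarrow> nat) \<Rightarrow> laurent \<Rightarrow> laurent" where
  "signed v f = of_int (sign v) * f"

lemma sign_comp_transpose:
  assumes "u \<in> S_infty" "a \<noteq> r"
  shows "sign (u \<circ> transpose a r) = - sign u"
proof -
  have "permutation u" using assms(1) by (auto simp: S_infty_def intro: permutes_imp_permutation)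
  then show ?thesis
    using sign_compose[OF _ permutation_swap_id, of u a r] assms(2) by (simp add: sign_swap_id)
qed

text \<open>Each exchange changes both the sign in the chain sum and the sign of the permutation, so
  every nonempty chain contributes positively. The empty chain is subtracted, since membership in K
  is required only of permutations reached by an exchange. \<open>J\<close> is an invariant of the
  exchanges.\<close>

lemma signed_chain_sum:
  assumes K: "0 \<in> K" "\<And>f h. f \<in> K \<Longrightarrow> h \<in> K \<Longrightarrow> f + h \<in> K"
    and J: "\<And>u a. J u \<Longrightarrow> a \<in> set as \<Longrightarrow> cov r a u \<Longrightarrow>
      J (u \<circ> transpose a r) \<and> signed (u \<circ> transpose a r) (g (u \<circ> transpose a r)) \<in> K"
    and S: "\<And>u. J u \<Longrightarrow> u \<in> S_infty" and "J u"
  shows "signed u (chain_sum g r as u) - signed u (g u) \<in> K"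
  using J \<open>J u\<close>
proof (induction as arbitrary: u)
  case Nil
  then show ?case using K by simp
next
  case (Cons a as)
  have IH: "signed u' (chain_sum g r as u') - signed u' (g u') \<in> K" if "J u'" for u'
    using Cons.IH[OF _ that] Cons.prems(1) by (simp del: o_apply)
  show ?case
  proof (cases "cov r a u")
    case True
    let ?u = "u \<circ> transpose a r"
    have u: "J ?u" "signed ?u (g ?u) \<in> K" using Cons.prems True by (simp_all del: o_apply)
    have "a \<noteq> r" using True by (auto simp: cov_def)
    then have s: "sign ?u = - sign u" using sign_comp_transpose S Cons.prems(2) by blast
    have "signed u (chain_sum g r (a # as) u) - signed u (g u) =
        (signed u (chain_sum g r as u) - signed u (g u)) +
        ((signed ?u (chain_sum g r as ?u) - signed ?u (g ?u)) + signed ?u (g ?u))"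
      using True s by (simp add: signed_def right_diff_distrib del: o_apply)
    then show ?thesis using IH[OF u(1)] IH[OF Cons.prems(2)] u(2) K(2) by metis
  next
    case False
    then show ?thesis using IH[OF Cons.prems(2)] by simp
  qed
qed

section \<open>Induction on the last descent and its code entry\<close>

definition increasing_after :: "nat \<Rightarrow> (nat \<Rightarrow> nat) \<Rightarrow> bool" where
  "increasing_after d w \<longleftrightarrow> (\<forall>q>d. w q < w (Suc q))"

definition code_at :: "nat \<Rightarrow> (nat \<Rightarrow> nat) \<Rightarrow> nat" where
  "code_at r w = card {q. r < q \<and> w q < w r}"

lemma finite_code: "w \<in> S_infty \<Longrightarrow> finite {q. r < q \<and> w q < w r}"
proof -
  assume "w \<in> S_infty"
  then have "finite (w -` {..<w r})" using S_infty_bij bij_is_inj by (intro finite_vimageI) auto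
  then show ?thesis by (rule rev_finite_subset) auto
qed

text \<open>The pivot s is the last position after r with an entry below w r. The universally
  quantified clause fits chains to the left of r, which keep the entries after r and never raise the
  entry at r; for any such u the set counted by the code lies in that of w and misses s.\<close>

lemma transition_pivot:
  assumes w: "w \<in> S_infty" and r: "1 \<le> r" and inc: "increasing_after r w" and d: "w (Suc r) < w r"
  obtains s v where "r < s" "w s < w r" "w r < w (Suc s)" "v = w \<circ> transpose r s" "v \<in> S_infty"
    "sign w = - sign v" "increasing_after r v"
    "\<forall>u. u \<in> S_infty \<and> (\<forall>q>r. u q = v q) \<and> u r \<le> v r \<longrightarrow>
      increasing_after r u \<and> code_at r u < code_at r w"
    "groth w = groth v - zv r * yv (w s) * chain_sum groth r [1..<r] v"
proof -
  let ?Q = "{q. r < q \<and> w q < w r}"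
  have fin: "finite ?Q" by (rule finite_code[OF w])
  have "Suc r \<in> ?Q" using d by simp
  define s where "s = Max ?Q"
  have sQ: "s \<in> ?Q" unfolding s_def using Max_in[OF fin] \<open>Suc r \<in> ?Q\<close> by blast
  then have s: "r < s" "w s < w r" by auto
  have "Suc s \<notin> ?Q" using Max_ge[OF fin, of "Suc s"] unfolding s_def by auto
  then have "w r < w (Suc s)" using s S_infty_eq_iff[OF w, of r "Suc s"] by auto
  note s = s this
  define v where "v = w \<circ> transpose r s"
  have vS: "v \<in> S_infty" unfolding v_def using w r s by (intro S_infty_comp S_infty_transpose) auto
  have sgn: "sign w = - sign v" unfolding v_def using sign_comp_transpose[OF w, of r s] s by simp
  have vv: "v r = w s" "v s = w r" "\<And>q. q \<noteq> r \<Longrightarrow> q \<noteq> s \<Longrightarrow> v q = w q"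
    by (auto simp: v_def transpose_def)
  have incv: "increasing_after r v"
    unfolding increasing_after_def
  proof (intro allI impI)
    fix q assume q: "r < q"
    then have "w q < w (Suc q)" using inc by (simp add: increasing_after_def)
    then show "v q < v (Suc q)" using q s vv by (cases "q = s"; cases "Suc q = s") auto
  qed
  have ends: "increasing_after r u \<and> code_at r u < code_at r w"
    if "u \<in> S_infty" "\<forall>q>r. u q = v q" "u r \<le> v r" for u
  proof
    show "increasing_after r u" using incv that(2) by (simp add: increasing_after_def)
    have "{q. r < q \<and> u q < u r} \<subseteq> ?Q - {s}"
    proof
      fix q assume "q \<in> {q. r < q \<and> u q < u r}"
      then have "r < q" "v q < w s" using that(2,3) vv(1) by auto
      then show "q \<in> ?Q - {s}" using vv s by (cases "q = s") auto
    qed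
    then have "{q. r < q \<and> u q < u r} \<subset> ?Q" using sQ by blast
    then show "code_at r u < code_at r w" unfolding code_at_def by (rule psubset_card_mono[OF fin])
  qed
  have "groth w = groth v - zv r * yv (w s) * chain_sum groth r [1..<r] v"
    using inc by (intro transition[OF w r _ s v_def]) (simp add: increasing_after_def)
  with that[OF s v_def vS sgn incv] ends show ?thesis by blast
qed

lemma increasing_id:
  assumes w: "w \<in> S_infty" and inc: "increasing_after 0 w"
  shows "w = id"
proof (rule ccontr)
  assume "w \<noteq> id"
  then have "\<exists>p. w p \<noteq> p" by (auto simp: fun_eq_iff)
  define p where "p = (LEAST p. w p \<noteq> p)"
  have p: "w p \<noteq> p" "\<And>q. q < p \<Longrightarrow> w q = q"
    using LeastI_ex[OF \<open>\<exists>p. w p \<noteq> p\<close>] not_less_Least unfolding p_def by blast+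
  have mono: "w a \<le> w b" if "p \<le> a" "a \<le> b" for a b
  proof -
    have "p > 0" using p(1) S_infty_0[OF w] by (cases p) auto
    show ?thesis using that(2)
    proof (induction b rule: dec_induct)
      case (step b)
      then have "w b < w (Suc b)" using inc that(1) \<open>p > 0\<close> by (simp add: increasing_after_def)
      then show ?case using step by simp
    qed simp
  qed
  obtain q where q: "w q = p" using S_infty_bij[OF w] by (metis bij_pointE)
  then have "p \<le> q" using p by (metis not_le)
  then have "w p < p" using mono[of p q] q p(1) by simp
  then have "w (w p) = w p" using p(2) by simp
  then show False using S_infty_eq_iff[OF w] p(1) by blast
qed

text \<open>The outer induction is on a bound for the last descent, the inner one on the code entry
  there; both v and the permutations on its chains have a smaller code entry than w.\<close>

lemma signed_groth_pos:
  assumes "w \<in> S_infty"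
  shows "signed w (groth w) \<in> pos_cone"
proof -
  have main: "increasing_after d w \<Longrightarrow> w \<in> S_infty \<Longrightarrow> signed w (groth w) \<in> pos_cone" for d w
  proof (induction d arbitrary: w)
    case 0
    then have "w = id" using increasing_id by blast
    then show ?case by (simp only: signed_def groth_id sign_id of_int_1 mult_1 pos_cone.one)
  next
    case (Suc d)
    show ?case using Suc.prems
    proof (induction "code_at (Suc d) w" arbitrary: w rule: less_induct)
      case less
      note w = less.prems(2)
      show ?case
      proof (cases "w (Suc (Suc d)) < w (Suc d)")
        case False
        then have "w (Suc d) < w (Suc (Suc d))" using S_infty_eq_iff[OF w, of "Suc d" "Suc (Suc d)"] by simp
        then have "increasing_after d w" using less.prems(1) unfolding increasing_after_def
          by (metis Suc_lessI)
        then show ?thesis by (rule Suc.IH[OF _ w])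
      next
        case True
        let ?r = "Suc d"
        have r1: "1 \<le> ?r" by simp
        obtain s v where "?r < s" "w s < w ?r" "w ?r < w (Suc s)" "v = w \<circ> transpose ?r s"
          and v: "v \<in> S_infty" "sign w = - sign v" and "increasing_after ?r v"
          and ends: "\<forall>u. u \<in> S_infty \<and> (\<forall>q>?r. u q = v q) \<and> u ?r \<le> v ?r \<longrightarrow>
            increasing_after ?r u \<and> code_at ?r u < code_at ?r w"
          and G: "groth w = groth v - zv ?r * yv (w s) * chain_sum groth ?r [1..<?r] v"
          using transition_pivot[OF w r1 less.prems(1) True] .
        define J where "J u \<longleftrightarrow> u \<in> S_infty \<and> (\<forall>q>?r. u q = v q) \<and> u ?r \<le> v ?r" for u
        have Jpos: "signed u (groth u) \<in> pos_cone" if "J u" for u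
          using that ends less.hyps unfolding J_def by blast
        have "J v" using v by (simp add: J_def)
        have chain: "signed v (chain_sum groth ?r [1..<?r] v) - signed v (groth v) \<in> pos_cone"
        proof (rule signed_chain_sum[where J = J])
          fix u a assume u: "J u" "a \<in> set [1..<?r]" "cov ?r a u"
          have "J (u \<circ> transpose a ?r)"
            unfolding J_def
          proof (intro conjI)
            show "u \<circ> transpose a ?r \<in> S_infty"
              using u by (intro S_infty_comp S_infty_transpose) (auto simp: J_def)
            show "\<forall>q>?r. (u \<circ> transpose a ?r) q = v q"
              using u by (auto simp: J_def transpose_def)
            show "(u \<circ> transpose a ?r) ?r \<le> v ?r"
              using u by (auto simp: J_def cov_def)
          qed
          then show "J (u \<circ> transpose a ?r) \<and> signed (u \<circ> transpose a ?r) (groth (u \<circ> transpose a ?r)) \<in> pos_cone"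
            using Jpos by blast
        qed (use \<open>J v\<close> in \<open>auto simp: J_def intro: pos_cone.intros\<close>)
        have zy: "zv ?r * yv (w s) \<in> pos_cone" "zv ?r * yv (w s) - 1 \<in> pos_cone"
        proof -
          have "yv (w s) \<in> pos_cone" "zv ?r \<in> pos_cone"
            using pos_cone.add[OF pos_cone.y[of "w s"] pos_cone.one]
              pos_cone.add[OF pos_cone.z[of ?r] pos_cone.one] by simp_all
          moreover have "zv ?r * yv (w s) - 1 = (zv ?r - 1) * yv (w s) + (yv (w s) - 1)"
            by (simp add: algebra_simps)
          ultimately show "zv ?r * yv (w s) \<in> pos_cone" "zv ?r * yv (w s) - 1 \<in> pos_cone"
            by (simp_all only:) (intro pos_cone.add pos_cone.mult pos_cone.z pos_cone.y; assumption)+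
        qed
        \<comment> \<open>Since w and v have opposite signs, the term of v that the chains do not
          absorb gets the coefficient z_r/zd - 1, which lies in the cone.\<close>
        have eq: "signed w (groth w) =
            zv ?r * yv (w s) * (signed v (chain_sum groth ?r [1..<?r] v) - signed v (groth v)) +
            (zv ?r * yv (w s) - 1) * signed v (groth v)"
          unfolding G signed_def v(2) by (simp add: algebra_simps)
        show ?thesis unfolding eq
          by (rule pos_cone.add[OF pos_cone.mult[OF zy(1) chain] pos_cone.mult[OF zy(2) Jpos[OF \<open>J v\<close>]]])
      qed
    qed
  qed
  obtain k where k: "w permutes {1..k}" using assms by (auto simp: S_infty_def)
  have "increasing_after k w" unfolding increasing_after_def
    using permutes_not_in[OF k] by simp
  then show ?thesis using main assms by blast
qed

lemma signed_finite_vars_pos: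
  assumes "w \<in> S_infty"
  shows "signed w (finite_vars k l w) \<in> pos_cone"
proof -
  have "signed w (finite_vars k l w) = specialize (alphabets k l) (signed w (groth w))"
    by (cases w rule: sign_cases) (simp_all add: signed_def finite_vars_def specialize_eq subst_uminus)
  then show ?thesis using specialize_pos_cone[OF signed_groth_pos[OF assms]] by simp
qed

lemma sign_unique:
  assumes "v \<in> S_infty" "w \<in> S_infty" "finite_vars k l v = finite_vars k l w" "finite_vars k l w \<noteq> 0"
  shows "sign v = sign w"
proof (rule ccontr)
  assume ne: "sign v \<noteq> sign w"
  let ?f = "signed w (finite_vars k l w)"
  have "sign v = - sign w" using ne by (cases v rule: sign_cases; cases w rule: sign_cases) auto
  then have "- ?f \<in> pos_cone" using signed_finite_vars_pos[OF assms(1), of k l] assms(3)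
    by (simp add: signed_def)
  then have "?f = 0" using signed_finite_vars_pos[OF assms(2)] pos_cone_pointed by blast
  then show False using assms(4) by (simp add: signed_def)
qed

text \<open>With the first max k l points fixed, \<open>finite_vars\<close> is the stable polynomial
  itself, so each generator is up to sign an element of \<open>grassmannian_basis\<close> or
  zero.\<close>

inductive_set grassmannian_cone :: "nat \<Rightarrow> nat \<Rightarrow> laurent set" for k l where
  zero: "0 \<in> grassmannian_cone k l"
| gen: "grassmannian \<mu> \<Longrightarrow> fixes_upto (max k l) \<mu> \<Longrightarrow> signed \<mu> (finite_vars k l \<mu>) \<in> grassmannian_cone k l"
| add: "f \<in> grassmannian_cone k l \<Longrightarrow> g \<in> grassmannian_cone k l \<Longrightarrow> f + g \<in> grassmannian_cone k l"

lemma perm_length_shift: "perm_length (shift_perm m v) = perm_length v" if "v \<in> S_infty"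
proof -
  have "inversions (shift_perm m v) = map_prod ((+) m) ((+) m) ` inversions v"
  proof (intro set_eqI iffI)
    fix x assume "x \<in> inversions (shift_perm m v)"
    then obtain p q where x: "x = (p, q)" "p < q" "shift_perm m v p > shift_perm m v q"
      by (auto simp: inversions_def)
    then have "m < p" by (cases "p \<le> m"; cases "q \<le> m") (simp_all add: shift_perm_def)
    then have "(p - m, q - m) \<in> inversions v" "x = map_prod ((+) m) ((+) m) (p - m, q - m)"
      using x by (auto simp: inversions_def shift_perm_def)
    then show "x \<in> map_prod ((+) m) ((+) m) ` inversions v" by blast
  next
    fix x assume "x \<in> map_prod ((+) m) ((+) m) ` inversions v"
    then obtain p q where x: "x = (m + p, m + q)" "p < q" "v p > v q" by (auto simp: inversions_def)
    then have "p > 0" using S_infty_0[OF that] by (cases p) auto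
    then show "x \<in> inversions (shift_perm m v)" using x by (auto simp: inversions_def shift_perm_def)
  qed
  moreover have "inj (map_prod ((+) m) ((+) m))" by (auto simp: inj_def)
  ultimately show ?thesis by (simp add: perm_length_eq card_image inj_on_subset)
qed

lemma sign_shift_perm: "v \<in> S_infty \<Longrightarrow> sign (shift_perm m v) = sign v"
  by (simp add: sign_perm_length shift_perm_S_infty perm_length_shift)

lemma finite_vars_chain_sum:
  "specialize (alphabets k l) (chain_sum groth r as u) = chain_sum (finite_vars k l) r as u"
  by (induction as arbitrary: u) (auto simp: finite_vars_def specialize_eq subst_diff)

text \<open>Each shift moves the last descent to the right, so its position cannot serve for
  termination. The increasing front f moves along with it, and the distance d between the two is the
  outer induction variable; the code entry is unchanged by the shift and drops in the transition. At
  distance 0 the only possible descent is at f.\<close>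

lemma signed_finite_vars_cone:
  assumes "w \<in> S_infty" "fixes_upto (max k l) w"
  shows "signed w (finite_vars k l w) \<in> grassmannian_cone k l"
proof -
  define M where "M = max k l"
  let ?E = "finite_vars k l" and ?K = "grassmannian_cone k l"
  have main: "w \<in> S_infty \<Longrightarrow> fixes_upto M w \<Longrightarrow> (\<forall>p. 1 \<le> p \<and> p < f \<longrightarrow> w p < w (Suc p)) \<Longrightarrow>
      increasing_after (f + d) w \<Longrightarrow> signed w (?E w) \<in> ?K" for d f w
  proof (induction d arbitrary: f w)
    case 0
    have "w p < w (Suc p)" if "p \<noteq> f" for p
    proof (cases "p = 0")
      case True
      then show ?thesis using S_infty_0[OF 0(1)] S_infty_pos[OF 0(1), of 1] by simp
    next
      case False
      then show ?thesis using that 0(3,4) by (cases "p < f") (auto simp: increasing_after_def)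
    qed
    then have "{p. w p > w (Suc p)} \<subseteq> {f}" by (auto dest: less_asym)
    then have "card {p. w p > w (Suc p)} \<le> 1" using card_mono[of "{f}"] by fastforce
    then have "grassmannian w" using 0(1) by (simp add: grassmannian_def)
    then show ?case using 0(2) unfolding M_def by (rule grassmannian_cone.gen)
  next
    case (Suc d)
    show ?case using Suc.prems
    proof (induction "code_at (f + Suc d) w" arbitrary: f w rule: less_induct)
      case less
      note w = less.prems(1)
      let ?r = "f + Suc d"
      show ?case
      proof (cases "w (Suc ?r) < w ?r")
        case False
        then have "w ?r < w (Suc ?r)" using S_infty_eq_iff[OF w, of ?r "Suc ?r"] by simp
        then have "increasing_after (f + d) w" using less.prems(4) unfolding increasing_after_def
          by (metis Suc_lessI add_Suc_right)
        then show ?thesis by (rule Suc.IH[OF less.prems(1-3)])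
      next
        case True
        \<comment> \<open>An exchange may use up the last fixed point of the prefix. The shift
          supplies M + 1 fixed points, of which M survive.\<close>
        define w' where "w' = shift_perm 1 w"
        define f' where "f' = Suc f"
        define R where "R = Suc ?r"
        have R: "R = f' + Suc d" "1 \<le> R" by (simp_all add: R_def f'_def)
        have w'S: "w' \<in> S_infty" unfolding w'_def using w by (rule shift_perm_S_infty)
        have w'_0: "w' 0 = 0" and w'_Suc: "w' (Suc p) = Suc (w p)" for p
          using S_infty_0[OF w] by (auto simp: w'_def shift_perm_def)
        have fx: "w' p = p" if "p \<le> Suc M" for p
          using that less.prems(2) w'_0 w'_Suc by (cases p) auto
        have front: "w' p < w' (Suc p)" if "1 \<le> p" "p < f'" for p
        proof -
          obtain q where q: "p = Suc q" using \<open>1 \<le> p\<close> by (cases p) auto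
          then show ?thesis using less.prems(3) that S_infty_0[OF w] S_infty_pos[OF w, of 1]
            by (cases q) (auto simp: w'_Suc f'_def)
        qed
        have inc: "increasing_after R w'" unfolding increasing_after_def
        proof (intro allI impI)
          fix q assume "R < q"
          then obtain p where "q = Suc p" "?r < p" unfolding R_def by (cases q) auto
          then show "w' q < w' (Suc q)" using less.prems(4) by (simp add: increasing_after_def w'_Suc)
        qed
        have d': "w' (Suc R) < w' R" using True by (simp add: R_def w'_Suc)
        have code: "code_at R w' = code_at ?r w"
        proof -
          have "{q. R < q \<and> w' q < w' R} = Suc ` {q. ?r < q \<and> w q < w ?r}"
          proof (intro set_eqI iffI)
            fix q assume "q \<in> {q. R < q \<and> w' q < w' R}"
            then show "q \<in> Suc ` {q. ?r < q \<and> w q < w ?r}"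
              unfolding R_def by (cases q) (auto simp: w'_Suc)
          qed (auto simp: R_def w'_Suc)
          then show ?thesis unfolding code_at_def by (simp add: card_image)
        qed
        obtain s v where v: "R < s" "w' s < w' R" and "w' R < w' (Suc s)"
          and v_def: "v = w' \<circ> transpose R s"
          and v2: "v \<in> S_infty" "sign w' = - sign v" and "increasing_after R v"
          and ends: "\<forall>u. u \<in> S_infty \<and> (\<forall>q>R. u q = v q) \<and> u R \<le> v R \<longrightarrow>
            increasing_after R u \<and> code_at R u < code_at R w'"
          and G: "groth w' = groth v - zv R * yv (w' s) * chain_sum groth R [1..<R] v"
          using transition_pivot[OF w'S R(2) inc d'] .
        \<comment> \<open>Everything up to M + 1 is fixed, so an inversion cannot begin at such a
          position or end in such a value. Hence z_R and the dotted variable of w' s both lie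
          outside the alphabets.\<close>
        have RM: "Suc M < R"
        proof (rule ccontr)
          assume "\<not> Suc M < R"
          then have "w' R = R" using fx by simp
          moreover have "w' s \<ge> s"
          proof (rule ccontr)
            assume "\<not> w' s \<ge> s"
            then have "w' (w' s) = w' s" using \<open>w' R = R\<close> v(2) \<open>\<not> Suc M < R\<close> fx by simp
            then show False using S_infty_eq_iff[OF w'S] \<open>\<not> w' s \<ge> s\<close> by simp
          qed
          ultimately show False using v by simp
        qed
        have sM: "Suc M < w' s"
        proof (rule ccontr)
          assume "\<not> Suc M < w' s"
          then have "w' (w' s) = w' s" using fx by simp
          then have "w' s = s" using S_infty_eq_iff[OF w'S] by blast
          then show False using \<open>\<not> Suc M < w' s\<close> RM v(1) by simp
        qed
        have spec: "specialize (alphabets k l) (zv R * yv (w' s)) = 1"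
        proof -
          have "Z R \<notin> alphabets k l" "Zd (w' s) \<notin> alphabets k l"
            using RM sM by (simp_all add: Z_in_alphabets Zd_in_alphabets M_def)
          then show ?thesis by (simp add: specialize_eq subst_mult subst_var_pow)
        qed
        have Ew: "?E w' = ?E v - chain_sum ?E R [1..<R] v"
          unfolding finite_vars_chain_sum[symmetric] unfolding finite_vars_def G
          using spec by (simp add: specialize_eq subst_diff subst_mult)
        have vfx: "v p = p" if "p \<le> Suc M" for p
          using that fx RM v(1) by (simp add: v_def transpose_def)
        have vR: "v R = w' s" by (simp add: v_def)
        have "[1..<R] = [1..<Suc M] @ [Suc M..<R]" using RM by (intro upt_split) auto
        \<comment> \<open>The fixed point M + 1 lies between a and R in position and between v a and
          v R in value, so it blocks the exchange.\<close>
        moreover have "\<not> cov R a v" if "a \<in> set [1..<Suc M]" for a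
        proof -
          have "a < Suc M" "Suc M < R" "v a = a" "v (Suc M) = Suc M" "Suc M < v R"
            using that RM vfx vR sM by auto
          then show ?thesis unfolding cov_def by metis
        qed
        ultimately have chain: "chain_sum ?E R [1..<R] v = chain_sum ?E R [Suc M..<R] v"
          by (metis chain_sum_append_no_cov)
        \<comment> \<open>The invariant combines what lowers the code entry at R with the fixed
          prefix and the increasing front, that is, all that the induction hypothesis asks
          for.\<close>
        define J where "J u \<longleftrightarrow> u \<in> S_infty \<and> (\<forall>q>R. u q = v q) \<and> u R \<le> v R \<and> fixes_upto M u \<and>
          (\<forall>p. 1 \<le> p \<and> p < f' \<longrightarrow> u p < u (Suc p))" for u
        have JK: "signed u (?E u) \<in> ?K" if "J u" for u
        proof (rule less.hyps)
          show "code_at (f' + Suc d) u < code_at ?r w" "increasing_after (f' + Suc d) u"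
            using that ends code R(1) unfolding J_def by auto
        qed (use that in \<open>auto simp: J_def\<close>)
        have "J v"
          unfolding J_def
        proof (intro conjI)
          show "\<forall>p. 1 \<le> p \<and> p < f' \<longrightarrow> v p < v (Suc p)"
            using front v(1) R(1) by (auto simp: v_def transpose_def)
        qed (use v2(1) vfx in auto)
        have "signed v (chain_sum ?E R [Suc M..<R] v) - signed v (?E v) \<in> ?K"
        proof (rule signed_chain_sum[where J = J])
          fix u a assume u: "J u" "a \<in> set [Suc M..<R]" "cov R a u"
          have a: "M < a" "a < R" using u by auto
          let ?u = "u \<circ> transpose a R"
          have uS: "u \<in> S_infty" using u by (simp add: J_def)
          have c: "u a < u R" "\<And>x. a < x \<Longrightarrow> x < R \<Longrightarrow> \<not> (u a < u x \<and> u x < u R)"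
            using u(3) a by (auto simp: cov_def)
          have val: "?u a = u R" "?u R = u a" "\<And>x. x \<noteq> a \<Longrightarrow> x \<noteq> R \<Longrightarrow> ?u x = u x"
            by (auto simp: transpose_def)
          have "J ?u"
            unfolding J_def
          proof (intro conjI allI impI)
            show "?u \<in> S_infty" using uS a by (intro S_infty_comp S_infty_transpose) auto
            show "?u q = v q" if "R < q" for q using that u a val by (simp add: J_def del: o_apply)
            show "?u R \<le> v R" using u c val by (simp add: J_def del: o_apply)
            show "?u p = p" if "p \<le> M" for p using that u a val by (simp add: J_def del: o_apply)
            \<comment> \<open>Only the entry at a grows, so the comparison at risk is that of a with
              a + 1. There the cover condition excludes an entry between u a and u R, so the entry
              at a + 1 exceeds u R.\<close>
            show "?u p < ?u (Suc p)" if "1 \<le> p \<and> p < f'" for p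
            proof -
              have up: "u p < u (Suc p)" and pR: "Suc p < R" using that u R(1) by (auto simp: J_def)
              consider "p = a" | "Suc p = a" | "p \<noteq> a" "Suc p \<noteq> a" by blast
              then show ?thesis
              proof cases
                case 1
                then have "\<not> (u (Suc p) < u R)" using c(2)[of "Suc p"] up pR by auto
                moreover have "u (Suc p) \<noteq> u R" using S_infty_eq_iff[OF uS] pR by simp
                ultimately show ?thesis using val pR 1 by (simp del: o_apply)
              next
                case 2
                then show ?thesis using val pR up c(1) by (simp del: o_apply)
              next
                case 3
                then show ?thesis using val pR up by (simp del: o_apply)
              qed
            qed
          qed
          then show "J ?u \<and> signed ?u (?E ?u) \<in> ?K" using JK by blast
        qed (use \<open>J v\<close> in \<open>auto simp: J_def intro: grassmannian_cone.intros\<close>)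
        moreover have "signed w' (?E w') = signed v (chain_sum ?E R [Suc M..<R] v) - signed v (?E v)"
          unfolding Ew chain signed_def v2(2) by (simp add: algebra_simps)
        moreover have "sign w' = sign w" "?E w' = ?E w"
          unfolding w'_def using sign_shift_perm[OF w] finite_vars_shift[OF w less.prems(2)]
          by (simp_all add: M_def)
        ultimately show ?thesis by (simp add: signed_def)
      qed
    qed
  qed
  obtain k' where k: "w permutes {1..k'}" using assms(1) by (auto simp: S_infty_def)
  have "increasing_after (0 + k') w" unfolding increasing_after_def
    using permutes_not_in[OF k] by simp
  then show ?thesis using main[of w 0 k'] assms unfolding M_def by auto
qed


section \<open>Completions and the alternation theorem\<close>

lemma shift_perm_inverse:
  assumes "v \<in> S_infty"
  shows "shift_perm m (inv v) (shift_perm m v p) = p" "shift_perm m v (shift_perm m (inv v) p) = p"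
  using S_infty_pos[OF assms, of "p - m"] S_infty_pos[OF S_infty_inv[OF assms], of "p - m"]
    S_infty_bij[OF assms]
  by (auto simp: shift_perm_def bij_is_inj surj_f_inv_f[OF bij_is_surj])

lemma inv_shift_perm: "v \<in> S_infty \<Longrightarrow> inv (shift_perm m v) = shift_perm m (inv v)"
  by (rule inv_unique_comp) (auto simp: fun_eq_iff shift_perm_inverse)

lemma perm_length_inv:
  assumes "v \<in> S_infty"
  shows "perm_length (inv v) = perm_length v"
proof -
  have bij: "bij v" by (rule S_infty_bij[OF assms])
  have [simp]: "inv v (v p) = p" "v (inv v p) = p" for p
    using bij by (simp_all add: bij_is_inj surj_f_inv_f[OF bij_is_surj])
  have "bij_betw (\<lambda>(p, q). (v q, v p)) (inversions v) (inversions (inv v))"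
    by (rule bij_betw_byWitness[where f' = "\<lambda>(p, q). (inv v q, inv v p)"])
      (auto simp: inversions_def)
  then show ?thesis unfolding perm_length_eq by (rule bij_betw_same_card[symmetric])
qed

text \<open>A local form of minimal length: no descent beyond row k, and none of the inverse beyond
  column l. Unlike the minimum over all completions it visibly survives shifting.\<close>

definition is_completion :: "nat \<Rightarrow> nat \<Rightarrow> (nat \<times> nat) set \<Rightarrow> (nat \<Rightarrow> nat) \<Rightarrow> bool" where
  "is_completion k l w v \<longleftrightarrow> v \<in> S_infty \<and> corner k l v = w \<and>
     (\<forall>p>k. v p < v (Suc p)) \<and> (\<forall>q>l. inv v q < inv v (Suc q))"

lemma increasing_from:
  assumes "\<forall>p>k. f p < f (Suc p)" "k < a" "a < b"
  shows "f a < (f b :: nat)"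
  using assms(3,2) by (induction rule: less_Suc_induct) (use assms(1) in \<open>auto intro: less_trans\<close>)

lemma strict_mono_on_unique:
  fixes f g :: "nat \<Rightarrow> nat"
  assumes f: "\<And>a b. a \<in> A \<Longrightarrow> b \<in> A \<Longrightarrow> a < b \<Longrightarrow> f a < f b"
    and g: "\<And>a b. a \<in> A \<Longrightarrow> b \<in> A \<Longrightarrow> a < b \<Longrightarrow> g a < g b"
    and im: "f ` A = g ` A" and a: "a \<in> A"
  shows "f a = g a"
  using a
proof (induction a rule: less_induct)
  case (less a)
  have le: "h' a \<le> h a"
    if mem: "h a \<in> h' ` A" and IH: "\<And>b. b < a \<Longrightarrow> b \<in> A \<Longrightarrow> h b = h' b"
      and h: "\<And>a b. a \<in> A \<Longrightarrow> b \<in> A \<Longrightarrow> a < b \<Longrightarrow> h a < h b"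
      and h': "\<And>a b. a \<in> A \<Longrightarrow> b \<in> A \<Longrightarrow> a < b \<Longrightarrow> h' a < h' b" for h h' :: "nat \<Rightarrow> nat"
  proof -
    obtain b where b: "b \<in> A" "h a = h' b" using mem by auto
    have "\<not> b < a" using IH[of b] h[of b a] b less.prems by auto
    then show ?thesis using h'[of a b] b less.prems by (cases "a = b") auto
  qed
  have "g a \<le> f a" using less f g im by (intro le[of f g]) auto
  moreover have "f a \<le> g a" using less f g im by (intro le[of g f]) auto
  ultimately show ?case by simp
qed

text \<open>The columns up to l left free by w must be filled from rows beyond k. Monotonicity makes
  these rows an initial segment of the rows beyond k, whose size is the number of free columns, and
  fixes the order of filling. The columns beyond l then take the remaining rows in increasing
  order.\<close>

lemma is_completion_unique:
  assumes v: "is_completion k l w v" and u: "is_completion k l w u"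
  shows "v = u"
proof -
  have S: "v \<in> S_infty" "u \<in> S_infty" using v u by (auto simp: is_completion_def)
  have invs: "inv x (x p) = p" "x (inv x p) = p" if "x \<in> {v, u}" for x p
    using that S S_infty_bij by (auto simp: bij_is_inj surj_f_inv_f[OF bij_is_surj])
  have corner_iff: "x p = q \<longleftrightarrow> (p, q) \<in> w"
    if "x \<in> {v, u}" "1 \<le> p" "p \<le> k" "1 \<le> q" "q \<le> l" for x p q
  proof -
    have "corner k l x = w" using that(1) v u by (auto simp: is_completion_def)
    then show ?thesis using that(2-5) unfolding corner_def by auto
  qed
  define P where "P x = {p. k < p \<and> x p \<le> l}" for x :: "nat \<Rightarrow> nat"
  define Q where "Q = {q \<in> {1..l}. \<forall>p\<in>{1..k}. (p, q) \<notin> w}"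
  have im: "x ` P x = Q" if x: "x \<in> {v, u}" for x
  proof (intro set_eqI iffI)
    fix q assume "q \<in> x ` P x"
    then obtain p where p: "k < p" "x p \<le> l" "q = x p" by (auto simp: P_def)
    have xS: "x \<in> S_infty" using x S by auto
    have "1 \<le> q" using p S_infty_pos[OF xS, of p] by simp
    moreover have "(p', q) \<notin> w" if "p' \<in> {1..k}" for p'
      using corner_iff[OF x, of p' q] that p \<open>1 \<le> q\<close> S_infty_eq_iff[OF xS, of p' p] by auto
    ultimately show "q \<in> Q" using p by (simp add: Q_def)
  next
    fix q assume q: "q \<in> Q"
    let ?p = "inv x q"
    have xS: "x \<in> S_infty" using x S by auto
    have xp: "x ?p = q" by (rule invs(2)[OF x])
    have "1 \<le> q" "q \<le> l" using q by (auto simp: Q_def)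
    have "?p \<noteq> 0"
    proof
      assume "?p = 0"
      then show False using xp S_infty_0[OF xS] \<open>1 \<le> q\<close> by simp
    qed
    moreover have "\<not> (1 \<le> ?p \<and> ?p \<le> k)"
    proof
      assume "1 \<le> ?p \<and> ?p \<le> k"
      then have "(?p, q) \<in> w" "?p \<in> {1..k}"
        using corner_iff[OF x, of ?p q] xp \<open>1 \<le> q\<close> \<open>q \<le> l\<close> by simp_all
      then show False using q by (simp add: Q_def)
    qed
    ultimately have "?p \<in> P x" using xp \<open>q \<le> l\<close> by (simp add: P_def)
    then show "q \<in> x ` P x" using xp by (metis imageI)
  qed
  have mono: "x a < x b" if "x \<in> {v, u}" "k < a" "a < b" for x a b
    using that increasing_from[of k x a b] v u by (auto simp: is_completion_def)
  have P: "P v = P u"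
  proof -
    have inj: "inj_on x (P x)" if "x \<in> {v, u}" for x
      using that S by (intro inj_onI) (auto simp: S_infty_eq_iff)
    have "finite Q" by (simp add: Q_def)
    then have fin: "finite (P v)" "finite (P u)"
      using im inj by (metis finite_imageD insertCI)+
    have card: "card (P v) = card (P u)"
      using im inj card_image by (metis insertCI)
    have down: "b \<in> P x" if "x \<in> {v, u}" "a \<in> P x" "k < b" "b \<le> a" for x a b
      using mono[OF that(1,3), of a] that by (cases "b = a") (auto simp: P_def)
    have "P v \<subseteq> P u \<or> P u \<subseteq> P v"
    proof (rule ccontr)
      assume "\<not> ?thesis"
      then obtain a b where "a \<in> P v" "a \<notin> P u" "b \<in> P u" "b \<notin> P v" by blast
      then show False using down[of v a b] down[of u b a] by (cases "a \<le> b") (auto simp: P_def)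
    qed
    then show ?thesis using fin card card_subset_eq by metis
  qed
  have low: "v p = u p" if "k < p" "v p \<le> l" for p
  proof (rule strict_mono_on_unique[where f = v and g = u and A = "P v"])
    show "v ` P v = u ` P v" using im[of v] im[of u] P by simp
  qed (use that mono in \<open>auto simp: P_def\<close>)
  have low': "v p = u p" if "k < p" "u p \<le> l" for p
    using low that P by (auto simp: P_def set_eq_iff)
  have agree: "v p \<le> l \<or> u p \<le> l \<Longrightarrow> v p = u p" for p
  proof -
    assume a: "v p \<le> l \<or> u p \<le> l"
    consider "p = 0" | "1 \<le> p" "p \<le> k" | "k < p" by linarith
    then show ?thesis
    proof cases
      case 1
      then show ?thesis using S_infty_0[OF S(1)] S_infty_0[OF S(2)] by simp
    next
      case 2
      then have "1 \<le> v p" "1 \<le> u p" using S_infty_pos[OF S(1), of p] S_infty_pos[OF S(2), of p] by simp_all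
      note bounds = 2 this
      show ?thesis using a
      proof
        assume "v p \<le> l"
        then show ?thesis using corner_iff[of v p "v p"] corner_iff[of u p "v p"] bounds by simp
      next
        assume "u p \<le> l"
        then show ?thesis using corner_iff[of u p "u p"] corner_iff[of v p "u p"] bounds by simp
      qed
    next
      case 3
      then show ?thesis using a low low' by blast
    qed
  qed
  \<comment> \<open>The rows sent beyond column l are complementary to those already known to agree,
    so both inverses have the same image on these columns and increase there.\<close>
  have inv_eq: "inv v q = inv u q" if "l < q" for q
  proof (rule strict_mono_on_unique[where f = "inv v" and g = "inv u" and A = "{l<..}"])
    show "inv v ` {l<..} = inv u ` {l<..}"
    proof -
      have "inv x ` {l<..} = {p. l < x p}" if "x \<in> {v, u}" for x
        using invs[OF that] by (auto intro!: image_eqI[of _ "inv x" "x _"])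
      moreover have "l < v p \<longleftrightarrow> l < u p" for p
        using agree[of p] by (cases "v p \<le> l"; cases "u p \<le> l") simp_all
      ultimately show ?thesis by simp
    qed
  qed (use that increasing_from v u in \<open>auto simp: is_completion_def\<close>)
  show ?thesis
  proof
    fix p
    show "v p = u p"
    proof (cases "v p \<le> l")
      case False
      then have "inv u (v p) = p" using inv_eq[of "v p"] invs[of v] by simp
      then show ?thesis using invs(2)[of u "v p"] by simp
    qed (use agree in simp)
  qed
qed

text \<open>A descent beyond the corner could be removed by a simple reflection, on the right for
  rows and on the left for columns, shortening the permutation without touching the corner.\<close>

lemma minimal_is_completion:
  assumes v: "v \<in> S_infty" "corner k l v = w"
    and min: "\<And>u. u \<in> S_infty \<Longrightarrow> corner k l u = w \<Longrightarrow> perm_length v \<le> perm_length u"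
  shows "is_completion k l w v"
  unfolding is_completion_def
proof (intro conjI allI impI v)
  fix p assume p: "k < p"
  show "v p < v (Suc p)"
  proof (rule ccontr)
    assume "\<not> ?thesis"
    then have "v (Suc p) < v p" using S_infty_eq_iff[OF v(1), of p "Suc p"] by simp
    then have "perm_length (v \<circ> simple_refl p) < perm_length v"
      using p perm_length_less_iff[OF v(1), of p] by simp
    moreover have "corner k l (v \<circ> simple_refl p) = w"
    proof -
      have "simple_refl p x = x" if "x \<in> {1..k}" for x using that p by auto
      then show ?thesis using v(2) by (auto simp: corner_def)
    qed
    ultimately show False
      using min[OF S_infty_comp[OF v(1) S_infty_simple_refl[of p]]] p by simp
  qed
next
  fix q assume q: "l < q"
  show "inv v q < inv v (Suc q)"
  proof (rule ccontr)
    assume "\<not> ?thesis"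
    then have "inv v (Suc q) < inv v q"
      using S_infty_eq_iff[OF S_infty_inv[OF v(1)], of q "Suc q"] by simp
    then have less: "perm_length (inv v \<circ> simple_refl q) < perm_length v"
      using q perm_length_less_iff[OF S_infty_inv[OF v(1)], of q] perm_length_inv[OF v(1)] by simp
    let ?u = "simple_refl q \<circ> v"
    have uS: "?u \<in> S_infty" using q by (intro S_infty_comp S_infty_simple_refl v) simp
    have "bij (simple_refl q)" by (metis bij_if_invol simple_refl_invol(1))
    then have "inv ?u = inv v \<circ> simple_refl q"
      using S_infty_bij[OF v(1)]
      by (simp add: o_inv_distrib inv_unique_comp[of "simple_refl q" "simple_refl q"])
    then have "perm_length ?u < perm_length v" using less perm_length_inv[OF uS] by simp
    moreover have "corner k l ?u = w"
    proof -
      have "simple_refl q x = y \<longleftrightarrow> x = y" if "y \<in> {1..l}" for x y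
        using that q by (cases "x = q"; cases "x = Suc q") auto
      then show ?thesis using v(2) by (auto simp: corner_def)
    qed
    ultimately show False using min[OF uS] by simp
  qed
qed

lemma is_completion_completion:
  assumes "u \<in> S_infty" "corner k l u = w"
  shows "is_completion k l w (completion k l w)"
proof -
  define minimal where "minimal v \<longleftrightarrow> v \<in> S_infty \<and> corner k l v = w \<and>
     (\<forall>u\<in>S_infty. corner k l u = w \<longrightarrow> perm_length v \<le> perm_length u)" for v
  obtain v where v: "v \<in> S_infty \<and> corner k l v = w"
    "\<forall>x. x \<in> S_infty \<and> corner k l x = w \<longrightarrow> perm_length v \<le> perm_length x"
    using ex_has_least_nat[of "\<lambda>v. v \<in> S_infty \<and> corner k l v = w" u perm_length] assms by auto
  then have "minimal v" by (auto simp: minimal_def)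
  have comp: "is_completion k l w x" if "minimal x" for x
    using that by (intro minimal_is_completion) (auto simp: minimal_def)
  have "completion k l w = v"
    unfolding completion_def minimal_def[symmetric]
    by (rule the_equality[of minimal]) (use \<open>minimal v\<close> comp is_completion_unique in blast)+
  then show ?thesis using comp \<open>minimal v\<close> by simp
qed

lemma completion_eqI: "is_completion k l w v \<Longrightarrow> completion k l w = v"
  using is_completion_completion[of v k l w] is_completion_unique
  by (metis is_completion_def)

lemma completion_exists:
  assumes "partial_perm k l w"
  shows "\<exists>u\<in>S_infty. corner k l u = w"
proof -
  let ?S = "{1..l + k}"
  have sub: "w \<subseteq> {1..k} \<times> {1..l}" and sv: "single_valued w" "single_valued (w\<inverse>)"
    using assms by (auto simp: partial_perm_def)
  \<comment> \<open>An empty row p is sent to column l + p, which keeps g injective and avoids the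
    corner; this is why l + k letters suffice.\<close>
  define g where "g p = (if p \<in> Domain w then THE q. (p, q) \<in> w else l + p)" for p
  have g: "g p = q" if "(p, q) \<in> w" for p q
  proof -
    have "(THE q. (p, q) \<in> w) = q" by (rule the_equality, rule that, rule single_valuedD[OF sv(1) _ that])
    then show ?thesis using that by (auto simp: g_def)
  qed
  have g': "g p = l + p" if "p \<notin> Domain w" for p using that by (simp add: g_def)
  have inj: "inj_on g {1..k}"
  proof (rule inj_onI)
    fix a b assume ab: "a \<in> {1..k}" "b \<in> {1..k}" "g a = g b"
    show "a = b"
    proof (cases "a \<in> Domain w"; cases "b \<in> Domain w")
      assume "a \<in> Domain w" "b \<in> Domain w"
      then obtain c d where "(a, c) \<in> w" "(b, d) \<in> w" by blast
      then have "(c, a) \<in> w\<inverse>" "(c, b) \<in> w\<inverse>" using g[of a c] g[of b d] ab(3) by auto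
      then show ?thesis by (rule single_valuedD[OF sv(2)])
    next
      assume "a \<in> Domain w" "b \<notin> Domain w"
      then obtain c where "(a, c) \<in> w" by blast
      then show ?thesis using g[of a c] g'[OF \<open>b \<notin> _\<close>] ab sub by auto
    next
      assume "a \<notin> Domain w" "b \<in> Domain w"
      then obtain c where "(b, c) \<in> w" by blast
      then show ?thesis using g[of b c] g'[OF \<open>a \<notin> _\<close>] ab sub by auto
    qed (use g' ab in auto)
  qed
  have gS: "g ` {1..k} \<subseteq> ?S"
  proof
    fix x assume "x \<in> g ` {1..k}"
    then obtain p where p: "p \<in> {1..k}" "x = g p" by auto
    show "x \<in> ?S"
    proof (cases "p \<in> Domain w")
      case True
      then obtain q where "(p, q) \<in> w" by blast
      then show ?thesis using g[of p q] p sub by auto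
    qed (use g' p in auto)
  qed
  have "card (?S - {1..k}) = card (?S - g ` {1..k})"
    using gS inj by (simp add: card_Diff_subset card_image)
  \<comment> \<open>Any bijection of the remaining rows and columns will do, since at this point
    only some completion has to exist.\<close>
  then obtain h where h: "bij_betw h (?S - {1..k}) (?S - g ` {1..k})"
    using finite_same_card_bij[of "?S - {1..k}" "?S - g ` {1..k}"] by auto
  define v where "v p = (if p \<in> {1..k} then g p else if p \<in> ?S then h p else p)" for p
  have "bij_betw v ({1..k} \<union> (?S - {1..k})) (g ` {1..k} \<union> (?S - g ` {1..k}))"
  proof (rule bij_betw_combine)
    show "bij_betw v {1..k} (g ` {1..k})"
      using inj_on_imp_bij_betw[OF inj] by (rule bij_betw_cong[THEN iffD1, rotated]) (simp add: v_def)
    show "bij_betw v (?S - {1..k}) (?S - g ` {1..k})"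
      using h by (rule bij_betw_cong[THEN iffD1, rotated]) (simp add: v_def)
  qed blast
  moreover have "{1..k} \<union> (?S - {1..k}) = ?S" "g ` {1..k} \<union> (?S - g ` {1..k}) = ?S" using gS by auto
  ultimately have "v permutes ?S" by (intro bij_imp_permutes) (auto simp: v_def)
  moreover have "corner k l v = w"
  proof (intro set_eqI iffI)
    fix x assume "x \<in> corner k l v"
    then obtain p q where x: "x = (p, q)" "p \<in> {1..k}" "q \<in> {1..l}" "g p = q"
      by (auto simp: corner_def v_def)
    then have "p \<in> Domain w" using g'[of p] by (cases "p \<in> Domain w") auto
    then show "x \<in> w" using g x by blast
  next
    fix x assume "x \<in> w"
    then show "x \<in> corner k l v" using sub g by (cases x) (auto simp: corner_def v_def)
  qed
  ultimately show ?thesis using S_inftyI by blast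
qed

text \<open>Shifting commutes with completing, which identifies the stable polynomial of a partial
  permutation with that of its completion.\<close>

lemma is_completion_shift:
  assumes "is_completion k l w v"
  shows "is_completion (m + k) (m + l) (shift_partial m w) (shift_perm m v)"
proof -
  have vS: "v \<in> S_infty" and w: "corner k l v = w"
    and inc: "\<forall>p>k. v p < v (Suc p)" "\<forall>q>l. inv v q < inv v (Suc q)"
    using assms by (auto simp: is_completion_def)
  have inc_shift: "shift_perm m x p < shift_perm m x (Suc p)" 
    if "\<forall>p>j. x p < x (Suc p)" "m + j < p" for x j p
    using that by (auto simp: shift_perm_def Suc_diff_le)
  have "corner (m + k) (m + l) (shift_perm m v) = shift_partial m w"
  proof (intro set_eqI iffI)
    fix x assume "x \<in> corner (m + k) (m + l) (shift_perm m v)"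
    then obtain p q where x: "x = (p, q)" "1 \<le> p" "p \<le> m + k" "1 \<le> q" "q \<le> m + l" "shift_perm m v p = q"
      by (auto simp: corner_def)
    show "x \<in> shift_partial m w"
    proof (cases "p \<le> m")
      case True
      then show ?thesis using x by (auto simp: shift_partial_def shift_perm_def)
    next
      case False
      then have "q = m + v (p - m)" "v (p - m) > 0"
        using x S_infty_pos[OF vS, of "p - m"] by (auto simp: shift_perm_def)
      then have "(p - m, v (p - m)) \<in> w" "x = (m + (p - m), m + v (p - m))"
        using x False unfolding w[symmetric] by (auto simp: corner_def)
      then show ?thesis unfolding shift_partial_def by blast
    qed
  next
    fix x assume "x \<in> shift_partial m w"
    then consider p where "x = (p, p)" "p \<in> {1..m}" | p q where "x = (m + p, m + q)" "(p, q) \<in> w"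
      unfolding shift_partial_def by blast
    then show "x \<in> corner (m + k) (m + l) (shift_perm m v)"
      by cases (auto simp: corner_def shift_perm_def w[symmetric])
  qed
  then show ?thesis
    unfolding is_completion_def inv_shift_perm[OF vS]
    using shift_perm_S_infty[OF vS] inc_shift inc by blast
qed

lemma completion_partial_perm:
  "partial_perm k l w \<Longrightarrow> is_completion k l w (completion k l w)"
  using completion_exists is_completion_completion by blast

lemma stable_groth_partial_eq:
  assumes "partial_perm k l w"
  shows "stable_groth_partial k l w = stable_groth k l (completion k l w)"
proof -
  have "completion (m + k) (m + l) (shift_partial m w) = shift_perm m (completion k l w)" for m
    by (rule completion_eqI[OF is_completion_shift[OF completion_partial_perm[OF assms]]])
  then show ?thesis by (simp add: stable_groth_partial_def stable_groth_def groth_partial_def)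
qed

section \<open>Signs of the expansion coefficients\<close>

lemma representation_cone:
  assumes ind: "\<not> laurent.dependent (grassmannian_basis k l)"
    and \<nu>: "\<nu> \<in> S_infty" and b: "finite_vars k l \<nu> \<in> grassmannian_basis k l"
    and f: "f \<in> grassmannian_cone k l"
  shows "f \<in> laurent.span (grassmannian_basis k l) \<and>
    sign \<nu> * laurent.representation (grassmannian_basis k l) f (finite_vars k l \<nu>) \<ge> 0"
  using f
proof (induction rule: grassmannian_cone.induct)
  case zero
  then show ?case by (simp add: laurent.span_zero laurent.representation_zero)
next
  case (gen \<mu>)
  have S: "\<mu> \<in> S_infty" using gen(1) by (simp add: grassmannian_def)
  show ?case
  proof (cases "finite_vars k l \<mu> = 0")
    case True
    then show ?thesis by (simp add: signed_def laurent.span_zero laurent.representation_zero)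
  next
    case False
    let ?B = "grassmannian_basis k l" and ?E = "finite_vars k l"
    have "?E \<mu> = stable_groth k l \<mu>" using stable_groth_fixes_upto[OF S gen(2)] by simp
    then have B: "?E \<mu> \<in> ?B" using gen(1) False unfolding grassmannian_basis_def by blast
    then have span: "?E \<mu> \<in> laurent.span ?B" by (rule laurent.span_base)
    have "laurent.representation ?B (signed \<mu> (?E \<mu>)) (?E \<nu>) = sign \<mu> * (if ?E \<nu> = ?E \<mu> then 1 else 0)"
      unfolding signed_def laurent.representation_scale[OF ind span] laurent.representation_basis[OF ind B] by simp
    \<comment> \<open>Different Grassmannian permutations can share a polynomial, for example by
      shifting. Their parities agree, so the coefficient of such a generator, multiplied by the sign
      of \<nu>, is 1.\<close>
    moreover have "sign \<nu> = sign \<mu>" if "?E \<nu> = ?E \<mu>" using sign_unique[OF \<nu> S that False] .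
    moreover have "signed \<mu> (?E \<mu>) \<in> laurent.span ?B"
      unfolding signed_def by (rule laurent.span_scale[OF span])
    ultimately show ?thesis by auto
  qed
next
  case (add f g)
  then show ?case
    by (simp add: laurent.span_add laurent.representation_add[OF ind] distrib_left)
qed

lemma alpha_alternates:
  assumes w: "partial_perm k l w" and \<nu>: "grassmannian \<nu>"
  shows "sign (completion k l w) * sign \<nu> * alpha k l w \<nu> \<ge> 0"
proof (cases "alpha k l w \<nu> = 0")
  case False
  let ?B = "grassmannian_basis k l" and ?E = "finite_vars k l" and ?m = "max k l"
  define c where "c = completion k l w"
  have cS: "c \<in> S_infty" using completion_partial_perm[OF w] by (simp add: c_def is_completion_def)
  have \<nu>S: "\<nu> \<in> S_infty" using \<nu> by (simp add: grassmannian_def)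
  let ?c = "shift_perm ?m c" and ?\<nu> = "shift_perm ?m \<nu>"
  have S: "?c \<in> S_infty" "?\<nu> \<in> S_infty" using cS \<nu>S by (simp_all add: shift_perm_S_infty)
  have alpha: "alpha k l w \<nu> = laurent.representation ?B (?E ?c) (?E ?\<nu>)"
    by (simp add: alpha_def stable_groth_partial_eq[OF w] stable_groth_eq cS[unfolded c_def] \<nu>S c_def)
  \<comment> \<open>\<open>representation\<close> is 0 by default for a dependent family, outside
    the span and at vectors that are not in the family. A nonzero value therefore yields linear
    independence and membership of the polynomial of \<nu>.\<close>
  with False have ne: "laurent.representation ?B (?E ?c) (?E ?\<nu>) \<noteq> 0" by simp
  then have b: "?E ?\<nu> \<in> ?B" by (rule laurent.representation_ne_zero)
  have ind: "\<not> laurent.dependent ?B"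
    using ne unfolding laurent.representation_def by (auto split: if_splits)
  have "fixes_upto ?m ?c" by (simp add: shift_perm_def)
  then have K: "signed ?c (?E ?c) \<in> grassmannian_cone k l"
    by (rule signed_finite_vars_cone[OF S(1)])
  have R: "signed ?c (?E ?c) \<in> laurent.span ?B"
    "sign ?\<nu> * laurent.representation ?B (signed ?c (?E ?c)) (?E ?\<nu>) \<ge> 0"
    using representation_cone[OF ind S(2) b K] by auto
  have "?E ?c = of_int (sign ?c) * signed ?c (?E ?c)"
    by (simp add: signed_def mult.assoc[symmetric] of_int_mult[symmetric] del: of_int_mult)
  then have "laurent.representation ?B (?E ?c) (?E ?\<nu>) =
      sign ?c * laurent.representation ?B (signed ?c (?E ?c)) (?E ?\<nu>)"
    using laurent.representation_scale[OF ind R(1), of "sign ?c"] by simp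
  then have eq: "sign ?c * sign ?\<nu> * alpha k l w \<nu> =
      sign ?\<nu> * laurent.representation ?B (signed ?c (?E ?c)) (?E ?\<nu>)"
    unfolding alpha by (simp add: mult.left_commute mult.assoc)
  show ?thesis
    unfolding c_def[symmetric]
    using R(2)[folded eq, unfolded sign_shift_perm[OF cS] sign_shift_perm[OF \<nu>S]] .
qed simp

lemma sign_pow_diff: "sign_pow (int a - c) * sign_pow (int b - c) = (- 1) ^ (a + b)"
  by (auto simp: sign_pow_def)

theorem theorem6p2:
  fixes n :: nat
    and r :: "nat \<Rightarrow> nat"
    and R :: "nat \<Rightarrow> nat \<Rightarrow> nat"
    and \<mu> :: "nat \<Rightarrow> (nat \<times> nat) set"
  assumes "is_rank_array n r R"
    and "\<mu> \<in> grassmannian_lacing_diagrams n r"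
  shows "sign_pow (int (lacing_length n r \<mu>) - codim n r R) * c_coeff n r \<mu> R \<ge> 0"
proof -
  have \<mu>: "grassmannian (lacing_completion r \<mu> j)" if "j \<in> {1..n}" for j
    using assms(2) that by (auto simp: grassmannian_lacing_diagrams_def)
  have parity: "(- 1) ^ lacing_length n r x = (\<Prod>j\<in>{1..n}. sign (lacing_completion r x j))"
    if "\<And>j. j \<in> {1..n} \<Longrightarrow> lacing_completion r x j \<in> S_infty" for x
    using that by (simp add: lacing_length_def power_sum sign_perm_length)
  \<comment> \<open>The codimension occurs in both exponents and drops out modulo 2. What remains is
    the parity of l(\<mu>) + l(w), a product of signs over j that can be matched with the factors
    \<alpha>, so every single summand is nonnegative.\<close>
  have "sign_pow (int (lacing_length n r \<mu>) - codim n r R) *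
      (sign_pow (int (lacing_length n r w) - codim n r R) * lacing_alpha n r w \<mu>) \<ge> 0"
    if "w \<in> lacings_of_rank n r R" for w
  proof -
    have w: "partial_perm (r (j - 1)) (r j) (w j)" if "j \<in> {1..n}" for j
      using \<open>w \<in> _\<close> that by (auto simp: lacings_of_rank_def lacing_diagrams_def)
    have S: "lacing_completion r w j \<in> S_infty" "lacing_completion r \<mu> j \<in> S_infty" if "j \<in> {1..n}" for j
      using completion_partial_perm[OF w[OF that]] \<mu>[OF that]
      by (simp_all add: lacing_completion_def is_completion_def grassmannian_def)
    have "sign_pow (int (lacing_length n r \<mu>) - codim n r R) *
        (sign_pow (int (lacing_length n r w) - codim n r R) * lacing_alpha n r w \<mu>) =
      (- 1) ^ lacing_length n r w * (- 1) ^ lacing_length n r \<mu> * lacing_alpha n r w \<mu>"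
      unfolding power_add[symmetric] sign_pow_diff[of _ "codim n r R", symmetric] by (simp only: mult_ac)
    also have "\<dots> = (\<Prod>j\<in>{1..n}. sign (lacing_completion r w j) * sign (lacing_completion r \<mu> j) *
        alpha (r (j - 1)) (r j) (w j) (lacing_completion r \<mu> j))"
      using parity[of w] parity[of \<mu>] S by (simp only: lacing_alpha_def prod.distrib)
    also have "\<dots> \<ge> 0"
      using alpha_alternates[OF w \<mu>] by (intro prod_nonneg) (simp add: lacing_completion_def)
    finally show ?thesis .
  qed
  then show ?thesis unfolding c_coeff_def sum_distrib_left by (rule sum_nonneg)
qed

end
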